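(* Let $f(\beta,S)$ be the thermodynamic-limit free energy per site of the one-dimensional ferromagnetic quantum Heisenberg model with spin $S$. As $\beta S\to\infty$, $$f(\beta,S)\le C_1\,S^{-\frac12}\beta^{-\frac32}\Bigl(1-\mathcal O\bigl((\beta S)^{-\frac18}(\ln\beta S)^{3/4}\bigr)\Bigr),\qquad C_1:=\frac1{2\pi}\int_{\mathbb R}\ln\bigl(1-e^{-p^2}\bigr)\,dp=\frac{-\zeta(\frac32)}{2\sqrt\pi}.$$
   Context: Let $S\in\{\tfrac12,1,\tfrac32,\dots\}$. For an integer $L\ge 1$ let $\mathscr H_L=\bigotimes_{x=1}^L\mathbb C^{2S+1}$. For $x\in\{1,\dots,L\}$, $\vec S_x=(S^1_x,S^2_x,S^3_x)$ denotes the spin operators acting on the $x$-th tensor factor, i.e. the (self-adjoint) generators of rotations in the $(2S+1)$-dimensional irreducible representation of $SU(2)$, satisfying $[S^j_x,S^k_x]=i\sum_l\epsilon_{jkl}S^l_x$ and $\vec S_x\cdot\vec S_x=S(S+1)$. The Hamiltonian is $$H_L=\sum_{x=1}^{L-1}\bigl(S^2-\vec S_x\cdot\vec S_{x+1}\bigr).$$ For $\beta>0$ the specific free energy is $f_L(\beta,S)=-\frac1{\beta L}\ln\bigl(\mathrm{Tr}\,e^{-\beta H_L}\bigr)$ and its thermodynamic limit (which is well known to exist) is $f(\beta,S)=\lim_{L\to\infty}f_L(\beta,S)$. Here $\zeta$ is the Riemann zeta function. The notation $\mathcal O(\cdot)$ refers to the limit $\beta S\to\infty$, with constants independent of $\beta$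 and $S$: the inequality holds with $\mathcal O(g)$ replaced by $Cg$ for some constant $C>0$ as soon as $\beta S$ is larger than some constant. *)

theory Defs
  imports "HOL-Analysis.Analysis" "Jordan_Normal_Form.Schur_Decomposition"
begin

section \<open>Matrix exponential, trace and tensor product\<close>

definition mat_exp :: "complex mat \<Rightarrow> complex mat" where
  "mat_exp A = Matrix.mat (dim_row A) (dim_row A) (\<lambda>(i, j). \<Sum>k. (A ^\<^sub>m k) $$ (i, j) / fact k)"

definition mat_trace :: "complex mat \<Rightarrow> complex" where
  "mat_trace A = (\<Sum>i<dim_row A. A $$ (i, i))"

text \<open>Kronecker product: with \<open>m = dim_row B\<close>, the row index \<open>i * m + k\<close>
  stands for the tensor product of the basis vectors number \<open>i\<close> and \<open>k\<close>.\<close>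

definition kron :: "complex mat \<Rightarrow> complex mat \<Rightarrow> complex mat" where
  "kron A B = Matrix.mat (dim_row A * dim_row B) (dim_col A * dim_col B)
     (\<lambda>(i, j). A $$ (i div dim_row B, j div dim_col B) * B $$ (i mod dim_row B, j mod dim_col B))"

lemma mat_exp_summable:
  fixes A :: "complex mat"
  assumes A: "A \<in> carrier_mat n n" and "i < n" "j < n"
  shows "summable (\<lambda>k. (A ^\<^sub>m k) $$ (i, j) / fact k)"
proof -
  define M where "M = (\<Sum>i<n. \<Sum>j<n. norm (A $$ (i, j)))"
  have M0: "M \<ge> 0" by (auto simp: M_def intro!: sum_nonneg)
  have M: "norm (A $$ (a, b)) \<le> M" if "a < n" "b < n" for a b
  proof -
    have "norm (A $$ (a, b)) \<le> (\<Sum>j<n. norm (A $$ (a, j)))"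
      using that by (intro member_le_sum) auto
    also have "\<dots> \<le> M" unfolding M_def
      using that by (intro member_le_sum[of a "{..<n}" "\<lambda>i. \<Sum>j<n. norm (A $$ (i, j))"] sum_nonneg) auto
    finally show ?thesis .
  qed
  have bound: "norm ((A ^\<^sub>m k) $$ (a, b)) \<le> (real n * M) ^ k" if "a < n" "b < n" for a b k
    using that
  proof (induction k arbitrary: b)
    case 0
    then show ?case using A by simp
  next
    case (Suc k)
    have C: "A ^\<^sub>m k \<in> carrier_mat n n" using A by simp
    have "(A ^\<^sub>m Suc k) $$ (a, b) = (\<Sum>l = 0..<n. (A ^\<^sub>m k) $$ (a, l) * A $$ (l, b))"
      using A C Suc.prems by (auto simp: scalar_prod_def intro!: sum.cong)
    also have "norm \<dots> \<le> (\<Sum>l = 0..<n. (real n * M) ^ k * M)"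
      using Suc M M0 by (intro sum_norm_le) (auto simp: norm_mult intro!: mult_mono)
    also have "\<dots> = (real n * M) ^ Suc k" by simp
    finally show ?case .
  qed
  have "summable (\<lambda>k. (real n * M) ^ k / fact k)"
    using summable_exp[of "real n * M"] by (simp add: divide_inverse mult.commute)
  then show ?thesis
    by (rule summable_comparison_test')
       (use bound assms in \<open>auto simp: norm_divide intro!: divide_right_mono\<close>)
qed


section \<open>Spin operators\<close>

definition spin_values :: "real set" where
  "spin_values = {real d / 2 | d :: nat. d \<ge> 1}"

definition spin_dim :: "real \<Rightarrow> nat" where
  "spin_dim S = nat \<lfloor>2 * S\<rfloor> + 1"

text \<open>The generators are written in the standard basis of eigenvectors of the third component;
  index \<open>i \<in> {0..2S}\<close> is the eigenvalue \<open>S - i\<close>. In terms of \<open>m = S - (i + 1)\<close>, the entry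
  \<open>(i + 1) * (2 * S - i)\<close> of the raising operator is \<open>S * (S + 1) - m * (m + 1)\<close>. The lemmas below
  check self-adjointness, the commutation relations and the value of the Casimir operator; as the
  dimension is \<open>2S + 1\<close>, this determines the representation up to unitary equivalence.\<close>

definition spin_raise :: "real \<Rightarrow> complex mat" where
  "spin_raise S = Matrix.mat (spin_dim S) (spin_dim S)
     (\<lambda>(i, j). if j = i + 1 then complex_of_real (sqrt (real (i + 1) * (2 * S - real i))) else 0)"

definition spin1 :: "real \<Rightarrow> complex mat" where
  "spin1 S = (1 / 2) \<cdot>\<^sub>m (spin_raise S + mat_adjoint (spin_raise S))"

definition spin2 :: "real \<Rightarrow> complex mat" where
  "spin2 S = (1 / (2 * \<i>)) \<cdot>\<^sub>m (spin_raise S - mat_adjoint (spin_raise S))"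

definition spin3 :: "real \<Rightarrow> complex mat" where
  "spin3 S = mat_diag (spin_dim S) (\<lambda>i. complex_of_real (S - real i))"

lemma mat_adjoint_index:
  fixes A :: "complex mat"
  assumes "i < dim_col A" "j < dim_row A"
  shows "mat_adjoint A $$ (i, j) = cnj (A $$ (j, i))"
  using assms by (simp add: mat_adjoint_def mat_of_rows_def)

lemma mat_adjoint_dim [simp]:
  fixes A :: "complex mat"
  shows "dim_row (mat_adjoint A) = dim_col A" "dim_col (mat_adjoint A) = dim_row A"
  by (simp_all add: mat_adjoint_def)

lemma spin_carrier [simp]:
  "spin1 S \<in> carrier_mat (spin_dim S) (spin_dim S)"
  "spin2 S \<in> carrier_mat (spin_dim S) (spin_dim S)"
  "spin3 S \<in> carrier_mat (spin_dim S) (spin_dim S)"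
  by (auto simp: spin1_def spin2_def spin3_def spin_raise_def)

context
  fixes S :: real and p :: "nat \<Rightarrow> nat \<Rightarrow> complex"
  assumes S: "S \<in> spin_values"
  defines "p \<equiv> (\<lambda>i j. if j = i + 1 then complex_of_real (sqrt (real (i + 1) * (2 * S - real i))) else 0)"
begin

private lemma dim: "real (spin_dim S) = 2 * S + 1"
proof -
  obtain d :: nat where "S = real d / 2" using S by (auto simp: spin_values_def)
  then have "2 * S = of_int (int d)" by simp
  then have "\<lfloor>2 * S\<rfloor> = int d" by (simp only: floor_of_int)
  then show ?thesis using \<open>2 * S = of_int (int d)\<close> by (simp add: spin_dim_def)
qed

private lemma index:
  assumes "i < spin_dim S" "j < spin_dim S"
  shows "spin1 S $$ (i, j) = (p i j + p j i) / 2"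
    and "spin2 S $$ (i, j) = (p i j - p j i) / (2 * \<i>)"
    and "spin3 S $$ (i, j) = (if i = j then complex_of_real (S - real i) else 0)"
  using assms
  by (simp_all add: spin1_def spin2_def spin3_def spin_raise_def p_def mat_adjoint_index mat_diag_def)

private lemma sum_upper:
  assumes "i < spin_dim S" "j < spin_dim S"
  shows "(\<Sum>k<spin_dim S. p i k * p j k) =
    (if i = j then complex_of_real (real (i + 1) * (2 * S - real i)) else 0)"
proof -
  have "p i k * p j k = (if k = i + 1 then if i = j then
      complex_of_real (real (i + 1) * (2 * S - real i)) else 0 else 0)" if "k < spin_dim S" for k
  proof (cases "k = i + 1")
    case True
    then have "2 * S - real i \<ge> 0" using dim that by linarith
    then show ?thesis using True by (simp add: p_def flip: of_real_mult)
  qed (simp add: p_def)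
  then have "(\<Sum>k<spin_dim S. p i k * p j k) = (\<Sum>k<spin_dim S. if k = i + 1 then if i = j then
      complex_of_real (real (i + 1) * (2 * S - real i)) else 0 else 0)"
    by (intro sum.cong) auto
  also have "\<dots> = (if i = j then complex_of_real (real (i + 1) * (2 * S - real i)) else 0)"
  proof (cases "i + 1 < spin_dim S")
    case False
    then have "real i = 2 * S" using dim assms by linarith
    then have "complex_of_real (real (i + 1) * (2 * S - real i)) = 0" by simp
    then show ?thesis using False by (simp only: sum.delta finite_lessThan lessThan_iff) auto
  qed (simp add: sum.delta)
  finally show ?thesis .
qed

private lemma sum_lower:
  assumes "i < spin_dim S" "j < spin_dim S"
  shows "(\<Sum>k<spin_dim S. p k i * p k j) =
    (if i = j then complex_of_real (real i * (2 * S - real i + 1)) else 0)"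
proof -
  have "p k i * p k j = (if k = i - 1 then if i = j then
      complex_of_real (real i * (2 * S - real i + 1)) else 0 else 0)" if "k < spin_dim S" for k
  proof (cases "i = k + 1")
    case True
    then have "2 * S - real k \<ge> 0" using dim assms by linarith
    then have "sqrt (real (k + 1) * (2 * S - real k)) * sqrt (real (k + 1) * (2 * S - real k))
        = real (k + 1) * (2 * S - real k)"
      by (intro real_sqrt_mult_self[THEN trans] abs_of_nonneg mult_nonneg_nonneg) auto
    also have "\<dots> = real i * (2 * S - real i + 1)" using True by simp
    finally have "sqrt (real (k + 1) * (2 * S - real k)) * sqrt (real (k + 1) * (2 * S - real k))
        = real i * (2 * S - real i + 1)" .
    then show ?thesis using True by (auto simp: p_def simp flip: of_real_mult)
  next
    case False
    then show ?thesis by (cases i) (auto simp: p_def)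
  qed
  then have "(\<Sum>k<spin_dim S. p k i * p k j) = (\<Sum>k<spin_dim S. if k = i - 1 then if i = j then
      complex_of_real (real i * (2 * S - real i + 1)) else 0 else 0)"
    by (intro sum.cong) auto
  moreover have "i - 1 < spin_dim S" using assms by linarith
  ultimately show ?thesis by (simp only: sum.delta finite_lessThan lessThan_iff) simp
qed

private lemma mult_index:
  assumes "A \<in> carrier_mat (spin_dim S) (spin_dim S)" "B \<in> carrier_mat (spin_dim S) (spin_dim S)"
    and "i < spin_dim S" "j < spin_dim S"
  shows "(A * B) $$ (i, j) = (\<Sum>k<spin_dim S. A $$ (i, k) * B $$ (k, j))"
  using assms by (auto simp: scalar_prod_def lessThan_atLeast0 intro!: sum.cong)

lemma spin_self_adjoint:
  "mat_adjoint (spin1 S) = spin1 S"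
  "mat_adjoint (spin2 S) = spin2 S"
  "mat_adjoint (spin3 S) = spin3 S"
  using spin_carrier[of S]
  by (auto intro!: eq_matI simp: mat_adjoint_index index p_def simp del: spin_carrier)

lemma spin_commutator:
  "spin1 S * spin2 S - spin2 S * spin1 S = \<i> \<cdot>\<^sub>m spin3 S"
  "spin2 S * spin3 S - spin3 S * spin2 S = \<i> \<cdot>\<^sub>m spin1 S"
  "spin3 S * spin1 S - spin1 S * spin3 S = \<i> \<cdot>\<^sub>m spin2 S"
proof -
  note c = spin_carrier[of S]
  have cd: "dim_row (spin1 S) = spin_dim S" "dim_col (spin1 S) = spin_dim S"
    "dim_row (spin2 S) = spin_dim S" "dim_col (spin2 S) = spin_dim S"
    "dim_row (spin3 S) = spin_dim S" "dim_col (spin3 S) = spin_dim S"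
    using c by (blast dest: carrier_matD)+
  show "spin1 S * spin2 S - spin2 S * spin1 S = \<i> \<cdot>\<^sub>m spin3 S"
  proof (rule eq_matI)
    fix i j assume "i < dim_row (\<i> \<cdot>\<^sub>m spin3 S)" "j < dim_col (\<i> \<cdot>\<^sub>m spin3 S)"
    then have ij: "i < spin_dim S" "j < spin_dim S" by (simp_all add: cd)
    have "(spin1 S * spin2 S - spin2 S * spin1 S) $$ (i, j)
        = (\<Sum>k<spin_dim S. (p i k + p k i) / 2 * ((p k j - p j k) / (2 * \<i>)))
          - (\<Sum>k<spin_dim S. (p i k - p k i) / (2 * \<i>) * ((p k j + p j k) / 2))"
      using ij by (simp add: cd mult_index[OF c(1) c(2)] mult_index[OF c(2) c(1)] index del: index_mult_mat(1))
    also have "\<dots> = (\<Sum>k<spin_dim S. (p k i * p k j) / (2 * \<i>) - (p i k * p j k) / (2 * \<i>))"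
      unfolding sum_subtractf[symmetric] by (intro sum.cong) (auto simp: field_simps)
    also have "\<dots> = (\<Sum>k<spin_dim S. p k i * p k j) / (2 * \<i>) - (\<Sum>k<spin_dim S. p i k * p j k) / (2 * \<i>)"
      unfolding sum_subtractf sum_divide_distrib ..
    also have "\<dots> = (\<i> \<cdot>\<^sub>m spin3 S) $$ (i, j)"
      using ij by (simp add: sum_upper sum_lower index cd) (auto simp: field_simps)
    finally show "(spin1 S * spin2 S - spin2 S * spin1 S) $$ (i, j) = (\<i> \<cdot>\<^sub>m spin3 S) $$ (i, j)" .
  qed (simp_all add: cd)
  have diag: "(A * spin3 S) $$ (i, j) = A $$ (i, j) * complex_of_real (S - real j)"
      "(spin3 S * A) $$ (i, j) = complex_of_real (S - real i) * A $$ (i, j)"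
    if "A \<in> carrier_mat (spin_dim S) (spin_dim S)" "i < spin_dim S" "j < spin_dim S" for A i j
    using that by (simp_all add: spin3_def mat_diag_mult_left mat_diag_mult_right del: index_mult_mat(1))
  show "spin2 S * spin3 S - spin3 S * spin2 S = \<i> \<cdot>\<^sub>m spin1 S"
    "spin3 S * spin1 S - spin1 S * spin3 S = \<i> \<cdot>\<^sub>m spin2 S"
    by (rule eq_matI; auto simp: cd diag index p_def field_simps simp del: index_mult_mat(1))+
qed

lemma spin_casimir:
  "spin1 S * spin1 S + spin2 S * spin2 S + spin3 S * spin3 S
     = complex_of_real (S * (S + 1)) \<cdot>\<^sub>m 1\<^sub>m (spin_dim S)" (is "?L = ?R")
proof (rule eq_matI)
  note c = spin_carrier[of S]
  have cd: "dim_row (spin1 S) = spin_dim S" "dim_col (spin1 S) = spin_dim S"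
    "dim_row (spin2 S) = spin_dim S" "dim_col (spin2 S) = spin_dim S"
    "dim_row (spin3 S) = spin_dim S" "dim_col (spin3 S) = spin_dim S"
    using c by (blast dest: carrier_matD)+
  show "dim_row ?L = dim_row ?R" "dim_col ?L = dim_col ?R" by (simp_all add: cd)
  fix i j assume "i < dim_row ?R" "j < dim_col ?R"
  then have ij: "i < spin_dim S" "j < spin_dim S" by simp_all
  have 3: "(spin3 S * spin3 S) $$ (i, j) = (if i = j then complex_of_real ((S - real i)\<^sup>2) else 0)"
    using ij by (simp add: spin3_def mat_diag_diag power2_eq_square del: index_mult_mat(1)) (simp add: mat_diag_def)
  have "?L $$ (i, j) = (\<Sum>k<spin_dim S. (p i k + p k i) / 2 * ((p k j + p j k) / 2))
       + (\<Sum>k<spin_dim S. (p i k - p k i) / (2 * \<i>) * ((p k j - p j k) / (2 * \<i>)))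
       + (spin3 S * spin3 S) $$ (i, j)"
    using ij by (simp add: cd mult_index[OF c(1) c(1)] mult_index[OF c(2) c(2)] index del: index_mult_mat(1))
  also have "\<dots> = (\<Sum>k<spin_dim S. (p k i * p k j) / 2 + (p i k * p j k) / 2) + (spin3 S * spin3 S) $$ (i, j)"
    unfolding sum.distrib[symmetric] by (intro arg_cong2[where f = "(+)"] refl, intro sum.cong refl) (simp add: field_simps)
  also have "\<dots> = (\<Sum>k<spin_dim S. p k i * p k j) / 2 + (\<Sum>k<spin_dim S. p i k * p j k) / 2
       + (spin3 S * spin3 S) $$ (i, j)"
    by (simp add: sum.distrib sum_divide_distrib)
  also have "\<dots> = ?R $$ (i, j)"
    unfolding 3 using ij by (simp add: sum_upper sum_lower) (auto simp: field_simps power2_eq_square)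
  finally show "?L $$ (i, j) = ?R $$ (i, j)" .
qed

end


section \<open>The Heisenberg chain and its free energy\<close>

definition site_op :: "real \<Rightarrow> nat \<Rightarrow> nat \<Rightarrow> complex mat \<Rightarrow> complex mat" where
  "site_op S L x A = kron (1\<^sub>m (spin_dim S ^ (x - 1))) (kron A (1\<^sub>m (spin_dim S ^ (L - x))))"

definition spin_dot :: "real \<Rightarrow> nat \<Rightarrow> nat \<Rightarrow> nat \<Rightarrow> complex mat" where
  "spin_dot S L x y =
     site_op S L x (spin1 S) * site_op S L y (spin1 S) +
     site_op S L x (spin2 S) * site_op S L y (spin2 S) +
     site_op S L x (spin3 S) * site_op S L y (spin3 S)"

text \<open>The sum over the bonds \<open>(x, x + 1)\<close>, \<open>1 \<le> x \<le> L - 1\<close>, is taken entrywise because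
  the type of matrices of unspecified size is not an additive monoid.\<close>

definition heisenberg_H :: "nat \<Rightarrow> real \<Rightarrow> complex mat" where
  "heisenberg_H L S = Matrix.mat (spin_dim S ^ L) (spin_dim S ^ L)
     (\<lambda>ij. \<Sum>x\<in>{1..<L}. (complex_of_real (S\<^sup>2) \<cdot>\<^sub>m 1\<^sub>m (spin_dim S ^ L) - spin_dot S L x (x + 1)) $$ ij)"

definition free_energy_fin :: "nat \<Rightarrow> real \<Rightarrow> real \<Rightarrow> real" where
  "free_energy_fin L \<beta> S =
     - (1 / (\<beta> * real L)) * ln (Re (mat_trace (mat_exp (complex_of_real (- \<beta>) \<cdot>\<^sub>m heisenberg_H L S))))"

definition free_energy :: "real \<Rightarrow> real \<Rightarrow> real" where
  "free_energy \<beta> S = lim (\<lambda>L. free_energy_fin L \<beta> S)"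


section \<open>Constants\<close>

text \<open>The Riemann zeta function on the half-line \<open>s > 1\<close>, where its Dirichlet series converges.\<close>

definition zeta_real :: "real \<Rightarrow> real" where
  "zeta_real s = (\<Sum>n. 1 / real (Suc n) powr s)"

definition C1 :: real where
  "C1 = 1 / (2 * pi) * (LINT p|lborel. ln (1 - exp (- p\<^sup>2)))"

end

theory Submission
  imports Defs "HOL-Library.Multiset" "HOL-Probability.Distributions" "HOL-Real_Asymp.Real_Asymp"
begin

text \<open>
  The bound comes from a lower bound on the partition function. If the vectors \<open>v\<close> satisfy
  Bessel's inequality, then \<open>Tr exp (-\<beta> H)\<close> is at least the sum of \<open>\<langle>v, exp (-\<beta> H) v\<rangle>\<close>, hence, by
  Jensen's inequality, at least the sum of \<open>|v|\<^sup>2 exp (-\<beta> \<langle>v, H v\<rangle> / |v|\<^sup>2)\<close>. The trial vectors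
  are products of spin waves: powers of \<open>\<Sum>x. u k x S\<^sup>-\<^sub>x\<close> with sine modes \<open>u k\<close> on a block of \<open>l\<close>
  sites, applied to the ferromagnetic ground state. Such a vector is the image, under a
  contraction, of a bosonic occupation number state, and the contraction does not increase the
  energy of a bond: both energies are sums of squares of the same differences, with smaller
  weights on the spin side. So \<open>H\<close> is replaced by free bosons with Dirichlet boundary conditions
  and dispersion at most \<open>S (\<pi> k / l)\<^sup>2\<close>; the norm lost is of order \<open>N\<^sup>2 / l\<close> for \<open>N\<close> bosons, and
  by Markov's inequality one may restrict to \<open>N = O(l\<^sup>2 / \<beta> S)\<close>. Blocks are separated by an
  unflipped spin, so the trial families of the blocks can be tensored. With \<open>b = \<beta> S\<close>, the
  relative errors are \<open>l\<^sup>3 / b\<^sup>2\<close> from the norm and \<open>b\<^bsup>1/2\<^esup> ln b / l\<close> from the boundary; they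
  balance at \<open>l = b\<^bsup>5/8\<^esup> (ln b)\<^bsup>1/4\<^esup>\<close>.
\<close>

section \<open>Spectral theorem and trace inequalities\<close>

text \<open>The block length is squeezed from two sides. The lowest modes dominate the occupation,
  so a block holds about \<open>l^2 / b\<close> bosons and the norm loss \<open>N^2 / l\<close>
  becomes \<open>l^3 / b^2\<close>, which keeps \<open>l\<close> far below \<open>b\<close> to the
  power 2/3; the boundary loss keeps \<open>l\<close> far above the thermal length
  \<open>sqrt b\<close>. So one family of spin waves cannot serve an arbitrarily long chain, and the
  chain is cut into blocks whose length depends on \<open>b\<close> alone. The contraction
  multiplies a boson amplitude by the square root of \<open>nu / mu\<close>, the ratio of the spin
  weight and the boson weight of a configuration. Images of orthogonal states need not be
  orthogonal, but Bessel's inequality survives, and the Peierls bound is arranged to ask for no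
  more. \<open>free_energy\<close> is a \<open>lim\<close>, which carries information only if the
  sequence converges. Convergence comes from Fekete's lemma: dropping the nonnegative energy of a
  junction bond makes \<open>ln Z\<close> subadditive, and the state without flips, of energy zero,
  makes it nonnegative.\<close>

definition ip :: "'a set \<Rightarrow> ('a \<Rightarrow> real) \<Rightarrow> ('a \<Rightarrow> real) \<Rightarrow> real" where
  "ip I f g = (\<Sum>x\<in>I. f x * g x)"

abbreviation nsq :: "'a set \<Rightarrow> ('a \<Rightarrow> real) \<Rightarrow> real" where
  "nsq I f \<equiv> ip I f f"

definition mv :: "'a set \<Rightarrow> ('a \<Rightarrow> 'a \<Rightarrow> real) \<Rightarrow> ('a \<Rightarrow> real) \<Rightarrow> 'a \<Rightarrow> real" where
  "mv I a v = (\<lambda>x. \<Sum>y\<in>I. a x y * v y)"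

definition qf :: "'a set \<Rightarrow> ('a \<Rightarrow> 'a \<Rightarrow> real) \<Rightarrow> ('a \<Rightarrow> real) \<Rightarrow> real" where
  "qf I a v = (\<Sum>x\<in>I. \<Sum>y\<in>I. v x * a x y * v y)"

definition orthonormal_fam :: "'a set \<Rightarrow> 'j set \<Rightarrow> ('j \<Rightarrow> 'a \<Rightarrow> real) \<Rightarrow> bool" where
  "orthonormal_fam I J u \<longleftrightarrow> (\<forall>j\<in>J. \<forall>k\<in>J. ip I (u j) (u k) = (if j = k then 1 else 0))"

lemma ip_commute: "ip I f g = ip I g f"
  by (simp add: ip_def mult.commute)

lemma ip_add_left: "ip I (\<lambda>x. f x + g x) h = ip I f h + ip I g h"
  by (simp add: ip_def sum.distrib algebra_simps)

lemma ip_diff_left: "ip I (\<lambda>x. f x - g x) h = ip I f h - ip I g h"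
  by (simp add: ip_def sum_subtractf algebra_simps)

lemma ip_scale_left: "ip I (\<lambda>x. c * f x) h = c * ip I f h"
  by (simp add: ip_def sum_distrib_left algebra_simps)

lemma ip_sum_left: "ip I (\<lambda>x. \<Sum>j\<in>J. f j x) h = (\<Sum>j\<in>J. ip I (f j) h)"
  unfolding ip_def sum_distrib_right by (rule sum.swap)

lemma ip_self_nonneg: "nsq I f \<ge> 0"
  by (auto simp: ip_def intro!: sum_nonneg)

lemma ip_zero:
  assumes "finite I" "nsq I f = 0"
  shows "\<forall>x\<in>I. f x = 0"
  using assms by (simp add: ip_def sum_nonneg_eq_0_iff)

lemma qf_eq_ip: "qf I a v = ip I v (mv I a v)"
  by (simp add: qf_def ip_def mv_def sum_distrib_left algebra_simps)

lemma ip_mv_symmetric: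
  assumes "\<And>x y. x \<in> I \<Longrightarrow> y \<in> I \<Longrightarrow> a x y = a y x"
  shows "ip I v (mv I a w) = ip I w (mv I a v)"
proof -
  have "ip I v (mv I a w) = (\<Sum>x\<in>I. \<Sum>y\<in>I. v x * a x y * w y)"
    by (simp add: ip_def mv_def sum_distrib_left algebra_simps)
  also have "\<dots> = (\<Sum>y\<in>I. \<Sum>x\<in>I. v x * a x y * w y)" by (rule sum.swap)
  also have "\<dots> = ip I w (mv I a v)"
    using assms by (auto simp: ip_def mv_def sum_distrib_left algebra_simps intro!: sum.cong)
  finally show ?thesis .
qed

lemma bessel_residual:
  assumes "finite J" "orthonormal_fam I J u"
  shows "nsq I (\<lambda>x. v x - (\<Sum>j\<in>J. ip I v (u j) * u j x))
    = nsq I v - (\<Sum>j\<in>J. (ip I v (u j))\<^sup>2)"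
    and "k \<in> J \<Longrightarrow> ip I (\<lambda>x. v x - (\<Sum>j\<in>J. ip I v (u j) * u j x)) (u k) = 0"
proof -
  let ?s = "\<lambda>x. \<Sum>j\<in>J. ip I v (u j) * u j x"
  let ?r = "\<lambda>x. v x - ?s x"
  have orth: "ip I ?r (u k) = 0" if "k \<in> J" for k
  proof -
    have "ip I ?r (u k) = ip I v (u k) - (\<Sum>j\<in>J. ip I v (u j) * ip I (u j) (u k))"
      by (simp add: ip_diff_left ip_sum_left ip_scale_left)
    also have "(\<Sum>j\<in>J. ip I v (u j) * ip I (u j) (u k)) = (\<Sum>j\<in>J. if j = k then ip I v (u j) else 0)"
      using assms that by (intro sum.cong) (auto simp: orthonormal_fam_def)
    finally show ?thesis using assms that by (simp add: sum.delta')
  qed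
  then show "k \<in> J \<Longrightarrow> ip I ?r (u k) = 0" .
  have "ip I ?r ?s = (\<Sum>j\<in>J. ip I v (u j) * ip I (u j) ?r)"
    by (subst ip_commute) (simp add: ip_sum_left ip_scale_left)
  also have "\<dots> = 0" using orth by (simp add: ip_commute)
  finally have "ip I ?r ?s = 0" .
  then have "nsq I ?r = ip I v ?r"
    by (subst ip_diff_left) (simp add: ip_commute)
  also have "\<dots> = nsq I v - (\<Sum>j\<in>J. ip I v (u j) * ip I v (u j))"
    by (subst ip_commute) (simp add: ip_diff_left ip_sum_left ip_scale_left ip_commute)
  finally show "nsq I ?r = nsq I v - (\<Sum>j\<in>J. (ip I v (u j))\<^sup>2)"
    by (simp add: power2_eq_square)
qed

lemma bessel:
  assumes "finite J" "orthonormal_fam I J u"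
  shows "(\<Sum>j\<in>J. (ip I v (u j))\<^sup>2) \<le> nsq I v"
  using bessel_residual(1)[OF assms, of v] ip_self_nonneg[of I "\<lambda>x. v x - (\<Sum>j\<in>J. ip I v (u j) * u j x)"]
  by simp

lemma ip_unit:
  assumes "finite I" "x \<in> I"
  shows "ip I (\<lambda>y. if y = x then 1 else 0) f = f x"
  using assms by (simp add: ip_def if_distrib[of "\<lambda>t. t * _"] cong: if_cong)

text \<open>Each summand is the squared distance of the unit vector at \<open>x\<close> from the
  span of the \<open>u j\<close>, so the sum is a codimension. If it is zero the family is complete;
  if it is positive some unit vector lies outside the span.\<close>

lemma orthonormal_fam_trace:
  assumes "finite I" "orthonormal_fam I J u"
  shows "(\<Sum>x\<in>I. 1 - (\<Sum>j\<in>J. (u j x)\<^sup>2)) = real (card I) - real (card J)"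
proof -
  have "(\<Sum>x\<in>I. \<Sum>j\<in>J. (u j x)\<^sup>2) = (\<Sum>j\<in>J. nsq I (u j))"
    by (subst sum.swap) (simp add: ip_def power2_eq_square)
  also have "\<dots> = real (card J)"
    using assms by (simp add: orthonormal_fam_def)
  finally show ?thesis by (simp add: sum_subtractf)
qed

lemma orthonormal_fam_complete:
  assumes fin: "finite I" "finite J" and u: "orthonormal_fam I J u" and card: "card J = card I"
    and x: "x \<in> I" and y: "y \<in> I"
  shows "(\<Sum>j\<in>J. u j x * u j y) = (if x = y then 1 else 0)"
proof -
  let ?e = "\<lambda>y. if y = x then 1 else 0 :: real"
  let ?r = "\<lambda>y. ?e y - (\<Sum>j\<in>J. ip I ?e (u j) * u j y)"
  have res: "ip I (\<lambda>y. (if y = z then 1 else 0) - (\<Sum>j\<in>J. ip I (\<lambda>y. if y = z then 1 else 0) (u j) * u j y))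
      (\<lambda>y. (if y = z then 1 else 0) - (\<Sum>j\<in>J. ip I (\<lambda>y. if y = z then 1 else 0) (u j) * u j y))
     = 1 - (\<Sum>j\<in>J. (u j z)\<^sup>2)" if "z \<in> I" for z
    unfolding bessel_residual(1)[OF fin(2) u] using fin(1) that by (simp add: ip_unit)
  have nn: "1 - (\<Sum>j\<in>J. (u j z)\<^sup>2) \<ge> 0" if "z \<in> I" for z
    unfolding res[OF that, symmetric] by (rule ip_self_nonneg)
  have "(\<Sum>z\<in>I. 1 - (\<Sum>j\<in>J. (u j z)\<^sup>2)) = 0"
    using orthonormal_fam_trace[OF fin(1) u] card by simp
  then have "1 - (\<Sum>j\<in>J. (u j x)\<^sup>2) = 0"
    using nn x fin(1) by (subst (asm) sum_nonneg_eq_0_iff) auto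
  then have "nsq I ?r = 0" using res[OF x] by simp
  then have "\<forall>y\<in>I. ?r y = 0" using fin(1) ip_zero by blast
  then have "?r y = 0" using y by blast
  then show ?thesis unfolding ip_unit[OF fin(1) x] by (auto split: if_splits)
qed

text \<open>The first-order condition at a maximum: for small \<open>t\<close> a linear term would
  outweigh the quadratic one.\<close>

lemma linear_coeff_zero:
  fixes A B :: real
  assumes "\<And>t. t * A + t\<^sup>2 * B \<le> 0"
  shows "A = 0"
proof (rule ccontr)
  assume "A \<noteq> 0"
  \<comment> \<open>At \<open>t = s * A\<close> the expression equals
    \<open>s * A^2 * (1 + s * B)\<close>, which is positive for nonzero \<open>A\<close> because
    \<open>s * |B| < 1\<close>.\<close>
  define s where "s = 1 / (\<bar>B\<bar> + 1)"
  have s: "s > 0" "s * \<bar>B\<bar> < 1" by (auto simp: s_def field_simps)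
  have "(s * A) * A + (s * A)\<^sup>2 * B \<le> 0" by (rule assms)
  then have "s * A\<^sup>2 * (1 + s * B) \<le> 0" by (simp add: power2_eq_square algebra_simps)
  moreover have "1 + s * B > 0"
    using s by (cases "B < 0") (auto simp: add_pos_nonneg)
  moreover have "s * A\<^sup>2 > 0" using s \<open>A \<noteq> 0\<close> by simp
  ultimately show False using mult_pos_pos[of "s * A\<^sup>2" "1 + s * B"] by linarith
qed

text \<open>Vectors are functions on an arbitrary type. Since they vanish off \<open>I\<close>, the
  sphere is a closed part of a product of intervals and singletons, and Tychonoff's theorem replaces
  finite-dimensional compactness.\<close>

lemma compact_unit_sphere_orth:
  fixes u :: "nat \<Rightarrow> 'a \<Rightarrow> real"
  assumes "finite I"
  shows "compact {v. (\<forall>x. x \<notin> I \<longrightarrow> v x = 0) \<and> nsq I v = 1 \<and> (\<forall>j<k. ip I v (u j) = 0)}"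
proof -
  let ?B = "PiE UNIV (\<lambda>x. if x \<in> I then {-1..1} else {0 :: real})"
  have "compactin (product_topology (\<lambda>_. euclidean) UNIV) ?B"
    by (subst compactin_PiE) auto
  then have B: "compact ?B" by (simp add: euclidean_product_topology)
  have "closed {v. nsq I v = 1}" unfolding ip_def
    by (intro closed_Collect_eq continuous_intros continuous_on_product_coordinates)
  moreover have "closed {v. ip I v (u j) = 0}" for j unfolding ip_def
    by (intro closed_Collect_eq continuous_intros continuous_on_product_coordinates)
  ultimately have "compact (?B \<inter> ({v. nsq I v = 1} \<inter> (\<Inter>j\<in>{..<k}. {v. ip I v (u j) = 0})))"
    by (intro compact_Int_closed[OF B] closed_Int closed_INT) auto
  also have "?B \<inter> ({v. nsq I v = 1} \<inter> (\<Inter>j\<in>{..<k}. {v. ip I v (u j) = 0}))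
     = {v. (\<forall>x. x \<notin> I \<longrightarrow> v x = 0) \<and> nsq I v = 1 \<and> (\<forall>j<k. ip I v (u j) = 0)}" (is "?L = ?R")
  proof (intro equalityI subsetI)
    fix v assume v: "v \<in> ?R"
    have "v x \<in> {-1..1}" if "x \<in> I" for x
    proof -
      have "v x * v x \<le> nsq I v" unfolding ip_def using assms that
        by (intro member_le_sum) auto
      then have "(v x)\<^sup>2 \<le> 1" using v by (simp add: power2_eq_square)
      then have "\<bar>v x\<bar> \<le> 1" by (simp only: abs_square_le_1)
      then show ?thesis by auto
    qed
    with v show "v \<in> ?L" by auto
  qed (auto simp: PiE_def Pi_def split: if_splits)
  finally show ?thesis .
qed

text \<open>A maximiser of the quadratic form among unit vectors orthogonal to the
  \<open>u j\<close> is an eigenvector. Stationarity tests only directions orthogonal to the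
  \<open>u j\<close>, but the residual \<open>g\<close> is itself such a direction, because
  \<open>a\<close> is symmetric and the \<open>u j\<close> are eigenvectors; testing
  \<open>g\<close> against itself gives zero.\<close>

lemma eigenvector_extend:
  fixes u :: "nat \<Rightarrow> 'a \<Rightarrow> real"
  assumes fin: "finite I" and sym: "\<And>x y. x \<in> I \<Longrightarrow> y \<in> I \<Longrightarrow> a x y = a y x"
    and u: "orthonormal_fam I {..<k} u" and k: "k < card I"
    and eig: "\<And>j x. j < k \<Longrightarrow> x \<in> I \<Longrightarrow> mv I a (u j) x = l j * u j x"
  shows "\<exists>w \<mu>. nsq I w = 1 \<and> (\<forall>j<k. ip I w (u j) = 0) \<and> (\<forall>x\<in>I. mv I a w x = \<mu> * w x)"
proof -
  define K where "K = {v. (\<forall>x. x \<notin> I \<longrightarrow> v x = 0) \<and> nsq I v = 1 \<and> (\<forall>j<k. ip I v (u j) = 0)}"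
  \<comment> \<open>Truncation to \<open>I\<close> goes along with scaling, since membership in the
    compact set \<open>K\<close> requires vanishing off \<open>I\<close>.\<close>
  have normalise: "\<exists>c>0. c\<^sup>2 * nsq I w = 1 \<and> (\<lambda>x. if x \<in> I then c * w x else 0) \<in> K"
    if w: "\<And>j. j < k \<Longrightarrow> ip I w (u j) = 0" "nsq I w > 0" for w
  proof (intro exI conjI)
    define c where "c = 1 / sqrt (nsq I w)"
    show "c > 0" using w(2) by (simp add: c_def)
    show c2: "c\<^sup>2 * nsq I w = 1" using w(2) by (simp add: c_def power_divide)
    have eq: "ip I (\<lambda>x. if x \<in> I then c * w x else 0) f = c * ip I w f" for f
      by (auto simp: ip_def sum_distrib_left intro!: sum.cong)
    have "nsq I (\<lambda>x. if x \<in> I then c * w x else 0) = 1"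
      unfolding eq by (subst ip_commute, unfold eq) (use c2 in \<open>simp add: power2_eq_square\<close>)
    then show "(\<lambda>x. if x \<in> I then c * w x else 0) \<in> K"
      using w(1) by (auto simp: K_def eq)
  qed
  have "K \<noteq> {}"
  proof -
    have "(\<Sum>x\<in>I. 1 - (\<Sum>j<k. (u j x)\<^sup>2)) > 0"
      using orthonormal_fam_trace[OF fin u] k by simp
    then obtain x where x: "x \<in> I" "1 - (\<Sum>j<k. (u j x)\<^sup>2) > 0"
      by (meson not_less sum_nonpos)
    let ?e = "\<lambda>y. if y = x then 1 else 0 :: real"
    show ?thesis
      using normalise[of "\<lambda>y. ?e y - (\<Sum>j<k. ip I ?e (u j) * u j y)"]
        bessel_residual[OF finite_lessThan u, where v = ?e] x fin by (auto simp: ip_unit)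
  qed
  moreover have "compact K" unfolding K_def by (rule compact_unit_sphere_orth[OF fin])
  moreover have "continuous_on K (qf I a)" unfolding qf_def
    by (intro continuous_intros continuous_on_subset[OF continuous_on_product_coordinates]) auto
  ultimately obtain v where v: "v \<in> K" and max: "\<And>w. w \<in> K \<Longrightarrow> qf I a w \<le> qf I a v"
    using continuous_attains_sup by metis
  define \<mu> where "\<mu> = qf I a v"
  have vK: "nsq I v = 1" "\<And>j. j < k \<Longrightarrow> ip I v (u j) = 0"
    using v by (auto simp: K_def)
  have bound: "qf I a w \<le> \<mu> * nsq I w" if w: "\<And>j. j < k \<Longrightarrow> ip I w (u j) = 0" for w
  proof (cases "nsq I w > 0")
    case True
    obtain c where c: "c > 0" "c\<^sup>2 * nsq I w = 1" "(\<lambda>x. if x \<in> I then c * w x else 0) \<in> K"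
      using normalise[OF w True] by blast
    have "c\<^sup>2 * qf I a w = qf I a (\<lambda>x. if x \<in> I then c * w x else 0)"
      unfolding qf_def sum_distrib_left
      by (intro sum.cong) (auto simp: power2_eq_square algebra_simps)
    also have "\<dots> \<le> \<mu>" unfolding \<mu>_def by (rule max[OF c(3)])
    also have "\<mu> = c\<^sup>2 * (\<mu> * nsq I w)" using c(2) by (metis mult.left_commute mult.right_neutral)
    finally show ?thesis using c(1) by simp
  next
    case False
    then have z: "nsq I w = 0" using ip_self_nonneg[of I w] by linarith
    then have "\<forall>x\<in>I. w x = 0" by (rule ip_zero[OF fin])
    then show ?thesis using z by (simp add: qf_def)
  qed
  have stat: "ip I w (\<lambda>x. mv I a v x - \<mu> * v x) = 0" if w: "\<And>j. j < k \<Longrightarrow> ip I w (u j) = 0" for w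
  proof -
    define A where "A = 2 * ip I w (mv I a v) - 2 * \<mu> * ip I w v"
    define B where "B = qf I a w - \<mu> * nsq I w"
    have "t * A + t\<^sup>2 * B \<le> 0" for t
    proof -
      have "qf I a (\<lambda>x. v x + t * w x) \<le> \<mu> * nsq I (\<lambda>x. v x + t * w x)"
        using w vK by (intro bound) (auto simp: ip_add_left ip_scale_left)
      moreover have "mv I a (\<lambda>x. v x + t * w x) = (\<lambda>x. mv I a v x + t * mv I a w x)"
        by (auto simp: mv_def sum.distrib sum_distrib_left algebra_simps)
      then have "qf I a (\<lambda>x. v x + t * w x) = \<mu> + 2 * t * ip I w (mv I a v) + t\<^sup>2 * qf I a w"
        using ip_mv_symmetric[of I a v w] sym
        by (simp add: qf_eq_ip \<mu>_def ip_add_left ip_scale_left ip_commute[of I _ "\<lambda>x. _ x + _ x"]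
            power2_eq_square algebra_simps)
           (simp add: ip_commute)
      moreover have "nsq I (\<lambda>x. v x + t * w x) = 1 + 2 * t * ip I w v + t\<^sup>2 * nsq I w"
        using vK
        by (simp add: ip_add_left ip_scale_left ip_commute[of I _ "\<lambda>x. _ x + _ x"]
            power2_eq_square algebra_simps) (simp add: ip_commute)
      ultimately show ?thesis unfolding A_def B_def by (simp add: algebra_simps)
    qed
    then have "A = 0" by (rule linear_coeff_zero)
    then show ?thesis
      by (subst ip_commute) (simp add: A_def ip_diff_left ip_scale_left ip_commute)
  qed
  define g where "g = (\<lambda>x. mv I a v x - \<mu> * v x)"
  have "ip I g (u j) = 0" if j: "j < k" for j
  proof -
    have "ip I g (u j) = ip I (u j) (mv I a v) - \<mu> * ip I v (u j)"
      unfolding g_def by (simp add: ip_diff_left ip_scale_left ip_commute)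
    also have "ip I (u j) (mv I a v) = ip I v (mv I a (u j))"
      using sym by (intro ip_mv_symmetric) auto
    also have "\<dots> = ip I v (\<lambda>x. l j * u j x)"
      unfolding ip_def using eig[OF j] by (intro sum.cong) auto
    also have "\<dots> = l j * ip I v (u j)" by (subst ip_commute) (simp add: ip_scale_left ip_commute)
    finally show ?thesis using vK(2)[OF j] by simp
  qed
  from stat[OF this] have "nsq I g = 0" by (simp add: g_def)
  then have "\<forall>x\<in>I. g x = 0" by (rule ip_zero[OF fin])
  then show ?thesis using vK unfolding g_def by (intro exI[of _ v] exI[of _ \<mu>]) auto
qed

text \<open>Spectral data as identities between entries, so that they apply directly to index sets
  of configurations. Real vectors suffice because the chain is a real symmetric matrix in the basis
  of spin flips.\<close>

definition eigensystem ::
  "'a set \<Rightarrow> ('a \<Rightarrow> 'a \<Rightarrow> real) \<Rightarrow> nat set \<Rightarrow> (nat \<Rightarrow> 'a \<Rightarrow> real) \<Rightarrow> (nat \<Rightarrow> real) \<Rightarrow> bool" where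
  "eigensystem I a J u l \<longleftrightarrow> finite I \<and> finite J \<and> orthonormal_fam I J u \<and>
     (\<forall>x\<in>I. \<forall>y\<in>I. (\<Sum>j\<in>J. u j x * u j y) = (if x = y then 1 else 0)) \<and>
     (\<forall>x\<in>I. \<forall>y\<in>I. a x y = (\<Sum>j\<in>J. l j * u j x * u j y))"

lemma eigensystem_exists:
  assumes fin: "finite I" and sym: "\<And>x y. x \<in> I \<Longrightarrow> y \<in> I \<Longrightarrow> a x y = a y x"
  shows "\<exists>J u l. eigensystem I a J u l"
proof -
  have "\<exists>u l. orthonormal_fam I {..<k} u \<and> (\<forall>j<k. \<forall>x\<in>I. mv I a (u j) x = l j * u j x)"
    if "k \<le> card I" for k using that
  proof (induction k)
    case 0
    then show ?case by (simp add: orthonormal_fam_def)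
  next
    case (Suc k)
    then obtain u l where ul: "orthonormal_fam I {..<k} u" "\<And>j x. j < k \<Longrightarrow> x \<in> I \<Longrightarrow> mv I a (u j) x = l j * u j x"
      by auto
    obtain w \<mu> where w: "nsq I w = 1" "\<And>j. j < k \<Longrightarrow> ip I w (u j) = 0" "\<And>x. x \<in> I \<Longrightarrow> mv I a w x = \<mu> * w x"
      using eigenvector_extend[OF fin sym ul(1) Suc_le_lessD[OF Suc.prems] ul(2)] by blast
    have "orthonormal_fam I {..<Suc k} (u(k := w))"
      using ul(1) w(1,2) unfolding orthonormal_fam_def
      by (auto simp: less_Suc_eq ip_commute)
    moreover have "\<forall>j<Suc k. \<forall>x\<in>I. mv I a ((u(k := w)) j) x = (l(k := \<mu>)) j * (u(k := w)) j x"
      using ul(2) w(3) by (auto simp: less_Suc_eq)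
    ultimately show ?case by blast
  qed
  from this[OF order_refl] obtain u l where ul: "orthonormal_fam I {..<card I} u"
      "\<And>j x. j < card I \<Longrightarrow> x \<in> I \<Longrightarrow> mv I a (u j) x = l j * u j x" by auto
  note compl = orthonormal_fam_complete[OF fin finite_lessThan ul(1) card_lessThan]
  have "a x y = (\<Sum>j<card I. l j * u j x * u j y)" if "x \<in> I" "y \<in> I" for x y
  proof -
    have "a x y = (\<Sum>z\<in>I. a x z * (\<Sum>j<card I. u j z * u j y))"
      using that fin by (simp add: compl if_distrib[of "(*) _"] cong: if_cong)
    also have "\<dots> = (\<Sum>j<card I. (\<Sum>z\<in>I. a x z * u j z) * u j y)"
      by (simp add: sum_distrib_left sum_distrib_right mult.assoc) (rule sum.swap)
    also have "\<dots> = (\<Sum>j<card I. l j * u j x * u j y)"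
      using ul(2) that by (intro sum.cong) (auto simp: mv_def)
    finally show ?thesis .
  qed
  then have "eigensystem I a {..<card I} u l"
    using ul(1) compl fin by (auto simp: eigensystem_def)
  then show ?thesis by blast
qed

lemma eigensystem_qf:
  assumes "eigensystem I a J u l"
  shows "qf I a v = (\<Sum>j\<in>J. l j * (ip I v (u j))\<^sup>2)"
proof -
  have "qf I a v = (\<Sum>x\<in>I. \<Sum>y\<in>I. \<Sum>j\<in>J. l j * (v x * u j x) * (v y * u j y))"
    unfolding qf_def using assms
    by (intro sum.cong) (auto simp: eigensystem_def sum_distrib_left sum_distrib_right algebra_simps)
  also have "\<dots> = (\<Sum>j\<in>J. \<Sum>x\<in>I. \<Sum>y\<in>I. l j * (v x * u j x) * (v y * u j y))"
    by (rule sym, subst sum.swap, rule sum.cong[OF refl], subst sum.swap) simp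
  also have "\<dots> = (\<Sum>j\<in>J. l j * (ip I v (u j))\<^sup>2)"
    by (simp add: ip_def power2_eq_square sum_product sum_distrib_left algebra_simps)
  finally show ?thesis .
qed

lemma parseval:
  assumes "finite I"
    and "\<And>x y. x \<in> I \<Longrightarrow> y \<in> I \<Longrightarrow> (\<Sum>j\<in>J. u j x * u j y) = (if x = y then 1 else 0)"
  shows "(\<Sum>j\<in>J. (ip I v (u j))\<^sup>2) = nsq I v"
proof -
  have "(\<Sum>j\<in>J. (ip I v (u j))\<^sup>2) = (\<Sum>j\<in>J. \<Sum>x\<in>I. \<Sum>y\<in>I. v x * v y * (u j x * u j y))"
    by (simp add: ip_def power2_eq_square sum_product algebra_simps)
  also have "\<dots> = (\<Sum>x\<in>I. \<Sum>y\<in>I. v x * v y * (\<Sum>j\<in>J. u j x * u j y))"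
    by (subst sum.swap, rule sum.cong[OF refl], subst sum.swap) (simp add: sum_distrib_left)
  also have "\<dots> = (\<Sum>x\<in>I. v x * v x)"
    using assms by (intro sum.cong) (auto simp: if_distrib[of "(*) _"] cong: if_cong)
  finally show ?thesis by (simp add: ip_def)
qed

lemma eigensystem_parseval:
  assumes "eigensystem I a J u l"
  shows "(\<Sum>j\<in>J. (ip I v (u j))\<^sup>2) = nsq I v"
  using assms by (intro parseval) (auto simp: eigensystem_def)

section \<open>Jensen's inequality and variational bounds for partition sums\<close>

lemma jensen_exp:
  fixes w x :: "'j \<Rightarrow> real"
  assumes "finite J" "\<And>j. j \<in> J \<Longrightarrow> w j \<ge> 0" and W: "sum w J > 0"
  shows "sum w J * exp (- (b * (\<Sum>j\<in>J. w j * x j) / sum w J)) \<le> (\<Sum>j\<in>J. w j * exp (- (b * x j)))"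
proof -
  \<comment> \<open>The exponential lies above its tangent at the weighted mean \<open>m\<close>,
    and the slope term of the tangent averages to zero.\<close>
  define m where "m = (\<Sum>j\<in>J. w j * x j) / sum w J"
  have "exp (- (b * m)) * (1 - b * (x j - m)) \<le> exp (- (b * x j))" for j
  proof -
    have "1 + (- (b * (x j - m))) \<le> exp (- (b * (x j - m)))" by (rule exp_ge_add_one_self)
    then have "exp (- (b * m)) * (1 + (- (b * (x j - m)))) \<le> exp (- (b * m)) * exp (- (b * (x j - m)))"
      by (rule mult_left_mono) simp
    also have "\<dots> = exp (- (b * x j))" by (simp flip: exp_add add: algebra_simps)
    finally show ?thesis by simp
  qed
  then have "(\<Sum>j\<in>J. w j * (exp (- (b * m)) * (1 - b * (x j - m)))) \<le> (\<Sum>j\<in>J. w j * exp (- (b * x j)))"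
    using assms by (intro sum_mono mult_left_mono) auto
  also have "(\<Sum>j\<in>J. w j * (exp (- (b * m)) * (1 - b * (x j - m))))
      = exp (- (b * m)) * (sum w J - b * ((\<Sum>j\<in>J. w j * x j) - sum w J * m))"
    by (simp add: sum_distrib_left sum_distrib_right sum_subtractf algebra_simps)
  also have "sum w J * m = (\<Sum>j\<in>J. w j * x j)" using W by (simp add: m_def)
  finally show ?thesis by (simp add: m_def mult.commute)
qed

text \<open>The squared overlaps of \<open>v k\<close> with the eigenvectors are the weights in
  Jensen's inequality, with total mass \<open>nsq I (v k)\<close>. After exchanging the sums,
  Bessel's inequality is applied to each normalised eigenvector.\<close>

lemma peierls:
  assumes es: "eigensystem I a J u l" and K: "finite K"
    and bess: "\<And>e. (\<Sum>k\<in>K. (ip I e (v k))\<^sup>2) \<le> nsq I e"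
    and pos: "\<And>k. k \<in> K \<Longrightarrow> nsq I (v k) > 0"
  shows "(\<Sum>k\<in>K. nsq I (v k) * exp (- (b * qf I a (v k) / nsq I (v k)))) \<le> (\<Sum>j\<in>J. exp (- (b * l j)))"
proof -
  note fin = es[unfolded eigensystem_def]
  have "(\<Sum>k\<in>K. nsq I (v k) * exp (- (b * qf I a (v k) / nsq I (v k))))
      \<le> (\<Sum>k\<in>K. \<Sum>j\<in>J. (ip I (v k) (u j))\<^sup>2 * exp (- (b * l j)))"
  proof (intro sum_mono)
    fix k assume k: "k \<in> K"
    show "nsq I (v k) * exp (- (b * qf I a (v k) / nsq I (v k)))
      \<le> (\<Sum>j\<in>J. (ip I (v k) (u j))\<^sup>2 * exp (- (b * l j)))"
      using jensen_exp[of J "\<lambda>j. (ip I (v k) (u j))\<^sup>2" b l] pos[OF k] fin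
      unfolding eigensystem_parseval[OF es] eigensystem_qf[OF es]
      by (simp add: mult.commute)
  qed
  also have "\<dots> = (\<Sum>j\<in>J. (\<Sum>k\<in>K. (ip I (u j) (v k))\<^sup>2) * exp (- (b * l j)))"
    by (subst sum.swap) (simp add: sum_distrib_right ip_commute)
  also have "\<dots> \<le> (\<Sum>j\<in>J. nsq I (u j) * exp (- (b * l j)))"
    by (intro sum_mono mult_right_mono bess) simp
  also have "\<dots> = (\<Sum>j\<in>J. exp (- (b * l j)))"
    using fin by (intro sum.cong) (auto simp: orthonormal_fam_def)
  finally show ?thesis .
qed

text \<open>The converse use of Jensen's inequality: now each eigenvector \<open>u j\<close> is
  expanded in the family \<open>v\<close>, and its eigenvalue is at least the mean of
  \<open>\<kappa>\<close> under the squared coefficients. It serves to discard the junction bond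
  between two chains.\<close>

lemma partition_upper:
  assumes es: "eigensystem I a J u l" and K: "finite K" and b: "b \<ge> 0"
    and norm: "\<And>k. k \<in> K \<Longrightarrow> nsq I (v k) = 1"
    and pars: "\<And>e. (\<Sum>k\<in>K. (ip I e (v k))\<^sup>2) = nsq I e"
    and lower: "\<And>e. (\<Sum>k\<in>K. \<kappa> k * (ip I e (v k))\<^sup>2) \<le> qf I a e"
  shows "(\<Sum>j\<in>J. exp (- (b * l j))) \<le> (\<Sum>k\<in>K. exp (- (b * \<kappa> k)))"
proof -
  note fin = es[unfolded eigensystem_def]
  have one: "nsq I (u j) = 1" if "j \<in> J" for j
    using fin that by (auto simp: orthonormal_fam_def)
  have "exp (- (b * l j)) \<le> (\<Sum>k\<in>K. (ip I (u j) (v k))\<^sup>2 * exp (- (b * \<kappa> k)))" if j: "j \<in> J" for j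
  proof -
    have "qf I a (u j) = (\<Sum>i\<in>J. if i = j then l i else 0)"
      unfolding eigensystem_qf[OF es] using fin j
      by (intro sum.cong) (auto simp: orthonormal_fam_def)
    then have "qf I a (u j) = l j" using fin j by simp
    then have "(\<Sum>k\<in>K. (ip I (u j) (v k))\<^sup>2 * \<kappa> k) \<le> l j"
      using lower[of "u j"] by (simp add: mult.commute)
    then have "exp (- (b * l j)) \<le> exp (- (b * (\<Sum>k\<in>K. (ip I (u j) (v k))\<^sup>2 * \<kappa> k)))"
      using b by (simp add: mult_left_mono)
    also have "\<dots> \<le> (\<Sum>k\<in>K. (ip I (u j) (v k))\<^sup>2 * exp (- (b * \<kappa> k)))"
      using jensen_exp[of K "\<lambda>k. (ip I (u j) (v k))\<^sup>2" b \<kappa>] K one[OF j]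
      by (simp add: pars)
    finally show ?thesis .
  qed
  then have "(\<Sum>j\<in>J. exp (- (b * l j))) \<le> (\<Sum>j\<in>J. \<Sum>k\<in>K. (ip I (u j) (v k))\<^sup>2 * exp (- (b * \<kappa> k)))"
    by (rule sum_mono)
  also have "\<dots> = (\<Sum>k\<in>K. (\<Sum>j\<in>J. (ip I (v k) (u j))\<^sup>2) * exp (- (b * \<kappa> k)))"
    by (subst sum.swap) (simp add: sum_distrib_right ip_commute)
  also have "\<dots> = (\<Sum>k\<in>K. exp (- (b * \<kappa> k)))"
    using norm by (intro sum.cong) (auto simp: eigensystem_parseval[OF es])
  finally show ?thesis .
qed

section \<open>The trace of a matrix exponential in terms of eigenvalues\<close>

lemma mat_power_spectral:
  fixes A :: "complex mat"
  assumes es: "eigensystem I a J u l" and c: "bij_betw c {..<n} I"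
    and A: "A = Matrix.mat n n (\<lambda>(i, j). z * complex_of_real (a (c i) (c j)))"
    and ij: "i < n" "j < n"
  shows "(A ^\<^sub>m k) $$ (i, j) = (\<Sum>p\<in>J. (z * of_real (l p)) ^ k * of_real (u p (c i) * u p (c j)))"
  using ij
proof (induction k arbitrary: j)
  case 0
  have cI: "c i \<in> I" "c j \<in> I" "c i = c j \<longleftrightarrow> i = j"
    using c 0 by (auto simp: bij_betw_def inj_on_def)
  have "(\<Sum>p\<in>J. u p (c i) * u p (c j)) = (if i = j then 1 else 0)"
    using es cI by (simp add: eigensystem_def)
  then have "(\<Sum>p\<in>J. complex_of_real (u p (c i) * u p (c j))) = (if i = j then 1 else 0)"
    unfolding of_real_sum[symmetric] by simp
  then show ?case using 0 A by simp
next
  case (Suc k)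
  have AC: "A \<in> carrier_mat n n" using A by simp
  have C: "A ^\<^sub>m k \<in> carrier_mat n n" using AC by simp
  have cI: "c m \<in> I" if "m < n" for m using c that by (auto simp: bij_betw_def)
  have aeq: "complex_of_real (a (c m) (c j)) = (\<Sum>q\<in>J. of_real (l q) * of_real (u q (c m) * u q (c j)))"
      if "m < n" for m
    using es cI[OF that] cI[OF Suc.prems(2)] by (simp add: eigensystem_def mult.assoc)
  have orth: "(\<Sum>m<n. u p (c m) * u q (c m)) = (if p = q then 1 else 0)" if "p \<in> J" "q \<in> J" for p q
  proof -
    have "(\<Sum>m<n. u p (c m) * u q (c m)) = ip I (u p) (u q)"
      unfolding ip_def by (rule sum.reindex_bij_betw[OF c])
    then show ?thesis using es that by (simp add: eigensystem_def orthonormal_fam_def)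
  qed
  have "(A ^\<^sub>m Suc k) $$ (i, j) = (\<Sum>m<n. (A ^\<^sub>m k) $$ (i, m) * A $$ (m, j))"
    using AC C Suc.prems by (auto simp: scalar_prod_def lessThan_atLeast0 intro!: sum.cong)
  also have "\<dots> = (\<Sum>m<n. (\<Sum>p\<in>J. (z * of_real (l p)) ^ k * of_real (u p (c i) * u p (c m))) *
       (z * (\<Sum>q\<in>J. of_real (l q) * of_real (u q (c m) * u q (c j)))))"
    using Suc A aeq by (intro sum.cong) auto
  also have "\<dots> = (\<Sum>m<n. \<Sum>p\<in>J. \<Sum>q\<in>J. (z * of_real (l p)) ^ k * of_real (u p (c i)) * (z * of_real (l q))
      * of_real (u q (c j))
       * of_real (u p (c m) * u q (c m)))"
    unfolding sum_distrib_left[of z] sum_product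
    by (intro sum.cong refl) (simp add: algebra_simps)
  also have "\<dots> = (\<Sum>p\<in>J. \<Sum>q\<in>J. (z * of_real (l p)) ^ k * of_real (u p (c i)) * (z * of_real (l q))
      * of_real (u q (c j))
       * of_real (\<Sum>m<n. u p (c m) * u q (c m)))"
    by (subst sum.swap, rule sum.cong[OF refl], subst sum.swap) (simp add: sum_distrib_left)
  also have "\<dots> = (\<Sum>p\<in>J. \<Sum>q\<in>J. if p = q then (z * of_real (l p)) ^ k * of_real (u p (c i)) * (z
      * of_real (l q)) * of_real (u q (c j)) else 0)"
    by (intro sum.cong refl) (simp add: orth)
  also have "\<dots> = (\<Sum>p\<in>J. (z * of_real (l p)) ^ Suc k * of_real (u p (c i) * u p (c j)))"
    using es by (intro sum.cong) (auto simp: eigensystem_def algebra_simps)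
  finally show ?case .
qed

lemma trace_exp_spectral:
  fixes A :: "complex mat"
  assumes es: "eigensystem I a J u l" and c: "bij_betw c {..<n} I"
    and A: "A = Matrix.mat n n (\<lambda>(i, j). complex_of_real (a (c i) (c j)))"
  shows "Re (mat_trace (mat_exp (complex_of_real (- b) \<cdot>\<^sub>m A))) = (\<Sum>p\<in>J. exp (- (b * l p)))"
proof -
  let ?B = "complex_of_real (- b) \<cdot>\<^sub>m A"
  have B: "?B = Matrix.mat n n (\<lambda>(i, j). complex_of_real (- b) * complex_of_real (a (c i) (c j)))"
    unfolding A by (intro eq_matI) auto
  have dim: "dim_row ?B = n" by (simp add: A)
  have ent: "mat_exp ?B $$ (i, i) = (\<Sum>p\<in>J. of_real (exp (- (b * l p)) * (u p (c i) * u p (c i))))"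
      if i: "i < n" for i
  proof -
    have "(\<lambda>k. (\<Sum>p\<in>J. ((complex_of_real (- b) * of_real (l p)) ^ k / fact k) * of_real (u p (c i) * u p (c i))))
        sums (\<Sum>p\<in>J. exp (complex_of_real (- b) * of_real (l p)) * of_real (u p (c i) * u p (c i)))"
      using exp_converges[where 'a = complex]
      by (intro sums_sum sums_mult2) (simp add: scaleR_conv_of_real field_simps)
    then have "(\<Sum>k. (?B ^\<^sub>m k) $$ (i, i) / fact k) = (\<Sum>p\<in>J. exp (complex_of_real (- b) * of_real (l p))
        * of_real (u p (c i) * u p (c i)))"
      unfolding mat_power_spectral[OF es c B i i] sum_divide_distrib
      by (simp add: sums_iff field_simps)
    also have "\<dots> = (\<Sum>p\<in>J. of_real (exp (- (b * l p)) * (u p (c i) * u p (c i))))"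
      by (intro sum.cong refl) (simp add: exp_of_real flip: of_real_minus of_real_mult)
    finally show ?thesis using i dim by (simp add: mat_exp_def)
  qed
  have "mat_trace (mat_exp ?B) = (\<Sum>i<n. \<Sum>p\<in>J. of_real (exp (- (b * l p)) * (u p (c i) * u p (c i))))"
    unfolding mat_trace_def using ent dim by (simp add: mat_exp_def)
  also have "\<dots> = of_real (\<Sum>p\<in>J. exp (- (b * l p)) * (\<Sum>i<n. u p (c i) * u p (c i)))"
    by (subst sum.swap) (simp add: sum_distrib_left)
  also have "(\<Sum>p\<in>J. exp (- (b * l p)) * (\<Sum>i<n. u p (c i) * u p (c i))) = (\<Sum>p\<in>J. exp (- (b * l p)))"
  proof (intro sum.cong refl)
    fix p assume p: "p \<in> J"
    have "(\<Sum>i<n. u p (c i) * u p (c i)) = nsq I (u p)"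
      unfolding ip_def by (rule sum.reindex_bij_betw[OF c])
    then show "exp (- (b * l p)) * (\<Sum>i<n. u p (c i) * u p (c i)) = exp (- (b * l p))"
      using es p by (simp add: eigensystem_def orthonormal_fam_def)
  qed
  finally show ?thesis by simp
qed

section \<open>The Heisenberg chain in the basis of spin flips\<close>

type_synonym conf = "nat \<Rightarrow> nat"
type_synonym state = "conf \<Rightarrow> real"

text \<open>\<open>n x\<close> counts the flips at site \<open>x\<close>, so the third spin
  component there is \<open>S - n x\<close> with \<open>D = 2 * S\<close>. Pinning \<open>n\<close>
  to zero off the chain makes equality of functions the same as equality of configurations.\<close>

definition Om :: "nat \<Rightarrow> nat \<Rightarrow> conf set" where
  "Om D L = {n. (\<forall>x. n x \<le> D) \<and> (\<forall>x. x \<notin> {1..L} \<longrightarrow> n x = 0)}"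

lemma finite_Om: "finite (Om D L)"
proof (rule finite_subset)
  show "Om D L \<subseteq> {n. \<forall>x. (x \<in> {1..L} \<longrightarrow> n x \<in> {..D}) \<and> (x \<notin> {1..L} \<longrightarrow> n x = 0)}"
    by (auto simp: Om_def)
  show "finite {n. \<forall>x. (x \<in> {1..L} \<longrightarrow> n x \<in> {..D}) \<and> (x \<notin> {1..L} \<longrightarrow> n x = (0 :: nat))}"
    by (intro finite_set_of_finite_funs) auto
qed

section \<open>Basis indices and their digits\<close>

text \<open>The flip numbers of the basis vector with index \<open>i\<close>: base-\<open>d\<close> digits, site 1 being the most
    significant one.\<close>

definition dig :: "nat \<Rightarrow> nat \<Rightarrow> nat \<Rightarrow> nat \<Rightarrow> nat" where
  "dig d L i = (\<lambda>x. if x \<in> {1..L} then (i div d ^ (L - x)) mod d else 0)"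

lemma dig_Suc: "dig d (Suc L) i = (dig d L (i div d))(Suc L := i mod d)"
proof
  fix x
  have "i div d ^ (Suc L - x) = i div d div d ^ (L - x)" if "x \<le> L"
    using that by (simp add: Suc_diff_le div_mult2_eq)
  then show "dig d (Suc L) i x = ((dig d L (i div d))(Suc L := i mod d)) x"
    by (auto simp: dig_def)
qed

lemma dig_bij: "bij_betw (dig (Suc D) L) {..<Suc D ^ L} (Om D L)"
proof (induction L)
  case 0
  have "Om D 0 = {\<lambda>_. 0}" by (auto simp: Om_def)
  moreover have "dig (Suc D) 0 0 = (\<lambda>_. 0)" by (auto simp: dig_def)
  moreover have "{..<Suc D ^ 0} = {0}" by auto
  ultimately show ?case by (simp add: bij_betw_def)
next
  case (Suc L)
  let ?d = "Suc D"
  have lt: "i div ?d < ?d ^ L" if "i < ?d ^ Suc L" for i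
    using that by (metis less_mult_imp_div_less mult.commute power_Suc)
  have top: "dig ?d L i (Suc L) = 0" for i by (simp add: dig_def)
  show ?case unfolding bij_betw_def
  proof
    show "inj_on (dig ?d (Suc L)) {..<?d ^ Suc L}"
    proof (rule inj_onI)
      fix i j assume ij: "i \<in> {..<?d ^ Suc L}" "j \<in> {..<?d ^ Suc L}" "dig ?d (Suc L) i = dig ?d (Suc L) j"
      have m: "i mod ?d = j mod ?d" using fun_cong[OF ij(3), of "Suc L"] by (simp add: dig_Suc)
      have "dig ?d L (i div ?d) = dig ?d L (j div ?d)"
      proof
        fix x show "dig ?d L (i div ?d) x = dig ?d L (j div ?d) x"
          using fun_cong[OF ij(3), of x] top by (cases "x = Suc L") (auto simp: dig_Suc)
      qed
      then have "i div ?d = j div ?d" using Suc lt ij by (auto simp: bij_betw_def inj_on_def)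
      with m show "i = j" by (metis div_mult_mod_eq)
    qed
    show "dig ?d (Suc L) ` {..<?d ^ Suc L} = Om D (Suc L)"
    proof (intro equalityI subsetI)
      fix n assume "n \<in> dig ?d (Suc L) ` {..<?d ^ Suc L}"
      then show "n \<in> Om D (Suc L)" by (auto simp: Om_def dig_def less_Suc_eq_le[symmetric])
    next
      fix n assume n: "n \<in> Om D (Suc L)"
      have "n(Suc L := 0) \<in> Om D L" using n by (auto simp: Om_def)
      then have "n(Suc L := 0) \<in> dig ?d L ` {..<?d ^ L}" using Suc by (simp add: bij_betw_def)
      then obtain i where i: "i < ?d ^ L" "dig ?d L i = n(Suc L := 0)"
        by (metis imageE lessThan_iff)
      have nl: "n (Suc L) < ?d" using n by (auto simp: Om_def less_Suc_eq_le)
      define j where "j = i * ?d + n (Suc L)"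
      have "j div ?d = i" "j mod ?d = n (Suc L)" using nl
        by (simp_all only: j_def div_mult_self3 mod_mult_self3 div_less mod_less add_0_right)
      then have "dig ?d (Suc L) j = n" using i by (simp add: dig_Suc)
      moreover have "j < ?d ^ Suc L"
      proof -
        have "j < (i + 1) * ?d" using nl by (simp add: j_def)
        also have "\<dots> \<le> ?d ^ L * ?d" using i(1) by (intro mult_right_mono) auto
        finally show ?thesis by (simp add: mult.commute)
      qed
      ultimately show "n \<in> dig ?d (Suc L) ` {..<?d ^ Suc L}" by blast
    qed
  qed
qed

lemma dig_in_Om: "i < Suc D ^ L \<Longrightarrow> dig (Suc D) L i \<in> Om D L"
  using dig_bij[of D L] by (auto simp: bij_betw_def)

lemma dig_inj: "i < Suc D ^ L \<Longrightarrow> j < Suc D ^ L \<Longrightarrow> dig (Suc D) L i = dig (Suc D) L j \<longleftrightarrow> i = j"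
  using dig_bij[of D L] by (auto simp: bij_betw_def inj_on_def)

lemma dig_high: "y \<le> L \<Longrightarrow> dig d (L + M) i y = dig d L (i div d ^ M) y"
  by (auto simp: dig_def div_mult2_eq[symmetric] add.commute simp flip: power_add)

lemma dig_low:
  assumes "y \<in> {1..M}" and d: "d > 0"
  shows "dig d (L + M) i (L + y) = dig d M (i mod d ^ M) y"
proof -
  have "d ^ M = d ^ (M - y) * d ^ y" using assms by (simp flip: power_add)
  then have "i mod d ^ M = d ^ (M - y) * ((i div d ^ (M - y)) mod d ^ y) + i mod d ^ (M - y)"
    by (simp only: mod_mult2_eq)
  then have "i mod d ^ M div d ^ (M - y) = (i div d ^ (M - y)) mod d ^ y"
    using d by simp
  moreover have "d dvd d ^ y" using assms by (intro dvd_power) auto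
  ultimately have "(i mod d ^ M div d ^ (M - y)) mod d = (i div d ^ (M - y)) mod d"
    by (simp add: mod_mod_cancel)
  then show ?thesis using assms by (auto simp: dig_def)
qed

text \<open>The two equations on the left are what the identity factors of \<open>site_op\<close>
  demand for a nonzero entry: the quotient collects the digits before \<open>x\<close>, the
  remainder those after \<open>x\<close>.\<close>

lemma dig_agree_off:
  assumes x: "x \<in> {1..L}" and i: "i < Suc D ^ L" and j: "j < Suc D ^ L"
  shows "i div (Suc D * Suc D ^ (L - x)) = j div (Suc D * Suc D ^ (L - x)) \<and> i mod Suc D ^ (L - x)
      = j mod Suc D ^ (L - x)
    \<longleftrightarrow> (\<forall>y. y \<noteq> x \<longrightarrow> dig (Suc D) L i y = dig (Suc D) L j y)"
proof -
  let ?d = "Suc D"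
  obtain k where k: "x = Suc k" using x by (cases x) auto
  define M where "M = L - x"
  have L: "L = k + Suc M" "L = x + M" using x k by (auto simp: M_def)
  have lt: "i div ?d ^ Suc M < ?d ^ k" "j div ?d ^ Suc M < ?d ^ k"
    using i j unfolding L(1) power_add by (auto intro: less_mult_imp_div_less)
  have "i div ?d ^ Suc M = j div ?d ^ Suc M \<longleftrightarrow> dig ?d k (i div ?d ^ Suc M) = dig ?d k (j div ?d ^ Suc M)"
    using dig_inj[OF lt] by simp
  also have "\<dots> \<longleftrightarrow> (\<forall>y. y < x \<longrightarrow> dig ?d L i y = dig ?d L j y)"
  proof
    assume eq: "dig ?d k (i div ?d ^ Suc M) = dig ?d k (j div ?d ^ Suc M)"
    show "\<forall>y. y < x \<longrightarrow> dig ?d L i y = dig ?d L j y"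
    proof (intro allI impI)
      fix y assume "y < x"
      then have "y \<le> k" using k by simp
      from dig_high[OF this, of ?d "Suc M"] show "dig ?d L i y = dig ?d L j y"
        unfolding L(1) using eq by simp
    qed
  next
    assume eq: "\<forall>y. y < x \<longrightarrow> dig ?d L i y = dig ?d L j y"
    show "dig ?d k (i div ?d ^ Suc M) = dig ?d k (j div ?d ^ Suc M)"
    proof
      fix y show "dig ?d k (i div ?d ^ Suc M) y = dig ?d k (j div ?d ^ Suc M) y"
      proof (cases "y \<le> k")
        case True
        then have "dig ?d L i y = dig ?d L j y" using eq k by simp
        then show ?thesis unfolding L(1) dig_high[OF True] .
      next
        case False
        then show ?thesis unfolding dig_def by (simp only: atLeastAtMost_iff simp_thms if_False)
      qed
    qed
  qed
  finally have 1: "i div (?d * ?d ^ (L - x)) = j div (?d * ?d ^ (L - x)) \<longleftrightarrow> (\<forall>y. y < x \<longrightarrow> dig ?d L i y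
      = dig ?d L j y)"
    by (simp add: M_def)
  have "i mod ?d ^ M = j mod ?d ^ M \<longleftrightarrow> dig ?d M (i mod ?d ^ M) = dig ?d M (j mod ?d ^ M)"
    by (intro dig_inj[symmetric]) auto
  also have "\<dots> \<longleftrightarrow> (\<forall>y. y > x \<longrightarrow> dig ?d L i y = dig ?d L j y)"
  proof
    assume eq: "dig ?d M (i mod ?d ^ M) = dig ?d M (j mod ?d ^ M)"
    show "\<forall>y. y > x \<longrightarrow> dig ?d L i y = dig ?d L j y"
    proof (intro allI impI)
      fix y assume "y > x"
      show "dig ?d L i y = dig ?d L j y"
      proof (cases "y \<le> L")
        case True
        then have "y - x \<in> {1..M}" using \<open>y > x\<close> L by auto
        from dig_low[OF this zero_less_Suc, of D x] show ?thesis using \<open>y > x\<close> eq L(2) by simp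
      qed (simp add: dig_def)
    qed
  next
    assume eq: "\<forall>y. y > x \<longrightarrow> dig ?d L i y = dig ?d L j y"
    show "dig ?d M (i mod ?d ^ M) = dig ?d M (j mod ?d ^ M)"
    proof
      fix y show "dig ?d M (i mod ?d ^ M) y = dig ?d M (j mod ?d ^ M) y"
      proof (cases "y \<in> {1..M}")
        case True
        then have "dig ?d L i (x + y) = dig ?d L j (x + y)" using eq by simp
        then show ?thesis unfolding L(2) dig_low[OF True zero_less_Suc] .
      qed (simp only: dig_def if_False)
    qed
  qed
  finally have 2: "i mod ?d ^ (L - x) = j mod ?d ^ (L - x) \<longleftrightarrow> (\<forall>y. y > x \<longrightarrow> dig ?d L i y = dig ?d L j y)"
    by (simp add: M_def)
  show ?thesis unfolding 1 2 by (metis linorder_neqE_nat less_irrefl)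
qed

section \<open>Matrix entries of site operators\<close>

definition half :: "nat \<Rightarrow> real" where "half D = real D / 2"

lemma spin_dim_half: "spin_dim (half D) = Suc D"
proof -
  have "2 * half D = of_int (int D)" by (simp add: half_def)
  then have "\<lfloor>2 * half D\<rfloor> = int D" by (simp only: floor_of_int)
  then show ?thesis by (simp add: spin_dim_def)
qed

lemma site_op_index:
  assumes x: "x \<in> {1..L}" and i: "i < Suc D ^ L" and j: "j < Suc D ^ L"
    and A: "A \<in> carrier_mat (Suc D) (Suc D)"
  shows "site_op (half D) L x A $$ (i, j) =
     (if \<forall>y. y \<noteq> x \<longrightarrow> dig (Suc D) L i y = dig (Suc D) L j y
      then A $$ (dig (Suc D) L i x, dig (Suc D) L j x) else 0)"
    and "site_op (half D) L x A \<in> carrier_mat (Suc D ^ L) (Suc D ^ L)"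
proof -
  let ?d = "Suc D"
  let ?r = "?d ^ (L - x)"
  have pr: "?d ^ (x - 1) * (?d * ?r) = ?d ^ L"
  proof -
    have "?d ^ (x - 1) * (?d * ?r) = ?d ^ ((x - 1) + Suc (L - x))" by (simp only: power_add power_Suc)
    also have "(x - 1) + Suc (L - x) = L" using x by auto
    finally show ?thesis .
  qed
  have dA: "dim_row A = ?d" "dim_col A = ?d" using A by auto
  show "site_op (half D) L x A \<in> carrier_mat (?d ^ L) (?d ^ L)"
    unfolding site_op_def spin_dim_half kron_def using dA pr
        by (intro carrier_matI) (simp_all only: dim_row_mat dim_col_mat index_one_mat)
  have lt: "k div (?d * ?r) < ?d ^ (x - 1)" if "k < ?d ^ L" for k
    using that unfolding pr[symmetric] by (rule less_mult_imp_div_less)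
  have ltr: "k mod (?d * ?r) < ?d * ?r" for k by simp
  have dg: "k mod (?d * ?r) div ?r = dig ?d L k x" "k mod (?d * ?r) mod ?r = k mod ?r" for k
  proof -
    have "k mod (?r * ?d) = ?r * (k div ?r mod ?d) + k mod ?r" by (rule mod_mult2_eq)
    then show "k mod (?d * ?r) div ?r = dig ?d L k x" using x by (simp add: mult.commute dig_def)
    show "k mod (?d * ?r) mod ?r = k mod ?r" by (simp add: mod_mod_cancel)
  qed
  have "site_op (half D) L x A $$ (i, j) = (1\<^sub>m (?d ^ (x - 1))) $$ (i div (?d * ?r), j div (?d * ?r)) *
     (kron A (1\<^sub>m ?r)) $$ (i mod (?d * ?r), j mod (?d * ?r))"
    unfolding site_op_def spin_dim_half using i j dA pr
    by (simp add: kron_def[of "1\<^sub>m (?d ^ (x - 1))"]) (simp add: kron_def)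
  also have "(kron A (1\<^sub>m ?r)) $$ (i mod (?d * ?r), j mod (?d * ?r))
     = A $$ (dig ?d L i x, dig ?d L j x) * 1\<^sub>m ?r $$ (i mod ?r, j mod ?r)"
    unfolding kron_def using ltr dA by (simp only: index_mat index_one_mat dim_row_mat dim_col_mat split dg)
  also have "(1\<^sub>m (?d ^ (x - 1))) $$ (i div (?d * ?r), j div (?d * ?r)) =
     (if i div (?d * ?r) = j div (?d * ?r) then 1 else (0 :: complex))"
    using lt[OF i] lt[OF j] by simp
  also have "1\<^sub>m ?r $$ (i mod ?r, j mod ?r) = (if i mod ?r = j mod ?r then 1 else (0 :: complex))"
    by simp
  finally show "site_op (half D) L x A $$ (i, j) =
     (if \<forall>y. y \<noteq> x \<longrightarrow> dig ?d L i y = dig ?d L j y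
      then A $$ (dig ?d L i x, dig ?d L j x) else 0)"
    unfolding dig_agree_off[OF x i j, symmetric] by auto
qed

text \<open>In a product of operators at \<open>x\<close> and \<open>y\<close> only one intermediate
  configuration \<open>k\<close> contributes: the one that already has the final value at
  \<open>x\<close> and still has the initial value elsewhere.\<close>

lemma agree_split:
  assumes "x \<noteq> y"
  shows "(\<forall>z. z \<noteq> x \<longrightarrow> f z = k z) \<and> (\<forall>z. z \<noteq> y \<longrightarrow> k z = g z)
    \<longleftrightarrow> k = f(x := g x) \<and> (\<forall>z. z \<noteq> x \<longrightarrow> z \<noteq> y \<longrightarrow> f z = g z)"
proof
  assume "(\<forall>z. z \<noteq> x \<longrightarrow> f z = k z) \<and> (\<forall>z. z \<noteq> y \<longrightarrow> k z = g z)"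
  then show "k = f(x := g x) \<and> (\<forall>z. z \<noteq> x \<longrightarrow> z \<noteq> y \<longrightarrow> f z = g z)"
    using assms by (simp add: fun_eq_iff)
next
  assume "k = f(x := g x) \<and> (\<forall>z. z \<noteq> x \<longrightarrow> z \<noteq> y \<longrightarrow> f z = g z)"
  then show "(\<forall>z. z \<noteq> x \<longrightarrow> f z = k z) \<and> (\<forall>z. z \<noteq> y \<longrightarrow> k z = g z)"
    using assms by simp
qed

lemma sum_delta_conj:
  assumes "finite I" "a \<in> I"
  shows "(\<Sum>n\<in>I. if n = a \<and> P then V else 0) = (if P then V else (0 :: 'b :: comm_monoid_add))"
  using assms by (cases P) auto

lemma site_op_mult_index:
  assumes x: "x \<in> {1..L}" and y: "y \<in> {1..L}" and xy: "x \<noteq> y" and i: "i < Suc D ^ L" and j: "j < Suc D ^ L"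
    and A: "A \<in> carrier_mat (Suc D) (Suc D)" and B: "B \<in> carrier_mat (Suc D) (Suc D)"
  shows "(site_op (half D) L x A * site_op (half D) L y B) $$ (i, j) =
     (if \<forall>z. z \<noteq> x \<longrightarrow> z \<noteq> y \<longrightarrow> dig (Suc D) L i z = dig (Suc D) L j z
      then A $$ (dig (Suc D) L i x, dig (Suc D) L j x) * B $$ (dig (Suc D) L i y, dig (Suc D) L j y) else 0)"
    (is "_ = (if ?P then ?V else 0)")
proof -
  let ?g = "dig (Suc D) L"
  let ?n = "(?g i)(x := ?g j x)"
  note cA = site_op_index(2)[OF x i j A] and cB = site_op_index(2)[OF y i j B]
  have nOm: "?n \<in> Om D L"
    using dig_in_Om[OF i] dig_in_Om[OF j] x by (auto simp: Om_def)
  have "(site_op (half D) L x A * site_op (half D) L y B) $$ (i, j)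
      = (\<Sum>k<Suc D ^ L. site_op (half D) L x A $$ (i, k) * site_op (half D) L y B $$ (k, j))"
    using cA cB i j by (auto simp: scalar_prod_def lessThan_atLeast0 intro!: sum.cong)
  also have "\<dots> = (\<Sum>k<Suc D ^ L. (\<lambda>n. if n = ?n \<and> ?P then ?V else 0) (?g k))"
  proof (intro sum.cong refl)
    fix k assume "k \<in> {..<Suc D ^ L}"
    then have k: "k < Suc D ^ L" by simp
    have "(\<forall>z. z \<noteq> x \<longrightarrow> ?g i z = ?g k z) \<and> (\<forall>z. z \<noteq> y \<longrightarrow> ?g k z = ?g j z) \<longleftrightarrow> ?g k = ?n \<and> ?P"
      by (rule agree_split[OF xy])
    note iff = this
    show "site_op (half D) L x A $$ (i, k) * site_op (half D) L y B $$ (k, j) = (\<lambda>n. if n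
        = ?n \<and> ?P then ?V else 0) (?g k)"
    proof (cases "?g k = ?n \<and> ?P")
      case True
      then have a: "\<forall>z. z \<noteq> x \<longrightarrow> ?g i z = ?g k z" "\<forall>z. z \<noteq> y \<longrightarrow> ?g k z = ?g j z" using iff by blast+
      have "?g k x = ?n x" "?g k y = ?n y" using True by metis+
      then have e: "?g k x = ?g j x" "?g k y = ?g i y" using xy by simp_all
      show ?thesis
        unfolding site_op_index(1)[OF x i k A] site_op_index(1)[OF y k j B] if_P[OF True] if_P[OF a(1)]
            if_P[OF a(2)] e ..
    next
      case False
      then have "\<not> (\<forall>z. z \<noteq> x \<longrightarrow> ?g i z = ?g k z) \<or> \<not> (\<forall>z. z \<noteq> y \<longrightarrow> ?g k z = ?g j z)" using iff by blast
      then show ?thesis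
      proof
        assume a: "\<not> (\<forall>z. z \<noteq> x \<longrightarrow> ?g i z = ?g k z)"
        show ?thesis unfolding site_op_index(1)[OF x i k A] if_not_P[OF False] if_not_P[OF a]
            by (rule mult_zero_left)
      next
        assume a: "\<not> (\<forall>z. z \<noteq> y \<longrightarrow> ?g k z = ?g j z)"
        show ?thesis unfolding site_op_index(1)[OF y k j B] if_not_P[OF False] if_not_P[OF a]
            by (rule mult_zero_right)
      qed
    qed
  qed
  also have "\<dots> = (\<Sum>n\<in>Om D L. if n = ?n \<and> ?P then ?V else 0)"
    by (rule sum.reindex_bij_betw[OF dig_bij])
  also have "\<dots> = (if ?P then ?V else 0)"
    using finite_Om nOm by (rule sum_delta_conj)
  finally show ?thesis .
qed

section \<open>The bond energy in the flip basis\<close>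

definition hopw :: "nat \<Rightarrow> nat \<Rightarrow> nat \<Rightarrow> real" where
  "hopw D a b = sqrt (real (Suc a) * (real D - real a)) * sqrt (real b * (real D - real b + 1))"

definition move :: "nat \<Rightarrow> conf \<Rightarrow> nat \<Rightarrow> nat" where
  "move x n = n(x := Suc (n x), Suc x := n (Suc x) - 1)"

definition movable :: "nat \<Rightarrow> nat \<Rightarrow> conf \<Rightarrow> bool" where
  "movable D x n \<longleftrightarrow> n x < D \<and> 0 < n (Suc x)"

text \<open>The entry of S+ at \<open>x\<close> times S- at \<open>Suc x\<close> in row
  \<open>n\<close> and column \<open>n'\<close>. The column has one flip more at \<open>x\<close>
  and one fewer at \<open>Suc x\<close>; the two square roots in \<open>hopw\<close> are the ladder
  coefficients of these sites.\<close>

definition hop :: "nat \<Rightarrow> nat \<Rightarrow> conf \<Rightarrow> state" where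
  "hop D x n n' = (if movable D x n \<and> n' = move x n then hopw D (n x) (n (Suc x)) else 0)"

text \<open>The diagonal part is \<open>S^2 - (S - n x) * (S - n (Suc x))\<close>, multiplied
  out.\<close>

definition bnd :: "nat \<Rightarrow> nat \<Rightarrow> conf \<Rightarrow> state" where
  "bnd D x n n' = (if n = n' then half D * (real (n x) + real (n (Suc x))) - real (n x)
      * real (n (Suc x)) else 0)
     - hop D x n n' / 2 - hop D x n' n / 2"

definition Hc :: "nat \<Rightarrow> nat \<Rightarrow> conf \<Rightarrow> state" where
  "Hc D L n n' = (\<Sum>x\<in>{1..<L}. bnd D x n n')"

definition raise_entry :: "nat \<Rightarrow> nat \<Rightarrow> nat \<Rightarrow> real" where
  "raise_entry D a b = (if b = a + 1 then sqrt (real (a + 1) * (2 * half D - real a)) else 0)"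

lemma spin_index:
  assumes "a \<le> D" "b \<le> D"
  shows "spin1 (half D) $$ (a, b) = (complex_of_real (raise_entry D a b) + raise_entry D b a) / 2"
    and "spin2 (half D) $$ (a, b) = (complex_of_real (raise_entry D a b) - raise_entry D b a) / (2 * \<i>)"
    and "spin3 (half D) $$ (a, b) = complex_of_real (if a = b then half D - real a else 0)"
  using assms
  by (simp_all add: spin1_def spin2_def spin3_def spin_raise_def raise_entry_def mat_adjoint_index mat_diag_def
      spin_dim_half less_Suc_eq_le)

text \<open>The first two products combine to half of (S+ S-) + (S- S+), in which the factors 1/i of
  the two \<open>spin2\<close> entries multiply to a real number. Hence all entries of a bond are
  real.\<close>

lemma spin_pair_entry:
  assumes "a \<le> D" "a' \<le> D" "b \<le> D" "b' \<le> D"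
  shows "spin1 (half D) $$ (a, a') * spin1 (half D) $$ (b, b') + spin2 (half D) $$ (a, a')
      * spin2 (half D) $$ (b, b')
     + spin3 (half D) $$ (a, a') * spin3 (half D) $$ (b, b')
   = complex_of_real ((raise_entry D a a' * raise_entry D b' b + raise_entry D a' a * raise_entry D b b') / 2
      + (if a = a' \<and> b = b' then (half D - real a) * (half D - real b) else 0))"
proof -
  have "(p + q) / 2 * ((r + s) / 2) + (p - q) / (2 * \<i>) * ((r - s) / (2 * \<i>))
      = (p * s + q * r) / 2" for p q r s :: complex
    by (simp add: field_simps power2_eq_square)
  then show ?thesis using assms by (auto simp: spin_index)
qed

lemma hop_eq_raise:
  assumes n: "n \<in> Om D L" "n' \<in> Om D L" and agree: "\<forall>z. z \<noteq> x \<longrightarrow> z \<noteq> Suc x \<longrightarrow> n z = n' z"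
  shows "hop D x n n' = raise_entry D (n x) (n' x) * raise_entry D (n' (Suc x)) (n (Suc x))"
proof (cases "n' x = Suc (n x) \<and> n (Suc x) = Suc (n' (Suc x))")
  case True
  then have "n' = move x n" using agree by (auto simp: move_def fun_eq_iff)
  moreover have "n' x \<le> D" using n by (auto simp: Om_def)
  then have "movable D x n" using True by (auto simp: movable_def)
  ultimately show ?thesis using True
    by (simp add: hop_def hopw_def raise_entry_def half_def)
next
  case False
  then have "hop D x n n' = 0" by (auto simp: hop_def move_def movable_def)
  moreover have "raise_entry D (n x) (n' x) * raise_entry D (n' (Suc x)) (n (Suc x)) = 0"
    using False by (auto simp: raise_entry_def)
  ultimately show ?thesis by simp
qed

lemma hop_agree: "hop D x n n' \<noteq> 0 \<Longrightarrow> z \<noteq> x \<Longrightarrow> z \<noteq> Suc x \<Longrightarrow> n z = n' z"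
  by (auto simp: hop_def move_def split: if_splits)

lemma heisenberg_H_index:
  assumes i: "i < Suc D ^ L" and j: "j < Suc D ^ L"
  shows "heisenberg_H L (half D) $$ (i, j) = complex_of_real (Hc D L (dig (Suc D) L i) (dig (Suc D) L j))"
proof -
  let ?n = "dig (Suc D) L i" and ?n' = "dig (Suc D) L j"
  note Om = dig_in_Om[OF i] dig_in_Om[OF j]
  have le: "?n z \<le> D" "?n' z \<le> D" for z using Om by (auto simp: Om_def)
  note c = spin_carrier[of "half D", unfolded spin_dim_half]
  have "(complex_of_real ((half D)\<^sup>2) \<cdot>\<^sub>m 1\<^sub>m (spin_dim (half D) ^ L) - spin_dot (half D) L x (x + 1)) $$ (i, j)
      = complex_of_real (bnd D x ?n ?n')" if x: "x \<in> {1..<L}" for x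
  proof -
    have xs: "x \<in> {1..L}" "Suc x \<in> {1..L}" "x \<noteq> Suc x" using x by auto
    note car = site_op_index(2)[OF xs(1) i j c(1)] site_op_index(2)[OF xs(1) i j c(2)] site_op_index(2)[OF
        xs(1) i j c(3)]
       site_op_index(2)[OF xs(2) i j c(1)] site_op_index(2)[OF xs(2) i j c(2)] site_op_index(2)[OF xs(2) i j
           c(3)]
    let ?P = "\<forall>z. z \<noteq> x \<longrightarrow> z \<noteq> Suc x \<longrightarrow> ?n z = ?n' z"
    have sd: "spin_dot (half D) L x (Suc x) $$ (i, j) =
      (site_op (half D) L x (spin1 (half D)) * site_op (half D) L (Suc x) (spin1 (half D))) $$ (i, j) +
      (site_op (half D) L x (spin2 (half D)) * site_op (half D) L (Suc x) (spin2 (half D))) $$ (i, j) +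
      (site_op (half D) L x (spin3 (half D)) * site_op (half D) L (Suc x) (spin3 (half D))) $$ (i, j)"
      and sdc: "spin_dot (half D) L x (Suc x) \<in> carrier_mat (Suc D ^ L) (Suc D ^ L)"
      unfolding spin_dot_def using car i j
      by (auto simp del: index_mult_mat(1))
    have sd2: "spin_dot (half D) L x (Suc x) $$ (i, j)
        = (if ?P then complex_of_real ((hop D x ?n ?n' + hop D x ?n' ?n) / 2
      + (if ?n x = ?n' x \<and> ?n (Suc x) = ?n' (Suc x) then (half D - real (?n x)) * (half D
          - real (?n (Suc x))) else 0)) else 0)"
    proof (cases ?P)
      case True
      then have hops: "hop D x ?n ?n' = raise_entry D (?n x) (?n' x) * raise_entry D (?n' (Suc x)) (?n (Suc x))"
        "hop D x ?n' ?n = raise_entry D (?n' x) (?n x) * raise_entry D (?n (Suc x)) (?n' (Suc x))"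
        by (intro hop_eq_raise[OF Om] hop_eq_raise[OF Om(2,1)]; simp)+
      show ?thesis
        unfolding sd site_op_mult_index[OF xs i j c(1) c(1)] site_op_mult_index[OF xs i j c(2) c(2)]
          site_op_mult_index[OF xs i j c(3) c(3)]
          if_P[OF True] hops
        by (rule spin_pair_entry[OF le(1) le(2) le(1) le(2)])
    next
      case False
      show ?thesis
        unfolding sd site_op_mult_index[OF xs i j c(1) c(1)] site_op_mult_index[OF xs i j c(2) c(2)]
          site_op_mult_index[OF xs i j c(3) c(3)] if_not_P[OF False] by simp
    qed
    have diag: "?n = ?n' \<longleftrightarrow> ?P \<and> ?n x = ?n' x \<and> ?n (Suc x) = ?n' (Suc x)" by (auto simp: fun_eq_iff)
    have ij: "i = j \<longleftrightarrow> ?n = ?n'" using dig_inj[OF i j] by simp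
    have "(complex_of_real ((half D)\<^sup>2) \<cdot>\<^sub>m 1\<^sub>m (spin_dim (half D) ^ L) - spin_dot (half D) L x (x
        + 1)) $$ (i, j)
       = complex_of_real (if ?n = ?n' then (half D)\<^sup>2 else 0) - spin_dot (half D) L x (Suc x) $$ (i, j)"
      using i j sdc by (simp add: spin_dim_half ij)
    also have "\<dots> = complex_of_real (bnd D x ?n ?n')"
    proof (cases ?P)
      case True
      then show ?thesis unfolding sd2 diag bnd_def
        by (auto simp: power2_eq_square algebra_simps simp flip: of_real_diff of_real_mult of_real_add
            of_real_divide)
    next
      case False
      then have "hop D x ?n ?n' = 0" "hop D x ?n' ?n = 0" using hop_agree by metis+
      moreover have "?n \<noteq> ?n'" using False by metis
      ultimately show ?thesis unfolding sd2 bnd_def if_not_P[OF False] by simp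
    qed
    finally show ?thesis .
  qed
  then show ?thesis using i j by (simp add: heisenberg_H_def spin_dim_half Hc_def)
qed

lemma Hc_commute: "Hc D L n n' = Hc D L n' n"
  unfolding Hc_def bnd_def by (intro sum.cong) auto

definition Zp :: "nat \<Rightarrow> real \<Rightarrow> nat \<Rightarrow> real" where
  "Zp D b L = Re (mat_trace (mat_exp (complex_of_real (- b) \<cdot>\<^sub>m heisenberg_H L (half D))))"

lemma Zp_spectral:
  assumes "eigensystem (Om D L) (Hc D L) J u l"
  shows "Zp D b L = (\<Sum>j\<in>J. exp (- (b * l j)))"
  unfolding Zp_def
proof (rule trace_exp_spectral[OF assms dig_bij])
  show "heisenberg_H L (half D) = Matrix.mat (Suc D ^ L) (Suc D ^ L)
    (\<lambda>(i, j). complex_of_real (Hc D L (dig (Suc D) L i) (dig (Suc D) L j)))"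
    by (rule eq_matI) (auto simp: heisenberg_H_index, auto simp: heisenberg_H_def spin_dim_half)
qed

lemma Hc_eigensystem: "\<exists>J u l. eigensystem (Om D L) (Hc D L) J u l"
  by (intro eigensystem_exists finite_Om Hc_commute)

text \<open>Ground state representation of a bond: on the states with given \<open>n x + n (x + 1)\<close> the bond energy is a
  Jacobi matrix which annihilates the vector with entries \<open>sqrt ((D choose n x) * (D choose n (x + 1)))\<close>.\<close>

definition bform :: "nat \<Rightarrow> nat \<Rightarrow> conf set \<Rightarrow> state \<Rightarrow> real" where
  "bform D x I v = (\<Sum>n\<in>I. if movable D x n
     then (sqrt ((real D - real (n x)) * real (n (Suc x))) * v n
          - sqrt (real (Suc (n x)) * (real D - real (n (Suc x)) + 1)) * v (move x n))\<^sup>2 / 2 else 0)"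

lemma bform_nonneg: "bform D x I v \<ge> 0"
  by (auto simp: bform_def intro!: sum_nonneg)

text \<open>Completion of squares. The diagonal \<open>half D * (a + b) - a * b\<close> is half of
  \<open>(D - a) * b + a * (D - b)\<close>; the first piece is kept at \<open>n\<close>, the second
  is carried by \<open>move x n\<close>, and the hopping supplies the cross term because
  \<open>hopw\<close> is the product of the two square roots.\<close>

lemma qf_bnd:
  assumes x: "x \<in> {1..<L}"
  shows "qf (Om D L) (bnd D x) v = bform D x (Om D L) v"
proof -
  let ?O = "Om D L"
  define P where "P = {n \<in> ?O. movable D x n}"
  have le: "n z \<le> D" if "n \<in> ?O" for n z using that by (auto simp: Om_def)
  have mv: "move x n \<in> ?O" if "n \<in> P" for n
    using that x by (auto simp: P_def Om_def move_def movable_def le_diff_conv le_SucI)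
  have finP: "finite P" using finite_Om[of D L] by (simp add: P_def)
  have hops: "(\<Sum>n\<in>?O. \<Sum>n'\<in>?O. v n * hop D x n n' * v n')
      = (\<Sum>n\<in>P. hopw D (n x) (n (Suc x)) * v n * v (move x n))"
  proof -
    have "(\<Sum>n\<in>?O. \<Sum>n'\<in>?O. v n * hop D x n n' * v n') = (\<Sum>n\<in>P. \<Sum>n'\<in>?O. v n * hop D x n n' * v n')"
      unfolding P_def using finite_Om by (intro sum.mono_neutral_right) (auto simp: hop_def)
    also have "\<dots> = (\<Sum>n\<in>P. \<Sum>n'\<in>?O. if n' = move x n then hopw D (n x) (n (Suc x)) * v n * v (move x n) else 0)"
      by (intro sum.cong refl) (auto simp: hop_def P_def)
    also have "\<dots> = (\<Sum>n\<in>P. hopw D (n x) (n (Suc x)) * v n * v (move x n))"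
      using mv finite_Om[of D L] by (intro sum.cong refl) simp
    finally show ?thesis .
  qed
  have "qf ?O (bnd D x) v = (\<Sum>n\<in>?O. \<Sum>n'\<in>?O.
      (if n = n' then (half D * (real (n x) + real (n (Suc x))) - real (n x) * real (n (Suc x)))
          * (v n)\<^sup>2 else 0)
       - v n * hop D x n n' * v n' / 2 - v n' * hop D x n' n * v n / 2)"
    unfolding qf_def bnd_def by (intro sum.cong refl) (auto simp: power2_eq_square algebra_simps)
  also have "\<dots> = (\<Sum>n\<in>?O. \<Sum>n'\<in>?O.
      (if n = n' then (half D * (real (n x) + real (n (Suc x))) - real (n x) * real (n (Suc x)))
          * (v n)\<^sup>2 else 0))
      - (\<Sum>n\<in>?O. \<Sum>n'\<in>?O. v n * hop D x n n' * v n') / 2 - (\<Sum>n\<in>?O. \<Sum>n'\<in>?O. v n' * hop D x n' n * v n) / 2"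
    by (simp add: sum_subtractf sum_divide_distrib)
  also have "(\<Sum>n\<in>?O. \<Sum>n'\<in>?O. v n' * hop D x n' n * v n) = (\<Sum>n\<in>?O. \<Sum>n'\<in>?O. v n * hop D x n n' * v n')"
    by (rule sum.swap)
  also have "(\<Sum>n\<in>?O. \<Sum>n'\<in>?O.
      (if n = n' then (half D * (real (n x) + real (n (Suc x))) - real (n x) * real (n (Suc x)))
          * (v n)\<^sup>2 else 0))
     = (\<Sum>n\<in>?O. (half D * (real (n x) + real (n (Suc x))) - real (n x) * real (n (Suc x))) * (v n)\<^sup>2)"
    using finite_Om by (intro sum.cong refl) simp
  also have "\<dots> = (\<Sum>n\<in>?O. (real D - real (n x)) * real (n (Suc x)) * (v n)\<^sup>2) / 2
      + (\<Sum>n\<in>?O. real (n x) * (real D - real (n (Suc x))) * (v n)\<^sup>2) / 2"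
    unfolding sum_divide_distrib sum.distrib[symmetric] half_def
    by (intro sum.cong refl) (simp add: field_simps)
  also have "(\<Sum>n\<in>?O. (real D - real (n x)) * real (n (Suc x)) * (v n)\<^sup>2)
      = (\<Sum>n\<in>P. (real D - real (n x)) * real (n (Suc x)) * (v n)\<^sup>2)"
    unfolding P_def using finite_Om le by (intro sum.mono_neutral_right) (auto simp: movable_def
        le_neq_implies_less)
  also have "(\<Sum>n\<in>?O. real (n x) * (real D - real (n (Suc x))) * (v n)\<^sup>2)
      = (\<Sum>n\<in>{n \<in> ?O. 0 < n x \<and> n (Suc x) < D}. real (n x) * (real D - real (n (Suc x))) * (v n)\<^sup>2)"
    using finite_Om le by (intro sum.mono_neutral_right) (auto simp: le_neq_implies_less)
  \<comment> \<open>The configurations with a flip at \<open>x\<close> and room at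
    \<open>Suc x\<close> are exactly the images of movable ones, so this piece is rewritten at the
    source of the move.\<close>
  also have "\<dots> = (\<Sum>n\<in>P. real (Suc (n x)) * (real D - real (n (Suc x)) + 1) * (v (move x n))\<^sup>2)"
  proof (rule sum.reindex_bij_witness[of _ "move x" "\<lambda>n. n(x := n x - 1, Suc x := Suc (n (Suc x)))"])
    fix n assume n: "n \<in> {n \<in> ?O. 0 < n x \<and> n (Suc x) < D}"
    have nx: "n x - Suc 0 < D" using n le[of n x] by (cases "n x") auto
    show eq: "move x (n(x := n x - 1, Suc x := Suc (n (Suc x)))) = n"
      using n by (auto simp: move_def fun_eq_iff)
    show "n(x := n x - 1, Suc x := Suc (n (Suc x))) \<in> P"
      using n x le[of n x] nx by (auto simp: P_def Om_def movable_def le_diff_conv le_SucI)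
    show "real (Suc ((n(x := n x - 1, Suc x := Suc (n (Suc x)))) x)) *
        (real D - real ((n(x := n x - 1, Suc x := Suc (n (Suc x)))) (Suc x)) + 1) *
        (v (move x (n(x := n x - 1, Suc x := Suc (n (Suc x))))))\<^sup>2
            = real (n x) * (real D - real (n (Suc x))) * (v n)\<^sup>2"
      unfolding eq using n by auto
  next
    fix n assume n: "n \<in> P"
    show "(move x n)(x := move x n x - 1, Suc x := Suc (move x n (Suc x))) = n"
      using n by (auto simp: move_def fun_eq_iff P_def movable_def)
    show "move x n \<in> {n \<in> ?O. 0 < n x \<and> n (Suc x) < D}"
      using mv[OF n] n le[of n "Suc x"] by (auto simp: move_def P_def movable_def)
  qed
  also have "(\<Sum>n\<in>P. (real D - real (n x)) * real (n (Suc x)) * (v n)\<^sup>2) / 2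
     + (\<Sum>n\<in>P. real (Suc (n x)) * (real D - real (n (Suc x)) + 1) * (v (move x n))\<^sup>2) / 2
     - (\<Sum>n\<in>?O. \<Sum>n'\<in>?O. v n * hop D x n n' * v n') / 2 - (\<Sum>n\<in>?O. \<Sum>n'\<in>?O. v n * hop D x n n' * v n') / 2
    = (\<Sum>n\<in>P. (sqrt ((real D - real (n x)) * real (n (Suc x))) * v n
          - sqrt (real (Suc (n x)) * (real D - real (n (Suc x)) + 1)) * v (move x n))\<^sup>2 / 2)"
    unfolding hops sum_divide_distrib sum.distrib[symmetric] sum_subtractf[symmetric]
  proof (rule sum.cong[OF refl])
    fix n assume n: "n \<in> P"
    then have nn: "real D - real (n x) \<ge> 0" "real D - real (n (Suc x)) + 1 \<ge> 0"
      using le[of n x] le[of n "Suc x"] by (auto simp: P_def)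
    have h: "sqrt ((real D - real (n x)) * real (n (Suc x))) * sqrt (real (Suc (n x)) * (real D
        - real (n (Suc x)) + 1))
      = hopw D (n x) (n (Suc x))"
      by (simp only: hopw_def real_sqrt_mult[symmetric] mult_ac)
    have s: "(sqrt ((real D - real (n x)) * real (n (Suc x))))\<^sup>2 = (real D - real (n x)) * real (n (Suc x))"
      "(sqrt (real (Suc (n x)) * (real D - real (n (Suc x)) + 1)))\<^sup>2
          = real (Suc (n x)) * (real D - real (n (Suc x)) + 1)"
      using nn by (intro real_sqrt_pow2 mult_nonneg_nonneg; simp)+
    show "(real D - real (n x)) * real (n (Suc x)) * (v n)\<^sup>2 / 2
        + real (Suc (n x)) * (real D - real (n (Suc x)) + 1) * (v (move x n))\<^sup>2 / 2
        - hopw D (n x) (n (Suc x)) * v n * v (move x n) / 2 - hopw D (n x) (n (Suc x)) * v n * v (move x n) / 2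
      = (sqrt ((real D - real (n x)) * real (n (Suc x))) * v n
          - sqrt (real (Suc (n x)) * (real D - real (n (Suc x)) + 1)) * v (move x n))\<^sup>2 / 2"
      unfolding power2_diff power_mult_distrib s h[symmetric] by (simp add: field_simps)
  qed
  also have "\<dots> = bform D x ?O v"
    unfolding bform_def P_def using finite_Om by (intro sum.inter_filter)
  finally show ?thesis by simp
qed

lemma qf_sum: "qf I (\<lambda>n n'. \<Sum>x\<in>X. a x n n') v = (\<Sum>x\<in>X. qf I (a x) v)"
proof -
  have "qf I (\<lambda>n n'. \<Sum>x\<in>X. a x n n') v = (\<Sum>n\<in>I. \<Sum>n'\<in>I. \<Sum>x\<in>X. v n * a x n n' * v n')"
    by (simp add: qf_def sum_distrib_left sum_distrib_right)
  also have "\<dots> = (\<Sum>x\<in>X. qf I (a x) v)"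
    unfolding qf_def by (rule sym, subst sum.swap, rule sum.cong[OF refl], subst sum.swap) simp
  finally show ?thesis .
qed

lemma qf_Hc: "qf (Om D L) (Hc D L) v = (\<Sum>x\<in>{1..<L}. bform D x (Om D L) v)"
  using qf_sum[of "Om D L" "bnd D" "{1..<L}" v] by (simp add: Hc_def[abs_def] qf_bnd)

section \<open>Bosonic states\<close>

definition cfgs :: "nat set \<Rightarrow> nat \<Rightarrow> conf set" where
  "cfgs X N = {n. (\<forall>x. x \<notin> X \<longrightarrow> n x = 0) \<and> sum n X = N}"

definition mu :: "nat set \<Rightarrow> state" where
  "mu X n = (\<Prod>x\<in>X. 1 / fact (n x))"

lemma finite_cfgs:
  assumes "finite X"
  shows "finite (cfgs X N)"
proof (rule finite_subset)
  show "cfgs X N \<subseteq> {n. \<forall>x. (x \<in> X \<longrightarrow> n x \<in> {..N}) \<and> (x \<notin> X \<longrightarrow> n x = 0)}"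
    using assms by (auto simp: cfgs_def intro: member_le_sum)
  show "finite {n. \<forall>x. (x \<in> X \<longrightarrow> n x \<in> {..N}) \<and> (x \<notin> X \<longrightarrow> n x = (0 :: nat))}"
    using assms by (intro finite_set_of_finite_funs) auto
qed

lemma mu_pos: "mu X n > 0"
  by (auto simp: mu_def intro!: prod_pos)

lemma mu_Suc:
  assumes "finite X" "x \<in> X"
  shows "mu X (n(x := Suc (n x))) * real (Suc (n x)) = mu X n"
proof -
  have "mu X (n(x := Suc (n x))) = 1 / fact (Suc (n x)) * (\<Prod>y\<in>X - {x}. 1 / fact (n y))"
    unfolding mu_def using assms by (subst prod.remove[of X x]) auto
  moreover have "mu X n = 1 / fact (n x) * (\<Prod>y\<in>X - {x}. 1 / fact (n y))"
    unfolding mu_def using assms by (rule prod.remove)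
  moreover have "1 / fact (Suc (n x)) * real (Suc (n x)) = 1 / fact (n x)"
    by (simp del: of_nat_Suc)
  ultimately show ?thesis by (metis mult.assoc mult.commute)
qed

lemma cfgs_Suc:
  assumes "finite X" "x \<in> X" "n \<in> cfgs X N"
  shows "n(x := Suc (n x)) \<in> cfgs X (Suc N)"
proof -
  have "sum (n(x := Suc (n x))) X = Suc (n x) + sum n (X - {x})"
    using assms by (subst sum.remove[of X x]) auto
  also have "\<dots> = Suc (sum n X)" using assms by (subst sum.remove[of X x n]) auto
  finally show ?thesis using assms by (auto simp: cfgs_def)
qed

lemma cfgs_pred:
  assumes "finite X" "x \<in> X" "n \<in> cfgs X (Suc N)" "n x > 0"
  shows "n(x := n x - 1) \<in> cfgs X N"
proof -
  have "sum (n(x := n x - 1)) X = n x - 1 + sum n (X - {x})"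
    using assms by (subst sum.remove[of X x]) auto
  moreover have "sum n X = n x + sum n (X - {x})" using assms by (subst sum.remove[of X x n]) auto
  ultimately show ?thesis using assms by (auto simp: cfgs_def)
qed

text \<open>Taking one particle away at \<open>x\<close>: the factor \<open>n x\<close> turns
  \<open>1 / fact (n x)\<close> into the weight with one particle fewer and removes the terms with
  an empty site. Adjointness of creation and annihilation and all density computations reduce to
  this shift.\<close>

lemma sum_cfgs_shift:
  assumes X: "finite X" "x \<in> X"
  shows "(\<Sum>n\<in>cfgs X (Suc N). mu X n * real (n x) * F n) = (\<Sum>m\<in>cfgs X N. mu X m * F (m(x := Suc (m x))))"
proof -
  have "(\<Sum>n\<in>cfgs X (Suc N). mu X n * real (n x) * F n)
      = (\<Sum>n\<in>{n \<in> cfgs X (Suc N). n x > 0}. mu X n * real (n x) * F n)"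
    using finite_cfgs[OF X(1)] by (intro sum.mono_neutral_right) auto
  also have "\<dots> = (\<Sum>m\<in>cfgs X N. mu X m * F (m(x := Suc (m x))))"
  proof (rule sum.reindex_bij_witness[of _ "\<lambda>m. m(x := Suc (m x))" "\<lambda>n. n(x := n x - 1)"])
    fix n assume n: "n \<in> {n \<in> cfgs X (Suc N). n x > 0}"
    then have eq: "(n(x := n x - 1))(x := Suc ((n(x := n x - 1)) x)) = n" by auto
    then show "(n(x := n x - 1))(x := Suc ((n(x := n x - 1)) x)) = n" .
    have "mu X n * real (n x) = mu X (n(x := n x - 1))"
      using mu_Suc[OF X, of "n(x := n x - 1)"] n eq by simp
    then show "mu X (n(x := n x - 1)) * F ((n(x := n x - 1))(x := Suc ((n(x := n x - 1)) x)))
        = mu X n * real (n x) * F n"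
      using eq by simp
  qed (use cfgs_Suc[OF X] cfgs_pred[OF X] in auto)
  finally show ?thesis .
qed

text \<open>A function \<open>f\<close> of the configurations stands for the Fock vector with amplitudes \<open>sqrt (mu X n)
    * f n\<close>. In this
  normalisation annihilation is a shift and no square roots occur in the commutation relations.\<close>

definition ann :: "nat \<Rightarrow> state \<Rightarrow> state" where
  "ann x f = (\<lambda>n. f (n(x := Suc (n x))))"

text \<open>At an empty site the difference \<open>n x - 1\<close> is truncated to zero; the factor
  \<open>n x\<close> makes that value irrelevant.\<close>

definition cre :: "nat \<Rightarrow> state \<Rightarrow> state" where
  "cre x f = (\<lambda>n. real (n x) * f (n(x := n x - 1)))"

definition crea :: "nat set \<Rightarrow> (nat \<Rightarrow> real) \<Rightarrow> state \<Rightarrow> state" where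
  "crea X w f = (\<lambda>n. \<Sum>x\<in>X. w x * cre x f n)"

definition vac :: "state" where
  "vac n = (if n = (\<lambda>_. 0) then 1 else 0)"

definition fip :: "nat set \<Rightarrow> nat \<Rightarrow> state \<Rightarrow> state \<Rightarrow> real" where
  "fip X N f g = (\<Sum>n\<in>cfgs X N. mu X n * f n * g n)"

lemma cre_commute: "cre x (cre y f) = cre y (cre x f)"
proof (cases "x = y")
  case False
  then show ?thesis by (auto simp: cre_def fun_upd_twist)
qed simp

lemma cre_sum: "cre x (\<lambda>n. \<Sum>y\<in>Y. w y * f y n) = (\<lambda>n. \<Sum>y\<in>Y. w y * cre x (f y) n)"
  by (auto simp: cre_def sum_distrib_left algebra_simps)

lemma pair_mset_eq: "{#a, b#} = {#c, d#} \<Longrightarrow> (c = a \<and> d = b) \<or> (c = b \<and> d = a)"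
  by (auto simp: add_eq_conv_ex)

lemma crea_commute: "crea X w (crea X w' f) = crea X w' (crea X w f)"
proof
  fix n
  have "crea X w (crea X w' f) n = (\<Sum>x\<in>X. \<Sum>y\<in>X. w x * w' y * cre x (cre y f) n)"
    by (simp add: crea_def[of X w] crea_def[of X w' f] cre_sum sum_distrib_left mult.assoc)
  also have "\<dots> = (\<Sum>y\<in>X. \<Sum>x\<in>X. w' y * w x * cre y (cre x f) n)"
    by (subst sum.swap) (simp add: cre_commute mult.commute)
  also have "\<dots> = crea X w' (crea X w f) n"
    by (simp add: crea_def[of X w'] crea_def[of X w f] cre_sum sum_distrib_left mult.assoc)
  finally show "crea X w (crea X w' f) n = crea X w' (crea X w f) n" .
qed

lemma crea_sum: "crea X w (\<lambda>n. \<Sum>k\<in>K. c k * f k n) n = (\<Sum>k\<in>K. c k * crea X w (f k) n)"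
  unfolding crea_def cre_sum sum_distrib_left
  by (subst sum.swap) (simp add: algebra_simps)

text \<open>The canonical commutation relation: the commutator of annihilation at \<open>x\<close>
  with creation of the mode \<open>w\<close> is the scalar \<open>w x\<close>.\<close>

lemma ann_crea:
  assumes X: "finite X" "x \<in> X"
  shows "ann x (crea X w f) n = w x * f n + crea X w (ann x f) n"
proof -
  have "ann x (crea X w f) n = (\<Sum>y\<in>X. w y * cre y f (n(x := Suc (n x))))"
    by (simp add: ann_def crea_def)
  also have "\<dots> = w x * cre x f (n(x := Suc (n x))) + (\<Sum>y\<in>X - {x}. w y * cre y f (n(x := Suc (n x))))"
    using X by (rule sum.remove)
  also have "cre x f (n(x := Suc (n x))) = real (Suc (n x)) * f n"
    by (simp add: cre_def)
  \<comment> \<open>The commutator arises here, from the split of \<open>Suc (n x)\<close> into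
    \<open>1\<close> and \<open>n x\<close>; the other sites commute.\<close>
  also have "real (Suc (n x)) * f n = f n + cre x (ann x f) n"
    by (cases "n x = 0") (auto simp: cre_def ann_def algebra_simps fun_upd_idem)
  also have "(\<Sum>y\<in>X - {x}. w y * cre y f (n(x := Suc (n x)))) = (\<Sum>y\<in>X - {x}. w y * cre y (ann x f) n)"
    by (intro sum.cong) (auto simp: cre_def ann_def fun_upd_twist)
  also have "w x * (f n + cre x (ann x f) n) + \<dots> = w x * f n + (\<Sum>y\<in>X. w y * cre y (ann x f) n)"
    using X by (subst sum.remove[of X x]) (auto simp: algebra_simps)
  finally show ?thesis by (simp add: crea_def)
qed

lemma fip_crea:
  assumes X: "finite X"
  shows "fip X (Suc N) (crea X w f) g = fip X N f (\<lambda>n. \<Sum>x\<in>X. w x * ann x g n)"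
proof -
  have "fip X (Suc N) (crea X w f) g
      = (\<Sum>x\<in>X. w x * (\<Sum>n\<in>cfgs X (Suc N). mu X n * real (n x) * (f (n(x := n x - 1)) * g n)))"
    unfolding fip_def crea_def cre_def sum_distrib_left sum_distrib_right
    by (subst sum.swap) (simp add: algebra_simps)
  also have "\<dots> = (\<Sum>x\<in>X. w x * (\<Sum>m\<in>cfgs X N. mu X m * (f m * g (m(x := Suc (m x))))))"
  proof (rule sum.cong[OF refl])
    fix x assume "x \<in> X"
    from sum_cfgs_shift[OF X this, where N = N and F = "\<lambda>n. f (n(x := n x - 1)) * g n"]
    show "w x * (\<Sum>n\<in>cfgs X (Suc N). mu X n * real (n x) * (f (n(x := n x - 1)) * g n)) =
        w x * (\<Sum>m\<in>cfgs X N. mu X m * (f m * g (m(x := Suc (m x)))))" by simp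
  qed
  also have "\<dots> = fip X N f (\<lambda>n. \<Sum>x\<in>X. w x * ann x g n)"
    unfolding fip_def ann_def sum_distrib_left
    by (subst sum.swap) (simp add: algebra_simps)
  finally show ?thesis .
qed

section \<open>Occupation number states of orthonormal modes\<close>

locale modes =
  fixes X K :: "nat set" and u :: "nat \<Rightarrow> nat \<Rightarrow> real"
  assumes finX: "finite X" and finK: "finite K"
    and orth: "\<And>j k. j \<in> K \<Longrightarrow> k \<in> K \<Longrightarrow> (\<Sum>x\<in>X. u j x * u k x) = (if j = k then 1 else 0)"
begin

text \<open>The unnormalised occupation number state with \<open>count M k\<close> bosons in mode
  \<open>k\<close>. A multiset is the right index, as creation operators commute.\<close>

definition chi :: "nat multiset \<Rightarrow> state" where
  "chi M = fold_mset (\<lambda>k. crea X (u k)) vac M"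

definition nrm :: "nat multiset \<Rightarrow> real" where
  "nrm M = (\<Prod>k\<in>K. fact (count M k))"

lemma chi_empty: "chi {#} = vac"
  by (simp add: chi_def)

lemma chi_add: "chi (add_mset k M) = crea X (u k) (chi M)"
proof -
  interpret comp_fun_commute "\<lambda>k. crea X (u k)"
    by standard (auto simp: crea_commute)
  show ?thesis by (simp add: chi_def)
qed

lemma nrm_pos: "nrm M > 0"
  by (auto simp: nrm_def intro!: prod_pos)

lemma nrm_add:
  assumes "k \<in> K"
  shows "nrm (add_mset k M) = real (Suc (count M k)) * nrm M"
proof -
  have "nrm (add_mset k M) = fact (Suc (count M k)) * (\<Prod>j\<in>K - {k}. fact (count M j))"
    unfolding nrm_def using assms finK by (subst prod.remove[of K k]) auto
  moreover have "nrm M = fact (count M k) * (\<Prod>j\<in>K - {k}. fact (count M j))"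
    unfolding nrm_def using assms finK by (subst prod.remove[of K k]) auto
  ultimately show ?thesis by simp
qed

lemma nrm_remove:
  assumes "k \<in> K" "k \<in># M"
  shows "real (count M k) * nrm (M - {#k#}) = nrm M"
  using nrm_add[OF assms(1), of "M - {#k#}"] assms(2) by simp

text \<open>By the commutation relation annihilation acts as a derivation on products of creation
  operators, and it kills the vacuum.\<close>

lemma ann_chi:
  assumes "set_mset M \<subseteq> K" "x \<in> X"
  shows "ann x (chi M) n = (\<Sum>k\<in>K. real (count M k) * u k x * chi (M - {#k#}) n)"
  using assms(1)
proof (induction M arbitrary: n)
  case empty
  have "vac (n(x := Suc (n x))) = 0"
    by (auto simp: vac_def fun_eq_iff intro!: exI[of _ x])
  then show ?case by (simp add: ann_def chi_empty)
next
  case (add k M)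
  then have k: "k \<in> K" and M: "set_mset M \<subseteq> K" by auto
  have "ann x (chi (add_mset k M)) n = u k x * chi M n + crea X (u k) (ann x (chi M)) n"
    by (simp add: chi_add ann_crea[OF finX assms(2)])
  also have "ann x (chi M) = (\<lambda>n. \<Sum>j\<in>K. (real (count M j) * u j x) * chi (M - {#j#}) n)"
    using add.IH[OF M] by auto
  also have "crea X (u k) \<dots> n = (\<Sum>j\<in>K. real (count M j) * u j x * crea X (u k) (chi (M - {#j#})) n)"
    by (rule crea_sum)
  also have "\<dots> = (\<Sum>j\<in>K. real (count M j) * u j x * chi (add_mset k M - {#j#}) n)"
  proof (intro sum.cong refl)
    fix j assume "j \<in> K"
    show "real (count M j) * u j x * crea X (u k) (chi (M - {#j#})) n =
          real (count M j) * u j x * chi (add_mset k M - {#j#}) n"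
    \<comment> \<open>If \<open>j\<close> is not in \<open>M\<close> the multiset difference does
      not lower anything, but then the coefficient is zero.\<close>
    proof (cases "j \<in># M")
      case True
      then have "add_mset k M - {#j#} = add_mset k (M - {#j#})" by simp
      then show ?thesis by (simp add: chi_add)
    qed (simp add: not_in_iff)
  qed
  also have "u k x * chi M n + \<dots> = (\<Sum>j\<in>K. real (count (add_mset k M) j) * u j x * chi (add_mset k M - {#j#}) n)"
  proof -
    have "(\<Sum>j\<in>K. real (count (add_mset k M) j) * u j x * chi (add_mset k M - {#j#}) n)
      = (\<Sum>j\<in>K. (if j = k then u j x * chi M n else 0) + real (count M j) * u j x * chi (add_mset k M
          - {#j#}) n)"
      by (intro sum.cong) (auto simp: algebra_simps)
    then show ?thesis using k finK by (simp add: sum.distrib)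
  qed
  finally show ?case .
qed

text \<open>One creation operator is moved to the other side, where, by orthonormality of the modes,
  it removes exactly one boson of the same mode.\<close>

lemma fip_chi:
  assumes "set_mset M \<subseteq> K" "set_mset M' \<subseteq> K" "size M' = size M"
  shows "fip X (size M) (chi M) (chi M') = (if M = M' then nrm M else 0)"
  using assms
proof (induction M arbitrary: M')
  case empty
  have "cfgs X 0 = {\<lambda>_. 0}" using finX by (auto simp: cfgs_def)
  then show ?case using empty by (simp add: fip_def chi_empty vac_def mu_def nrm_def)
next
  case (add k M)
  then have k: "k \<in> K" and M: "set_mset M \<subseteq> K" by auto
  have "fip X (size (add_mset k M)) (chi (add_mset k M)) (chi M')
     = fip X (size M) (chi M) (\<lambda>n. \<Sum>x\<in>X. u k x * ann x (chi M') n)"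
    by (simp add: chi_add fip_crea[OF finX])
  also have "(\<lambda>n. \<Sum>x\<in>X. u k x * ann x (chi M') n) = (\<lambda>n. real (count M' k) * chi (M' - {#k#}) n)"
  proof
    fix n
    have "(\<Sum>x\<in>X. u k x * ann x (chi M') n)
        = (\<Sum>x\<in>X. \<Sum>j\<in>K. real (count M' j) * chi (M' - {#j#}) n * (u k x * u j x))"
      using add.prems by (simp add: ann_chi sum_distrib_left algebra_simps)
    also have "\<dots> = (\<Sum>j\<in>K. real (count M' j) * chi (M' - {#j#}) n * (\<Sum>x\<in>X. u k x * u j x))"
      by (subst sum.swap) (simp add: sum_distrib_left)
    also have "\<dots> = (\<Sum>j\<in>K. if j = k then real (count M' j) * chi (M' - {#j#}) n else 0)"
      using k by (intro sum.cong) (auto simp: orth)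
    finally show "(\<Sum>x\<in>X. u k x * ann x (chi M') n) = real (count M' k) * chi (M' - {#k#}) n"
      using finK k by simp
  qed
  also have "fip X (size M) (chi M) (\<lambda>n. real (count M' k) * chi (M' - {#k#}) n)
      = real (count M' k) * fip X (size M) (chi M) (chi (M' - {#k#}))"
    by (simp add: fip_def sum_distrib_left algebra_simps)
  also have "\<dots> = (if add_mset k M = M' then nrm (add_mset k M) else 0)"
  proof (cases "k \<in># M'")
    case True
    then have "size (M' - {#k#}) = size M" using add.prems by (simp add: size_Diff_singleton)
    moreover have "set_mset (M' - {#k#}) \<subseteq> K" using add.prems by (meson in_diffD subset_iff)
    ultimately have "fip X (size M) (chi M) (chi (M' - {#k#})) = (if M = M' - {#k#} then nrm M else 0)"
      by (intro add.IH[OF M])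
    moreover have "M = M' - {#k#} \<longleftrightarrow> add_mset k M = M'" using True by auto
    ultimately show ?thesis using k by (auto simp: nrm_add)
  next
    case False
    then show ?thesis by (auto simp: not_in_iff[symmetric])
  qed
  finally show ?case .
qed

text \<open>One computation for the density (\<open>w k = u k x\<close>) and the gradient
  (\<open>w k = u k y - u k x\<close>). Cross terms vanish because \<open>M - {#k#}\<close>
  determines \<open>k\<close>, so the result is a sum over modes.\<close>

lemma fip_lowered:
  assumes M: "set_mset M \<subseteq> K" "size M = Suc N"
  defines "L \<equiv> \<lambda>w n. \<Sum>k\<in>K. real (count M k) * w k * chi (M - {#k#}) n"
  shows "fip X N (L w) (L w) = nrm M * (\<Sum>k\<in>K. real (count M k) * (w k)\<^sup>2)"
proof -
  have "fip X N (L w) (L w) = (\<Sum>n\<in>cfgs X N. \<Sum>k\<in>K. \<Sum>j\<in>K. real (count M k) * w k * (real (count M j) * w j)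
       * (mu X n * chi (M - {#k#}) n * chi (M - {#j#}) n))"
    unfolding fip_def L_def
    by (intro sum.cong refl) (simp only: sum_product sum_distrib_left sum_distrib_right mult.assoc mult_ac)
  also have "\<dots> = (\<Sum>k\<in>K. \<Sum>j\<in>K. real (count M k) * w k * (real (count M j) * w j)
       * fip X N (chi (M - {#k#})) (chi (M - {#j#})))"
    unfolding fip_def sum_distrib_left
    by (subst sum.swap, rule sum.cong[OF refl], subst sum.swap) simp
  also have "\<dots> = (\<Sum>k\<in>K. \<Sum>j\<in>K. if j = k then nrm M * (real (count M k) * (w k)\<^sup>2) else 0)"
  proof (intro sum.cong refl)
    fix k j assume kj: "k \<in> K" "j \<in> K"
    show "real (count M k) * w k * (real (count M j) * w j) * fip X N (chi (M - {#k#})) (chi (M - {#j#}))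
        = (if j = k then nrm M * (real (count M k) * (w k)\<^sup>2) else 0)"
    proof (cases "k \<in># M \<and> j \<in># M")
      case True
      then have sz: "size (M - {#k#}) = N" "size (M - {#j#}) = size (M - {#k#})"
        using M by (simp_all add: size_Diff_singleton)
      have "fip X N (chi (M - {#k#})) (chi (M - {#j#})) = (if M - {#k#}
          = M - {#j#} then nrm (M - {#k#}) else 0)"
        using fip_chi[of "M - {#k#}" "M - {#j#}"] M sz by (metis (no_types, lifting) in_diffD subset_iff)
      moreover have "M - {#k#} = M - {#j#} \<longleftrightarrow> j = k"
        using True by (metis insert_DiffM add_left_cancel add_mset_add_single single_eq_single)
      ultimately show ?thesis using nrm_remove[OF kj(1), of M] True
        by (auto simp: power2_eq_square)
    qed (auto simp: not_in_iff)
  qed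
  also have "\<dots> = nrm M * (\<Sum>k\<in>K. real (count M k) * (w k)\<^sup>2)"
    using finK by (simp add: sum_distrib_left)
  finally show ?thesis .
qed

lemma fip_gradient:
  assumes M: "set_mset M \<subseteq> K" "size M = Suc N" and x: "x \<in> X" "y \<in> X"
  shows "fip X N (\<lambda>n. ann y (chi M) n - ann x (chi M) n) (\<lambda>n. ann y (chi M) n - ann x (chi M) n)
    = nrm M * (\<Sum>k\<in>K. real (count M k) * (u k y - u k x)\<^sup>2)"
proof -
  have "(\<lambda>n. ann y (chi M) n - ann x (chi M) n) = (\<lambda>n. \<Sum>k\<in>K. real (count M k) * (u k y - u k x) * chi (M
      - {#k#}) n)"
    using M x by (auto simp: ann_chi sum_subtractf[symmetric] algebra_simps)
  then show ?thesis using fip_lowered[OF M] by simp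
qed

lemma fip_ann:
  assumes M: "set_mset M \<subseteq> K" "size M = Suc N" and x: "x \<in> X"
  shows "fip X N (ann x (chi M)) (ann x (chi M)) = nrm M * (\<Sum>k\<in>K. real (count M k) * (u k x)\<^sup>2)"
proof -
  have "ann x (chi M) = (\<lambda>n. \<Sum>k\<in>K. real (count M k) * u k x * chi (M - {#k#}) n)"
    using M x by (auto simp: ann_chi)
  then show ?thesis using fip_lowered[OF M] by simp
qed

lemma ann_ann_chi:
  assumes M: "set_mset M \<subseteq> K" and x: "x \<in> X"
  shows "ann x (ann x (chi M)) n = (\<Sum>(k, j)\<in>K \<times> K. (real (count M k) * real (count (M - {#k#}) j)) * (u k x
      * u j x)
      * chi (M - {#k, j#}) n)"
proof -
  have sub: "set_mset (M - {#k#}) \<subseteq> K" for k using M by (meson in_diffD subset_iff)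
  have eq: "ann x (chi M) = (\<lambda>n. \<Sum>k\<in>K. real (count M k) * u k x * chi (M - {#k#}) n)"
    using M x by (auto simp: ann_chi)
  have "ann x (ann x (chi M)) n = (\<Sum>k\<in>K. real (count M k) * u k x * ann x (chi (M - {#k#})) n)"
    by (subst eq) (simp add: ann_def)
  also have "\<dots> = (\<Sum>k\<in>K. \<Sum>j\<in>K. (real (count M k) * real (count (M - {#k#}) j)) * (u k x * u j x)
      * chi (M - {#k, j#}) n)"
    using ann_chi[OF sub x] by (intro sum.cong refl) (simp add: sum_distrib_left add_mset_commute algebra_simps)
  finally show ?thesis by (simp add: sum.cartesian_product)
qed

text \<open>Removing ordered pairs of bosons \<open>p\<close> and \<open>q\<close> leaves orthogonal
  states unless the pairs agree up to order. The direct and the exchange term give the factor 2, the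
  amplitudes are bounded by \<open>B^2\<close>, and the multiplicities \<open>c p\<close> add up to
  at most \<open>(size M)^2\<close>.\<close>

lemma fip_ann_ann_le:
  assumes M: "set_mset M \<subseteq> K" "size M = Suc (Suc N)" and x: "x \<in> X"
    and B: "\<And>k. k \<in> K \<Longrightarrow> (u k x)\<^sup>2 \<le> B"
  shows "fip X N (ann x (ann x (chi M))) (ann x (ann x (chi M))) \<le> nrm M * (2 * (B * real (size M))\<^sup>2)"
proof -
  define c where "c = (\<lambda>p. real (count M (fst p)) * real (count (M - {#fst p#}) (snd p)))"
  define a where "a = (\<lambda>p. u (fst p) x * u (snd p) x)"
  define R where "R = (\<lambda>p. M - {#fst p, snd p#})"
  have vec: "ann x (ann x (chi M)) = (\<lambda>n. \<Sum>p\<in>K \<times> K. c p * a p * chi (R p) n)"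
    using ann_ann_chi[OF M(1) x] by (auto simp: c_def a_def R_def case_prod_beta)
  have sum_count: "(\<Sum>k\<in>K. real (count M k)) = real (size M)"
  proof -
    have "size M = sum (count M) (set_mset M)" by (simp add: size_multiset_overloaded_eq)
    also have "\<dots> = sum (count M) K" using M(1) finK
      by (intro sum.mono_neutral_left) (auto simp: not_in_iff)
    finally show ?thesis by simp
  qed
  have c0: "c p \<ge> 0" for p by (simp add: c_def)
  \<comment> \<open>The multiplicity \<open>c p\<close> restores the factorials that
    \<open>nrm\<close> loses when the pair is removed.\<close>
  have cR: "c p * nrm (R p) = nrm M \<and> size (R p) = N \<and> R p + {#fst p, snd p#} = M"
      if "p \<in> K \<times> K" "c p \<noteq> 0" for p
  proof -
    obtain k j where p: "p = (k, j)" by force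
    have "count M k \<noteq> 0" "count (M - {#k#}) j \<noteq> 0"
      using that(2) unfolding p c_def fst_conv snd_conv
          by (metis mult_zero_left of_nat_0, metis mult_zero_right of_nat_0)
    then have k: "k \<in> K" "j \<in> K" "k \<in># M" "j \<in># M - {#k#}"
      using that(1) p by (auto simp only: count_eq_zero_iff mem_Sigma_iff)
    have sub: "{#k, j#} \<subseteq># M" using k by (metis insert_subset_eq_iff single_subset_iff)
    have "real (count M k) * (real (count (M - {#k#}) j) * nrm (M - {#k#} - {#j#})) = nrm M"
      using nrm_remove[OF k(2,4)] nrm_remove[OF k(1,3)] by simp
    moreover have Rp: "M - {#k#} - {#j#} = R p" by (simp add: R_def p add_mset_commute)
    ultimately have "c p * nrm (R p) = nrm M"
      by (simp only: c_def p fst_conv snd_conv mult.assoc)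
    moreover have "R p + {#fst p, snd p#} = M"
      using sub by (simp only: R_def p fst_conv snd_conv subset_mset.diff_add)
    moreover have "size (R p) = N"
      using sub M(2) by (simp add: p R_def size_Diff_submset)
    ultimately show ?thesis by blast
  qed
  have "fip X N (ann x (ann x (chi M))) (ann x (ann x (chi M)))
      = (\<Sum>n\<in>cfgs X N. \<Sum>p\<in>K \<times> K. \<Sum>q\<in>K \<times> K. c p * a p * (c q * a q) * (mu X n * chi (R p) n * chi (R q) n))"
    unfolding fip_def vec
    by (intro sum.cong refl) (simp only: sum_product sum_distrib_left sum_distrib_right mult.assoc mult_ac)
  also have "\<dots> = (\<Sum>p\<in>K \<times> K. \<Sum>q\<in>K \<times> K. c p * a p * (c q * a q) * fip X N (chi (R p)) (chi (R q)))"
    unfolding fip_def sum_distrib_left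
    by (subst sum.swap, rule sum.cong[OF refl], subst sum.swap) simp
  also have "\<dots> \<le> (\<Sum>p\<in>K \<times> K. \<Sum>q\<in>K \<times> K. if q = p \<or> q = prod.swap p then nrm M * (c q * B\<^sup>2) else 0)"
  proof (intro sum_mono)
    fix p q assume pq: "p \<in> K \<times> K" "q \<in> K \<times> K"
    show "c p * a p * (c q * a q) * fip X N (chi (R p)) (chi (R q)) \<le> (if q = p \<or> q
        = prod.swap p then nrm M * (c q * B\<^sup>2) else 0)"
    proof (cases "c p \<noteq> 0 \<and> c q \<noteq> 0")
      case True
      note rp = cR[OF pq(1)] and rq = cR[OF pq(2)]
      have RK: "set_mset (R p) \<subseteq> K" "set_mset (R q) \<subseteq> K"
        using M(1) unfolding R_def by (meson in_diffD subset_iff)+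
      have f: "fip X N (chi (R p)) (chi (R q)) = (if R p = R q then nrm (R p) else 0)"
        using fip_chi[OF RK] rp rq True by simp
      show ?thesis
      proof (cases "R p = R q")
        case Req: True
        then have "{#fst p, snd p#} = {#fst q, snd q#}" using rp rq True by (metis add_left_cancel)
        from pair_mset_eq[OF this] have qp: "q = p \<or> q = prod.swap p"
          by (auto simp: prod_eq_iff)
        then have "a q = a p" by (auto simp: a_def)
        have "a p * a p = (u (fst p) x)\<^sup>2 * (u (snd p) x)\<^sup>2" by (simp add: a_def power2_eq_square)
        also have "\<dots> \<le> B * B" using pq(1) B by (intro mult_mono) (auto intro: order_trans[OF zero_le_power2])
        finally have aB: "a p * a p \<le> B\<^sup>2" by (simp add: power2_eq_square)
        have "c p * a p * (c q * a q) * fip X N (chi (R p)) (chi (R q))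
            = (c p * nrm (R p)) * (c q * (a p * a p))"
          using f Req \<open>a q = a p\<close> by simp
        also have "\<dots> = nrm M * (c q * (a p * a p))" using rp True by simp
        also have "\<dots> \<le> nrm M * (c q * B\<^sup>2)"
          using aB c0 nrm_pos[of M] by (intro mult_left_mono) auto
        finally show ?thesis using qp by simp
      next
        case False
        then show ?thesis using f c0 nrm_pos[of M] by (simp add: less_imp_le)
      qed
    next
      case False
      moreover have "0 \<le> nrm M * (c q * B\<^sup>2)"
        using c0 nrm_pos[of M] by (intro mult_nonneg_nonneg) (auto simp: less_imp_le)
      ultimately show ?thesis by auto
    qed
  qed
  also have "\<dots> \<le> (\<Sum>p\<in>K \<times> K. \<Sum>q\<in>K \<times> K. (if q = p then nrm M * (c q * B\<^sup>2) else 0) + (if q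
      = prod.swap p then nrm M * (c q * B\<^sup>2) else 0))"
    using c0 nrm_pos[of M] by (intro sum_mono) (auto simp: less_imp_le)
  also have "\<dots> = (\<Sum>p\<in>K \<times> K. nrm M * (c p * B\<^sup>2) + nrm M * (c (prod.swap p) * B\<^sup>2))"
    using finK by (intro sum.cong refl) (auto simp: sum.distrib)
  also have "\<dots> = 2 * (nrm M * B\<^sup>2 * (\<Sum>p\<in>K \<times> K. c p))"
  proof -
    have "(\<Sum>p\<in>K \<times> K. c (prod.swap p)) = (\<Sum>p\<in>K \<times> K. c p)"
      by (rule sum.reindex_bij_witness[of _ prod.swap prod.swap]) auto
    then show ?thesis by (simp add: sum.distrib sum_distrib_left[symmetric] sum_distrib_right[symmetric])
  qed
  finally have le: "fip X N (ann x (ann x (chi M))) (ann x (ann x (chi M)))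
      \<le> 2 * (nrm M * B\<^sup>2 * (\<Sum>p\<in>K \<times> K. c p))" .
  have "(\<Sum>p\<in>K \<times> K. c p) \<le> (\<Sum>p\<in>K \<times> K. real (count M (fst p)) * real (count M (snd p)))"
    unfolding c_def by (intro sum_mono mult_left_mono) auto
  also have "\<dots> = (real (size M))\<^sup>2"
    by (simp add: sum.cartesian_product' sum_count[symmetric] power2_eq_square sum_product)
  finally have "nrm M * B\<^sup>2 * (\<Sum>p\<in>K \<times> K. c p) \<le> nrm M * B\<^sup>2 * (real (size M))\<^sup>2"
    using nrm_pos[of M] by (intro mult_left_mono) auto
  with le show ?thesis by (simp add: power_mult_distrib)
qed

end

section \<open>Gluing chains\<close>

definition glue :: "nat \<Rightarrow> conf \<Rightarrow> conf \<Rightarrow> nat \<Rightarrow> nat" where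
  "glue L n m = (\<lambda>x. if x \<le> L then n x else m (x - L))"

definition lo :: "nat \<Rightarrow> conf \<Rightarrow> nat \<Rightarrow> nat" where
  "lo L n = (\<lambda>x. if x \<le> L then n x else 0)"

text \<open>Position 0 lies outside the right chain; without the case distinction it would inherit
  the value at the last site of the left chain.\<close>

definition hi :: "nat \<Rightarrow> conf \<Rightarrow> nat \<Rightarrow> nat" where
  "hi L n = (\<lambda>x. if x = 0 then 0 else n (x + L))"

lemma Om_outside: "n \<in> Om D L \<Longrightarrow> x = 0 \<or> L < x \<Longrightarrow> n x = 0"
  by (auto simp: Om_def)

lemma Om_le: "n \<in> Om D L \<Longrightarrow> n x \<le> D"
  by (auto simp: Om_def)

lemma lo_glue: "n \<in> Om D L \<Longrightarrow> lo L (glue L n m) = n"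
  by (auto simp: lo_def glue_def fun_eq_iff Om_outside)

lemma hi_glue: "m \<in> Om D M \<Longrightarrow> hi L (glue L n m) = m"
  by (auto simp: hi_def glue_def fun_eq_iff Om_outside)

lemma glue_lo_hi: "glue L (lo L n) (hi L n) = n"
  by (auto simp: hi_def lo_def glue_def fun_eq_iff)

lemma lo_Om: "n \<in> Om D (L + M) \<Longrightarrow> lo L n \<in> Om D L"
  by (auto simp: lo_def Om_def)

lemma hi_Om: "n \<in> Om D (L + M) \<Longrightarrow> hi L n \<in> Om D M"
  by (auto simp: hi_def Om_def)

lemma glue_Om: "n \<in> Om D L \<Longrightarrow> m \<in> Om D M \<Longrightarrow> glue L n m \<in> Om D (L + M)"
  by (subst Om_def) (auto simp: glue_def Om_le Om_outside)

lemma glue_left: "x \<le> L \<Longrightarrow> glue L n m x = n x"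
  by (simp add: glue_def)

lemma glue_right: "x \<ge> 1 \<Longrightarrow> glue L n m (L + x) = m x" "glue L n m (Suc (L + x)) = m (Suc x)"
  by (auto simp: glue_def Suc_diff_le)

lemma sum_glue: "(\<Sum>n\<in>Om D (L + M). F n) = (\<Sum>n\<in>Om D L. \<Sum>m\<in>Om D M. F (glue L n m))"
proof -
  have "(\<Sum>p\<in>Om D L \<times> Om D M. F (glue L (fst p) (snd p))) = (\<Sum>n\<in>Om D (L + M). F n)"
    by (rule sum.reindex_bij_witness[of _ "\<lambda>n. (lo L n, hi L n)" "\<lambda>p. glue L (fst p) (snd p)"])
       (auto simp: lo_glue hi_glue glue_lo_hi lo_Om hi_Om glue_Om)
  then show ?thesis by (simp add: sum.cartesian_product')
qed

lemma move_glue_left: "Suc x \<le> L \<Longrightarrow> move x (glue L n m) = glue L (move x n) m"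
  by (auto simp: move_def glue_def fun_eq_iff)

lemma move_glue_right: "x \<ge> 1 \<Longrightarrow> move (L + x) (glue L n m) = glue L n (move x m)"
  by (auto simp: move_def glue_def fun_eq_iff)

lemma bform_glue_left:
  assumes "Suc x \<le> L"
  shows "bform D x (Om D (L + M)) e = (\<Sum>m\<in>Om D M. bform D x (Om D L) (\<lambda>n. e (glue L n m)))"
  unfolding bform_def sum_glue using assms
  by (subst sum.swap) (simp add: move_glue_left movable_def glue_left cong: if_cong)

lemma bform_glue_right:
  assumes "x \<ge> 1"
  shows "bform D (L + x) (Om D (L + M)) e = (\<Sum>n\<in>Om D L. bform D x (Om D M) (\<lambda>m. e (glue L n m)))"
  unfolding bform_def sum_glue using assms
  by (simp add: move_glue_right movable_def glue_right cong: if_cong)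

lemma qf_glue:
  assumes "L \<ge> 1" "M \<ge> 1"
  shows "qf (Om D (L + M)) (Hc D (L + M)) e = (\<Sum>m\<in>Om D M. qf (Om D L) (Hc D L) (\<lambda>n. e (glue L n m)))
     + bform D L (Om D (L + M)) e + (\<Sum>n\<in>Om D L. qf (Om D M) (Hc D M) (\<lambda>m. e (glue L n m)))"
proof -
  have "qf (Om D (L + M)) (Hc D (L + M)) e = (\<Sum>x\<in>{1..<L}. bform D x (Om D (L + M)) e) + (\<Sum>x\<in>{L..<L
      + M}. bform D x (Om D (L + M)) e)"
    unfolding qf_Hc using assms by (subst sum.atLeastLessThan_concat) auto
  also have "(\<Sum>x\<in>{L..<L + M}. bform D x (Om D (L + M)) e)
      = bform D L (Om D (L + M)) e + (\<Sum>x\<in>{1 + L..<M + L}. bform D x (Om D (L + M)) e)"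
    using assms by (subst sum.atLeast_Suc_lessThan) (auto simp: add.commute)
  also have "(\<Sum>x\<in>{1 + L..<M + L}. bform D x (Om D (L + M)) e) = (\<Sum>x\<in>{1..<M}. bform D (L + x) (Om D (L + M)) e)"
    by (subst sum.shift_bounds_nat_ivl) (simp add: add.commute)
  also have "(\<Sum>x\<in>{1..<L}. bform D x (Om D (L + M)) e) = (\<Sum>m\<in>Om D M. qf (Om D L) (Hc D L) (\<lambda>n. e (glue L n m)))"
    unfolding qf_Hc by (subst sum.swap) (simp add: bform_glue_left)
  also have "(\<Sum>x\<in>{1..<M}. bform D (L + x) (Om D (L + M)) e)
      = (\<Sum>n\<in>Om D L. qf (Om D M) (Hc D M) (\<lambda>m. e (glue L n m)))"
    unfolding qf_Hc by (subst sum.swap) (simp add: bform_glue_right)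
  finally show ?thesis by simp
qed

definition tens :: "nat \<Rightarrow> state \<Rightarrow> state \<Rightarrow> state" where
  "tens L v w = (\<lambda>n. v (lo L n) * w (hi L n))"

lemma tens_glue: "n \<in> Om D L \<Longrightarrow> m \<in> Om D M \<Longrightarrow> tens L v w (glue L n m) = v n * w m"
  by (simp add: tens_def lo_glue hi_glue)

text \<open>Contracting the left factor first leaves a vector on the right chain, so Parseval and
  Bessel for products can be applied one factor at a time.\<close>

lemma ip_tens:
  "ip (Om D (L + M)) e (tens L v w) = ip (Om D M) (\<lambda>m. ip (Om D L) (\<lambda>n. e (glue L n m)) v) w"
proof -
  have "ip (Om D (L + M)) e (tens L v w) = (\<Sum>n\<in>Om D L. \<Sum>m\<in>Om D M. e (glue L n m) * (v n * w m))"
    unfolding ip_def sum_glue by (intro sum.cong refl) (simp add: tens_glue)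
  also have "\<dots> = ip (Om D M) (\<lambda>m. ip (Om D L) (\<lambda>n. e (glue L n m)) v) w"
    unfolding ip_def by (subst sum.swap) (simp add: sum_distrib_right mult.assoc)
  finally show ?thesis .
qed

lemma ip_tens_tens:
  "ip (Om D (L + M)) (tens L v w) (tens L v' w') = ip (Om D L) v v' * ip (Om D M) w w'"
proof -
  have "ip (Om D (L + M)) (tens L v w) (tens L v' w') = (\<Sum>n\<in>Om D L. \<Sum>m\<in>Om D M. (v n * v' n) * (w m * w' m))"
    unfolding ip_def sum_glue by (intro sum.cong refl) (simp add: tens_glue)
  then show ?thesis by (simp add: ip_def sum_product)
qed

lemma ip_glue: "(\<Sum>m\<in>Om D M. nsq (Om D L) (\<lambda>n. e (glue L n m))) = nsq (Om D (L + M)) e"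
  unfolding ip_def sum_glue by (rule sum.swap)

text \<open>Products of eigenvectors of the two chains diagonalise the form without the junction
  bond. That bond is nonnegative, so dropping it can only increase the partition function.\<close>

lemma Zp_submult:
  assumes LM: "L \<ge> 1" "M \<ge> 1" and b: "b \<ge> 0"
  shows "Zp D b (L + M) \<le> Zp D b L * Zp D b M"
proof -
  obtain J u l where es: "eigensystem (Om D (L + M)) (Hc D (L + M)) J u l" using Hc_eigensystem by blast
  obtain J1 u1 l1 where es1: "eigensystem (Om D L) (Hc D L) J1 u1 l1" using Hc_eigensystem by blast
  obtain J2 u2 l2 where es2: "eigensystem (Om D M) (Hc D M) J2 u2 l2" using Hc_eigensystem by blast
  note f1 = es1[unfolded eigensystem_def] and f2 = es2[unfolded eigensystem_def]
  define v where "v = (\<lambda>p. tens L (u1 (fst p)) (u2 (snd p)))"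
  have "(\<Sum>j\<in>J. exp (- (b * l j))) \<le> (\<Sum>p\<in>J1 \<times> J2. exp (- (b * (l1 (fst p) + l2 (snd p)))))"
  proof (rule partition_upper[OF es _ b])
    show "finite (J1 \<times> J2)" using f1 f2 by simp
    fix p assume "p \<in> J1 \<times> J2"
    then show "nsq (Om D (L + M)) (v p) = 1"
      using f1 f2 unfolding v_def ip_tens_tens by (auto simp: orthonormal_fam_def)
  next
    fix e
    have g1: "(\<Sum>j\<in>J2. (ip (Om D (L + M)) e (tens L (u1 i) (u2 j)))\<^sup>2)
        = (\<Sum>m\<in>Om D M. (ip (Om D L) (\<lambda>n. e (glue L n m)) (u1 i))\<^sup>2)" for i
      unfolding ip_tens eigensystem_parseval[OF es2] by (simp add: ip_def power2_eq_square)
    show "(\<Sum>k\<in>J1 \<times> J2. (ip (Om D (L + M)) e (v k))\<^sup>2) = nsq (Om D (L + M)) e"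
    proof -
      have "(\<Sum>k\<in>J1 \<times> J2. (ip (Om D (L + M)) e (v k))\<^sup>2)
          = (\<Sum>i\<in>J1. \<Sum>j\<in>J2. (ip (Om D (L + M)) e (tens L (u1 i) (u2 j)))\<^sup>2)"
        by (simp add: v_def sum.cartesian_product')
      also have "\<dots> = (\<Sum>m\<in>Om D M. \<Sum>i\<in>J1. (ip (Om D L) (\<lambda>n. e (glue L n m)) (u1 i))\<^sup>2)"
        unfolding g1 by (rule sum.swap)
      also have "\<dots> = nsq (Om D (L + M)) e"
        unfolding eigensystem_parseval[OF es1] by (rule ip_glue)
      finally show ?thesis .
    qed
    have A: "(\<Sum>i\<in>J1. \<Sum>j\<in>J2. l1 i * (ip (Om D (L + M)) e (tens L (u1 i) (u2 j)))\<^sup>2)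
       = (\<Sum>m\<in>Om D M. qf (Om D L) (Hc D L) (\<lambda>n. e (glue L n m)))"
    proof -
      have "(\<Sum>i\<in>J1. \<Sum>j\<in>J2. l1 i * (ip (Om D (L + M)) e (tens L (u1 i) (u2 j)))\<^sup>2)
         = (\<Sum>i\<in>J1. \<Sum>m\<in>Om D M. l1 i * (ip (Om D L) (\<lambda>n. e (glue L n m)) (u1 i))\<^sup>2)"
        by (simp add: sum_distrib_left[symmetric] g1)
      also have "\<dots> = (\<Sum>m\<in>Om D M. \<Sum>i\<in>J1. l1 i * (ip (Om D L) (\<lambda>n. e (glue L n m)) (u1 i))\<^sup>2)"
        by (rule sum.swap)
      finally show ?thesis by (simp add: eigensystem_qf[OF es1])
    qed
    \<comment> \<open>Contraction in the opposite order, so that the left family can be summed out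
      by Parseval while the energies sit on the right.\<close>
    have ips: "ip (Om D (L + M)) e (tens L (u1 i) (u2 j))
        = ip (Om D L) (\<lambda>n. ip (Om D M) (\<lambda>m. e (glue L n m)) (u2 j)) (u1 i)" for i j
      unfolding ip_tens unfolding ip_def sum_distrib_right by (subst sum.swap) (simp add: mult_ac)
    have g2: "(\<Sum>i\<in>J1. (ip (Om D (L + M)) e (tens L (u1 i) (u2 j)))\<^sup>2)
        = (\<Sum>n\<in>Om D L. (ip (Om D M) (\<lambda>m. e (glue L n m)) (u2 j))\<^sup>2)" for j
      unfolding ips eigensystem_parseval[OF es1] by (simp add: ip_def power2_eq_square)
    have B: "(\<Sum>i\<in>J1. \<Sum>j\<in>J2. l2 j * (ip (Om D (L + M)) e (tens L (u1 i) (u2 j)))\<^sup>2)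
       = (\<Sum>n\<in>Om D L. qf (Om D M) (Hc D M) (\<lambda>m. e (glue L n m)))"
    proof -
      have "(\<Sum>i\<in>J1. \<Sum>j\<in>J2. l2 j * (ip (Om D (L + M)) e (tens L (u1 i) (u2 j)))\<^sup>2)
         = (\<Sum>j\<in>J2. \<Sum>n\<in>Om D L. l2 j * (ip (Om D M) (\<lambda>m. e (glue L n m)) (u2 j))\<^sup>2)"
        by (subst sum.swap) (simp add: sum_distrib_left[symmetric] g2)
      also have "\<dots> = (\<Sum>n\<in>Om D L. \<Sum>j\<in>J2. l2 j * (ip (Om D M) (\<lambda>m. e (glue L n m)) (u2 j))\<^sup>2)"
        by (rule sum.swap)
      finally show ?thesis by (simp add: eigensystem_qf[OF es2])
    qed
    have "(\<Sum>k\<in>J1 \<times> J2. (l1 (fst k) + l2 (snd k)) * (ip (Om D (L + M)) e (v k))\<^sup>2)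
      = (\<Sum>i\<in>J1. \<Sum>j\<in>J2. l1 i * (ip (Om D (L + M)) e (tens L (u1 i) (u2 j)))\<^sup>2) +
        (\<Sum>i\<in>J1. \<Sum>j\<in>J2. l2 j * (ip (Om D (L + M)) e (tens L (u1 i) (u2 j)))\<^sup>2)"
      by (simp add: v_def sum.cartesian_product' sum.distrib distrib_right)
    also have "\<dots> \<le> qf (Om D (L + M)) (Hc D (L + M)) e"
      unfolding A B qf_glue[OF LM] using bform_nonneg[of D L "Om D (L + M)" e] by simp
    finally show "(\<Sum>k\<in>J1 \<times> J2. (l1 (fst k) + l2 (snd k)) * (ip (Om D (L + M)) e (v k))\<^sup>2)
        \<le> qf (Om D (L + M)) (Hc D (L + M)) e" .
  qed
  also have "\<dots> = (\<Sum>i\<in>J1. exp (- (b * l1 i))) * (\<Sum>j\<in>J2. exp (- (b * l2 j)))"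
    by (simp add: sum_product sum.cartesian_product' exp_add[symmetric] algebra_simps)
  finally show ?thesis by (simp add: Zp_spectral[OF es] Zp_spectral[OF es1] Zp_spectral[OF es2])
qed

text \<open>The state without flips has energy zero, and this single trial vector suffices. It makes
  \<open>ln (Zp D b L)\<close> nonnegative, as the limit argument requires.\<close>

lemma Zp_ge_1: "Zp D b L \<ge> 1"
proof -
  obtain J u l where es: "eigensystem (Om D L) (Hc D L) J u l" using Hc_eigensystem by blast
  let ?v = "\<lambda>n :: nat \<Rightarrow> nat. if n = (\<lambda>_. 0) then 1 else 0 :: real"
  have z: "(\<lambda>_. 0) \<in> Om D L" by (simp add: Om_def)
  have ipv: "ip (Om D L) e ?v = e (\<lambda>_. 0)" for e
    using ip_unit[OF finite_Om z] by (simp add: ip_commute)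
  have mz: "move x n \<noteq> (\<lambda>_. 0)" for x and n :: "nat \<Rightarrow> nat"
    by (auto simp: move_def fun_eq_iff intro!: exI[of _ x])
  have "bform D x (Om D L) ?v = 0" for x
    unfolding bform_def using mz by (intro sum.neutral) (auto simp: movable_def)
  then have "qf (Om D L) (Hc D L) ?v = 0" by (simp add: qf_Hc)
  moreover have "(e (\<lambda>_. 0))\<^sup>2 \<le> nsq (Om D L) e" for e :: "state"
    unfolding ip_def power2_eq_square using z finite_Om
        by (intro member_le_sum[of "\<lambda>_. 0" _ "\<lambda>x. e x * e x"]) auto
  ultimately have "1 \<le> (\<Sum>j\<in>J. exp (- (b * l j)))"
    using peierls[OF es, of "{0 :: nat}" "\<lambda>_. ?v" b] by (simp add: ipv)
  then show ?thesis by (simp add: Zp_spectral[OF es])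
qed

section \<open>Trial families and their tensor products\<close>

text \<open>The quadratic form of the chain with one more, unflipped spin attached at its left end.\<close>

definition dform :: "nat \<Rightarrow> nat \<Rightarrow> state \<Rightarrow> real" where
  "dform D L v = qf (Om D L) (Hc D L) v + half D * (\<Sum>n\<in>Om D L. real (n 1) * (v n)\<^sup>2)"

abbreviation peierls_weight :: "nat \<Rightarrow> real \<Rightarrow> nat \<Rightarrow> state \<Rightarrow> real" where
  "peierls_weight D b L v \<equiv> nsq (Om D L) v * exp (- (b * dform D L v / nsq (Om D L) v))"

text \<open>\<open>W\<close> is a Peierls lower bound for the partition function, realised
    by trial vectors with unflipped last spin.\<close>

definition trial :: "nat \<Rightarrow> real \<Rightarrow> nat \<Rightarrow> real \<Rightarrow> bool" where
  "trial D b L W \<longleftrightarrow> (\<exists>(I :: nat set) v. finite I \<and> (\<forall>i\<in>I. nsq (Om D L) (v i) > 0) \<and>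
     (\<forall>i\<in>I. \<forall>n. n L \<noteq> 0 \<longrightarrow> v i n = 0) \<and>
     (\<forall>e. (\<Sum>i\<in>I. (ip (Om D L) e (v i))\<^sup>2) \<le> nsq (Om D L) e) \<and>
     W \<le> (\<Sum>i\<in>I. peierls_weight D b L (v i)))"

lemma trialE:
  assumes "trial D b L W"
  obtains I :: "nat set" and v where "finite I" "\<forall>i\<in>I. nsq (Om D L) (v i) > 0"
    "\<forall>i\<in>I. \<forall>n. n L \<noteq> 0 \<longrightarrow> v i n = 0"
    "\<forall>e. (\<Sum>i\<in>I. (ip (Om D L) e (v i))\<^sup>2) \<le> nsq (Om D L) e"
    "W \<le> (\<Sum>i\<in>I. peierls_weight D b L (v i))"
  using assms unfolding trial_def by (elim exE conjE) (rule that)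

lemma trial_Zp:
  assumes "trial D b L W" "b \<ge> 0"
  shows "W \<le> Zp D b L"
proof -
  obtain I :: "nat set" and v where Iv: "finite I" "\<forall>i\<in>I. nsq (Om D L) (v i) > 0"
    "\<forall>e. (\<Sum>i\<in>I. (ip (Om D L) e (v i))\<^sup>2) \<le> nsq (Om D L) e"
    "W \<le> (\<Sum>i\<in>I. peierls_weight D b L (v i))"
    using assms(1) by (rule trialE)
  note I = Iv(1) bspec[OF Iv(2)] spec[OF Iv(3)] Iv(4)
  obtain J u l where es: "eigensystem (Om D L) (Hc D L) J u l" using Hc_eigensystem by blast
  note I(4)
  also have "(\<Sum>i\<in>I. peierls_weight D b L (v i))
     \<le> (\<Sum>i\<in>I. nsq (Om D L) (v i) * exp (- (b * qf (Om D L) (Hc D L) (v i) / nsq (Om D L) (v i))))"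
  proof (intro sum_mono mult_left_mono)
    fix i assume i: "i \<in> I"
    have "qf (Om D L) (Hc D L) (v i) \<le> dform D L (v i)"
      by (auto simp: dform_def half_def intro!: sum_nonneg mult_nonneg_nonneg)
    then show "exp (- (b * dform D L (v i) / nsq (Om D L) (v i)))
        \<le> exp (- (b * qf (Om D L) (Hc D L) (v i) / nsq (Om D L) (v i)))"
      using assms(2) I(2)[OF i] by (simp add: divide_right_mono mult_left_mono)
  qed (use I(2) in \<open>auto simp: less_imp_le\<close>)
  also have "\<dots> \<le> (\<Sum>j\<in>J. exp (- (b * l j)))"
    using I by (intro peierls[OF es]) auto
  finally show ?thesis by (simp add: Zp_spectral[OF es])
qed

text \<open>Moving a flip across the junction puts it on site \<open>L\<close>, where
  \<open>v\<close> allows none. So one term of each square vanishes and the bond sees an unflipped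
  left neighbour.\<close>

lemma bform_tens_junction:
  assumes D: "D \<ge> 1" and LM: "L \<ge> 1" "M \<ge> 1" and v: "\<And>n. n L \<noteq> 0 \<Longrightarrow> v n = 0"
  shows "bform D L (Om D (L + M)) (tens L v w) = half D * nsq (Om D L) v * (\<Sum>m\<in>Om D M. real (m 1) * (w m)\<^sup>2)"
proof -
  have "bform D L (Om D (L + M)) (tens L v w) = (\<Sum>n\<in>Om D L. \<Sum>m\<in>Om D M. half D * (v n * v n) * (real (m 1)
      * (w m)\<^sup>2))"
    unfolding bform_def sum_glue
  proof (intro sum.cong refl)
    fix n m assume nm: "n \<in> Om D L" "m \<in> Om D M"
    have j: "glue L n m L = n L" "glue L n m (Suc L) = m 1" by (auto simp: glue_def)
    have mv: "tens L v w (move L (glue L n m)) = 0"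
    proof -
      have "lo L (move L (glue L n m)) L \<noteq> 0" by (simp add: lo_def move_def)
      then show ?thesis by (simp add: tens_def v)
    qed
    show "(if movable D L (glue L n m)
         then (sqrt ((real D - real (glue L n m L)) * real (glue L n m (Suc L))) * tens L v w (glue L n m) -
               sqrt (real (Suc (glue L n m L)) * (real D - real (glue L n m (Suc L)) + 1))
                   * tens L v w (move L (glue L n m)))\<^sup>2 / 2
         else 0) = half D * (v n * v n) * (real (m 1) * (w m)\<^sup>2)"
    proof (cases "n L = 0")
      case True
      then show ?thesis using D
        by (auto simp: mv j tens_glue[OF nm] movable_def power_mult_distrib half_def power2_eq_square)
    qed (simp add: mv tens_glue[OF nm] v)
  qed
  also have "\<dots> = half D * nsq (Om D L) v * (\<Sum>m\<in>Om D M. real (m 1) * (w m)\<^sup>2)"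
    by (simp only: sum_distrib_left[symmetric] sum_distrib_right[symmetric] ip_def)
  finally show ?thesis .
qed

lemma qf_scale: "qf I a (\<lambda>x. c * v x) = c\<^sup>2 * qf I a v"
  by (simp add: qf_def sum_distrib_left power2_eq_square algebra_simps)

lemma qf_cong: "(\<And>x. x \<in> I \<Longrightarrow> v x = w x) \<Longrightarrow> qf I a v = qf I a w"
  unfolding qf_def by (intro sum.cong) auto

text \<open>The junction contributes precisely the boundary term that \<open>dform\<close> adds to
  the right chain. This is why the trial vectors end in an unflipped spin: relative to the norms,
  energies then add without an interaction.\<close>

lemma dform_tens:
  assumes D: "D \<ge> 1" and LM: "L \<ge> 1" "M \<ge> 1" and v: "\<And>n. n L \<noteq> 0 \<Longrightarrow> v n = 0"
  shows "dform D (L + M) (tens L v w) = dform D L v * nsq (Om D M) w + nsq (Om D L) v * dform D M w"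
proof -
  have A: "(\<Sum>m\<in>Om D M. qf (Om D L) (Hc D L) (\<lambda>n. tens L v w (glue L n m)))
      = qf (Om D L) (Hc D L) v * nsq (Om D M) w"
  proof -
    have "(\<Sum>m\<in>Om D M. qf (Om D L) (Hc D L) (\<lambda>n. tens L v w (glue L n m)))
        = (\<Sum>m\<in>Om D M. (w m)\<^sup>2 * qf (Om D L) (Hc D L) v)"
      unfolding qf_scale[symmetric] by (intro sum.cong refl qf_cong) (simp add: tens_glue mult.commute)
    also have "\<dots> = (\<Sum>m\<in>Om D M. (w m)\<^sup>2) * qf (Om D L) (Hc D L) v" by (rule sum_distrib_right[symmetric])
    finally show ?thesis by (simp add: ip_def power2_eq_square mult.commute)
  qed
  have B: "(\<Sum>n\<in>Om D L. qf (Om D M) (Hc D M) (\<lambda>m. tens L v w (glue L n m)))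
      = nsq (Om D L) v * qf (Om D M) (Hc D M) w"
  proof -
    have "(\<Sum>n\<in>Om D L. qf (Om D M) (Hc D M) (\<lambda>m. tens L v w (glue L n m)))
        = (\<Sum>n\<in>Om D L. (v n)\<^sup>2 * qf (Om D M) (Hc D M) w)"
      unfolding qf_scale[symmetric] by (intro sum.cong refl qf_cong) (simp add: tens_glue)
    then show ?thesis by (simp add: ip_def power2_eq_square sum_distrib_right)
  qed
  have C: "(\<Sum>n\<in>Om D (L + M). real (n 1) * (tens L v w n)\<^sup>2)
      = (\<Sum>n\<in>Om D L. real (n 1) * (v n)\<^sup>2) * nsq (Om D M) w"
  proof -
    have "(\<Sum>n\<in>Om D (L + M). real (n 1) * (tens L v w n)\<^sup>2)
        = (\<Sum>n\<in>Om D L. \<Sum>m\<in>Om D M. (real (n 1) * (v n)\<^sup>2) * (w m * w m))"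
      unfolding sum_glue using LM
      by (intro sum.cong refl) (simp add: tens_glue power_mult_distrib power2_eq_square, simp add: glue_def)
    then show ?thesis by (simp add: ip_def sum_product)
  qed
  have J: "bform D L (Om D (L + M)) (tens L v w) = half D * nsq (Om D L) v * (\<Sum>m\<in>Om D M. real (m 1) * (w m)\<^sup>2)"
    by (rule bform_tens_junction[OF D LM]) (rule v)
  show ?thesis
    unfolding dform_def qf_glue[OF LM] A B C J by (simp add: algebra_simps)
qed

text \<open>Norms multiply and energies per squared norm add, so the Peierls weights factorise.
  Bessel's inequality is applied first on the right chain and then on the left.\<close>

lemma trial_mult:
  assumes D: "D \<ge> 1" and LM: "L \<ge> 1" "M \<ge> 1" and W: "trial D b L W" "trial D b M W'" "W \<ge> 0" "W' \<ge> 0"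
  shows "trial D b (L + M) (W * W')"
proof -
  obtain I :: "nat set" and v where Iv: "finite I" "\<forall>i\<in>I. nsq (Om D L) (v i) > 0"
    "\<forall>i\<in>I. \<forall>n. n L \<noteq> 0 \<longrightarrow> v i n = 0"
    "\<forall>e. (\<Sum>i\<in>I. (ip (Om D L) e (v i))\<^sup>2) \<le> nsq (Om D L) e"
    "W \<le> (\<Sum>i\<in>I. peierls_weight D b L (v i))"
    using W(1) by (rule trialE)
  note I = Iv(1) bspec[OF Iv(2)] mp[OF spec[OF bspec[OF Iv(3)]]] spec[OF Iv(4)] Iv(5)
  obtain K :: "nat set" and w where Kw: "finite K" "\<forall>i\<in>K. nsq (Om D M) (w i) > 0"
    "\<forall>i\<in>K. \<forall>n. n M \<noteq> 0 \<longrightarrow> w i n = 0"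
    "\<forall>e. (\<Sum>i\<in>K. (ip (Om D M) e (w i))\<^sup>2) \<le> nsq (Om D M) e"
    "W' \<le> (\<Sum>i\<in>K. peierls_weight D b M (w i))"
    using W(2) by (rule trialE)
  note K = Kw(1) bspec[OF Kw(2)] mp[OF spec[OF bspec[OF Kw(3)]]] spec[OF Kw(4)] Kw(5)
  \<comment> \<open>Pairs of indices are encoded as numbers, since \<open>trial\<close> indexes its
    vectors by naturals.\<close>
  define t where "t = (\<lambda>p. tens L (v (fst (prod_decode p))) (w (snd (prod_decode p))))"
  define N where "N = prod_encode ` (I \<times> K)"
  have sumN: "(\<Sum>p\<in>N. F (t p)) = (\<Sum>i\<in>I. \<Sum>k\<in>K. F (tens L (v i) (w k)))" for F :: "state \<Rightarrow> real"
    unfolding N_def t_def by (subst sum.reindex) (auto simp: inj_on_def sum.cartesian_product')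
  show ?thesis unfolding trial_def
  proof (intro exI[of _ N] exI[of _ t] conjI ballI allI impI)
    show "finite N" using I(1) K(1) by (simp add: N_def)
    fix p assume "p \<in> N"
    then obtain i k where ik: "i \<in> I" "k \<in> K" "t p = tens L (v i) (w k)" by (auto simp: N_def t_def)
    show "nsq (Om D (L + M)) (t p) > 0" unfolding ik(3) ip_tens_tens using I(2)[OF ik(1)] K(2)[OF ik(2)] by simp
    fix n :: "nat \<Rightarrow> nat" assume "n (L + M) \<noteq> 0"
    then have "hi L n M \<noteq> 0" using LM by (simp add: hi_def add.commute)
    then show "t p n = 0" unfolding ik(3) tens_def using K(3)[OF ik(2)] by simp
  next
    fix e
    have "(\<Sum>p\<in>N. (ip (Om D (L + M)) e (t p))\<^sup>2) = (\<Sum>i\<in>I. \<Sum>k\<in>K. (ip (Om D M) (\<lambda>m. ip (Om D L) (\<lambda>n. e (glue L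
        n m)) (v i)) (w k))\<^sup>2)"
      using sumN[of "\<lambda>x. (ip (Om D (L + M)) e x)\<^sup>2"] by (simp only: ip_tens)
    also have "\<dots> \<le> (\<Sum>i\<in>I. ip (Om D M) (\<lambda>m. ip (Om D L) (\<lambda>n. e (glue L n m)) (v i)) (\<lambda>m. ip (Om D L) (\<lambda>n. e
        (glue L n m)) (v i)))"
      by (intro sum_mono K(4))
    also have "\<dots> = (\<Sum>m\<in>Om D M. \<Sum>i\<in>I. (ip (Om D L) (\<lambda>n. e (glue L n m)) (v i))\<^sup>2)"
      unfolding ip_def[of "Om D M"] power2_eq_square by (rule sum.swap)
    also have "\<dots> \<le> (\<Sum>m\<in>Om D M. nsq (Om D L) (\<lambda>n. e (glue L n m)))"
      by (intro sum_mono I(4))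
    also have "\<dots> = nsq (Om D (L + M)) e" by (rule ip_glue)
    finally show "(\<Sum>p\<in>N. (ip (Om D (L + M)) e (t p))\<^sup>2) \<le> nsq (Om D (L + M)) e" .
  next
    let ?a = "\<lambda>i. nsq (Om D L) (v i)" and ?c = "\<lambda>k. nsq (Om D M) (w k)"
    have "W * W' \<le> (\<Sum>i\<in>I. ?a i * exp (- (b * dform D L (v i) / ?a i))) * (\<Sum>k\<in>K. ?c k * exp (- (b
        * dform D M (w k) / ?c k)))"
      using I(5) K(5) W by (intro mult_mono) auto
    also have "\<dots> = (\<Sum>i\<in>I. \<Sum>k\<in>K. ?a i * ?c k * exp (- (b * dform D (L + M) (tens L (v i) (w k)) / (?a i
        * ?c k))))"
      unfolding sum_product
    proof (intro sum.cong refl)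
      fix i k assume ik: "i \<in> I" "k \<in> K"
      have d: "dform D (L + M) (tens L (v i) (w k)) = dform D L (v i) * ?c k + ?a i * dform D M (w k)"
        using I(3)[OF ik(1)] by (intro dform_tens[OF D LM]) auto
      have "b * dform D (L + M) (tens L (v i) (w k)) / (?a i * ?c k)
          = b * dform D L (v i) / ?a i + b * dform D M (w k) / ?c k"
        unfolding d using I(2)[OF ik(1)] K(2)[OF ik(2)] by (simp add: field_simps)
      then show "?a i * exp (- (b * dform D L (v i) / ?a i)) * (?c k * exp (- (b * dform D M (w k) / ?c k))) =
         ?a i * ?c k * exp (- (b * dform D (L + M) (tens L (v i) (w k)) / (?a i * ?c k)))"
        by (simp add: exp_add[symmetric])
    qed
    also have "\<dots> = (\<Sum>p\<in>N. peierls_weight D b (L + M) (t p))"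
      using sumN[of "\<lambda>x. peierls_weight D b (L + M) x"]
      by (simp only: ip_tens_tens)
    finally show "W * W' \<le> (\<Sum>p\<in>N. peierls_weight D b (L + M) (t p))" .
  qed
qed

lemma trial_power:
  assumes "D \<ge> 1" "L \<ge> 1" "trial D b L W" "W \<ge> 0"
  shows "trial D b (Suc q * L) (W ^ Suc q)"
proof (induction q)
  case (Suc q)
  have "trial D b (L + Suc q * L) (W * W ^ Suc q)"
    using assms Suc by (intro trial_mult) auto
  then show ?case by simp
qed (use assms in simp)

section \<open>Spin waves on a block\<close>

text \<open>The spin counterpart of the boson weight \<open>1 / fact j\<close>, to which it
  converges as \<open>D\<close> tends to infinity.\<close>

definition nu1 :: "nat \<Rightarrow> nat \<Rightarrow> real" where
  "nu1 D j = real (D choose j) / real D ^ j"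

definition nu :: "nat \<Rightarrow> nat set \<Rightarrow> state" where
  "nu D X n = (\<Prod>x\<in>X. nu1 D (n x))"

lemma nu1_Suc:
  assumes "D \<ge> 1"
  shows "nu1 D (Suc j) * (real D * real (Suc j)) = nu1 D j * (real D - real j)"
proof -
  have "real (D choose Suc j) * real (Suc j) = real (D choose j) * (real D - real j)"
  proof (cases "j \<le> D")
    case True
    have "Suc j * (D choose Suc j) = (D - j) * (D choose j)"
      by (simp only: binomial_absorption binomial_absorb_comp)
    then have "real (Suc j * (D choose Suc j)) = real ((D - j) * (D choose j))" by simp
    then show ?thesis using True by (simp add: of_nat_diff algebra_simps)
  qed (simp add: binomial_eq_0)
  moreover have "nu1 D (Suc j) * (real D * real (Suc j)) = real (D choose Suc j) * real (Suc j) / real D ^ j"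
    using assms by (simp add: nu1_def del: of_nat_Suc)
  ultimately show ?thesis by (simp add: nu1_def)
qed

lemma nu1_nonneg: "nu1 D j \<ge> 0"
  by (simp add: nu1_def)

text \<open>The quantity is the product of \<open>1 - i / D\<close> over \<open>i < j\<close>.
  Estimating \<open>i / D\<close> by \<open>i\<close> keeps the lower bound, and with it the final
  constants, uniform in the spin.\<close>

lemma nu1_fact:
  assumes D: "D \<ge> 1"
  shows "nu1 D j * fact j \<le> 1 \<and> nu1 D j * fact j \<ge> 1 - real j * (real j - 1) / 2"
proof (induction j)
  case 0
  then show ?case by (simp add: nu1_def)
next
  case (Suc j)
  define g where "g = nu1 D j * fact j"
  have g0: "g \<ge> 0" by (simp add: g_def nu1_nonneg)
  have "nu1 D (Suc j) * fact (Suc j) * real D = nu1 D (Suc j) * (real D * real (Suc j)) * fact j"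
    by (simp add: algebra_simps)
  also have "\<dots> = g * (real D - real j)"
    unfolding nu1_Suc[OF D] by (simp add: g_def)
  finally have e: "nu1 D (Suc j) * fact (Suc j) = g - g * (real j / real D)"
    using D by (simp add: field_simps)
  have "g * (real j / real D) \<le> 1 * (real j / 1)"
    using Suc D g0 unfolding g_def[symmetric] by (intro mult_mono divide_left_mono) auto
  moreover have "g * (real j / real D) \<ge> 0" using g0 by simp
  moreover have "1 - real (Suc j) * (real (Suc j) - 1) / 2 = 1 - real j * (real j - 1) / 2 - real j"
    by (simp add: field_simps)
  ultimately show ?case
    using Suc unfolding e g_def[symmetric] by linarith
qed

lemma nu_nonneg: "nu D X n \<ge> 0"
  by (auto simp: nu_def nu1_nonneg intro!: prod_nonneg)

lemma nu_eq_mu: "nu D X n = mu X n * (\<Prod>x\<in>X. nu1 D (n x) * fact (n x))"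
  unfolding nu_def mu_def prod.distrib[symmetric] by (intro prod.cong refl) simp

lemma nu_le_mu:
  assumes "D \<ge> 1"
  shows "nu D X n \<le> mu X n"
proof -
  have "(\<Prod>x\<in>X. nu1 D (n x) * fact (n x)) \<le> 1"
    using nu1_fact[OF assms] nu1_nonneg by (intro prod_le_1) auto
  then show ?thesis unfolding nu_eq_mu using mu_pos[of X n] by (simp add: mult_left_le)
qed

lemma prod_ge_one_minus_sum:
  fixes g a :: "'a \<Rightarrow> real"
  assumes "finite X" "\<And>x. x \<in> X \<Longrightarrow> 0 \<le> g x \<and> g x \<le> 1 \<and> 1 - a x \<le> g x"
  shows "1 - (\<Sum>x\<in>X. a x) \<le> (\<Prod>x\<in>X. g x)"
  using assms
proof (induction X)
  case (insert x X)
  have p: "0 \<le> prod g X" "prod g X \<le> 1"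
    using insert.prems by (auto intro!: prod_nonneg prod_le_1)
  have "prod g X - a x \<le> g x * prod g X"
  proof -
    have "(1 - g x) * prod g X \<le> (1 - g x) * 1" using insert.prems[of x] p by (intro mult_left_mono) auto
    then show ?thesis using insert.prems[of x] by (simp add: algebra_simps)
  qed
  then show ?case using insert by fastforce
qed simp

lemma nu_ge:
  assumes "D \<ge> 1" "finite X"
  shows "nu D X n \<ge> mu X n * (1 - (\<Sum>x\<in>X. real (n x) * (real (n x) - 1) / 2))"
  unfolding nu_eq_mu using mu_pos[of X n] nu1_fact[OF assms(1)] nu1_nonneg
  by (intro mult_left_mono prod_ge_one_minus_sum assms(2)) auto

text \<open>Detailed balance: after multiplication by the square roots of the weights, the two
  coefficients in \<open>bform\<close> coincide, and the bond energy sees only the difference of the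
  values of \<open>chi\<close>.\<close>

lemma nu_move:
  assumes D: "D \<ge> 1" and X: "finite X" "x \<in> X" "Suc x \<in> X" and n: "n (Suc x) > 0"
  shows "nu D X (move x n) * (real (Suc (n x)) * (real D - real (n (Suc x)) + 1))
      = nu D X n * ((real D - real (n x)) * real (n (Suc x)))"
proof -
  let ?y = "Suc x"
  define P where "P = (\<Prod>z\<in>X - {x} - {?y}. nu1 D (n z))"
  have spl: "nu D X m = nu1 D (m x) * (nu1 D (m ?y) * (\<Prod>z\<in>X - {x} - {?y}. nu1 D (m z)))" for m
    unfolding nu_def using X by (subst prod.remove[of X x], simp, simp, subst prod.remove[of "X - {x}" ?y]) auto
  have P: "(\<Prod>z\<in>X - {x} - {?y}. nu1 D (move x n z)) = P"
    unfolding P_def by (intro prod.cong) (auto simp: move_def)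
  obtain j where j: "n ?y = Suc j" using n by (cases "n ?y") auto
  have a: "nu1 D (Suc (n x)) * (real D * real (Suc (n x))) = nu1 D (n x) * (real D - real (n x))"
    by (rule nu1_Suc[OF D])
  have b: "nu1 D (Suc j) * (real D * real (Suc j)) = nu1 D j * (real D - real j)"
    by (rule nu1_Suc[OF D])
  have "real D * (nu D X (move x n) * (real (Suc (n x)) * (real D - real (n ?y) + 1)))
     = P * (nu1 D (Suc (n x)) * (real D * real (Suc (n x)))) * (nu1 D j * (real D - real j))"
    unfolding spl[of "move x n"] P using j by (simp add: move_def)
  also have "\<dots> = real D * (nu D X n * ((real D - real (n x)) * real (n ?y)))"
    unfolding a b[symmetric] spl[of n] P_def[symmetric] using j by simp
  finally show ?thesis using D by simp
qed

context modes
begin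

lemma chi_supp: "chi M n \<noteq> 0 \<Longrightarrow> sum n X = size M"
proof (induction M arbitrary: n)
  case empty
  then show ?case by (simp add: chi_empty vac_def split: if_splits)
next
  case (add k M)
  from add.prems obtain x where x: "x \<in> X" "n x \<noteq> 0" "chi M (n(x := n x - 1)) \<noteq> 0"
    unfolding chi_add crea_def cre_def by (metis (no_types, lifting) mult_eq_0_iff of_nat_0 sum.neutral)
  have "sum (n(x := n x - 1)) X = size M" by (rule add.IH[OF x(3)])
  moreover have "sum (n(x := n x - 1)) X = n x - 1 + sum n (X - {x})"
    using finX x(1) by (subst sum.remove[of X x]) auto
  moreover have "sum n X = n x + sum n (X - {x})" using finX x(1) by (subst sum.remove[of X x n]) auto
  ultimately show ?case using x(2) by simp
qed

lemma chi_zero_site: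
  assumes "\<And>k. k \<in> K \<Longrightarrow> u k y = 0" "set_mset M \<subseteq> K" "n y \<noteq> 0"
  shows "chi M n = 0"
  using assms(2,3)
proof (induction M arbitrary: n)
  case empty
  then show ?case by (auto simp: chi_empty vac_def)
next
  case (add k M)
  have "u k x * cre x (chi M) n = 0" for x
    using add assms(1)[of k] by (cases "x = y") (auto simp: cre_def)
  then show ?case by (simp add: chi_add crea_def)
qed

end

section \<open>Spin wave vectors: energy, norm and Bessel's inequality\<close>

locale block = modes "{1..l}" K u for l K u +
  fixes D :: nat
  assumes D: "D \<ge> 1" and l: "l \<ge> 1" and last: "\<And>k. k \<in> K \<Longrightarrow> u k l = 0"
begin

abbreviation "X \<equiv> {1..l}"

text \<open>Since \<open>(S\<^sup>-)\<^sup>j\<close> maps the top weight vector to a vector of norm squared \<open>(fact j)\<^sup>2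
    * (D choose j)\<close>, this is the
  spin wave product with \<open>S\<^sup>-\<^sub>x / sqrt D\<close> in place of the creation operator at \<open>x\<close>.\<close>

definition vec :: "nat multiset \<Rightarrow> state" where
  "vec M n = sqrt (nu D X n) * chi M n / sqrt (nrm M)"

lemma vec_square: "(vec M n)\<^sup>2 = nu D X n * (chi M n)\<^sup>2 / nrm M"
  using nu_nonneg[of D X n] nrm_pos[of M] by (simp add: vec_def power_mult_distrib power_divide less_imp_le)

lemma vec_supp: "vec M n \<noteq> 0 \<Longrightarrow> n \<in> Om D l \<Longrightarrow> n \<in> cfgs X (size M)"
  using chi_supp[of M n] by (auto simp: vec_def cfgs_def Om_def)

text \<open>The passage from spins to bosons: boson configurations with more than \<open>D\<close>
  particles on a site are absent from \<open>Om D l\<close> and only add nonnegative terms.\<close>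

lemma sum_Om_le_cfgs:
  assumes "\<And>n. n \<in> Om D l \<Longrightarrow> G n \<noteq> 0 \<Longrightarrow> n \<in> cfgs X N" "\<And>n. n \<in> Om D l \<Longrightarrow> n \<in> cfgs X N \<Longrightarrow> G n \<le> F n" "\<And>n. F n
      \<ge> (0 :: real)"
  shows "(\<Sum>n\<in>Om D l. G n) \<le> (\<Sum>n\<in>cfgs X N. F n)"
proof -
  have "(\<Sum>n\<in>Om D l. G n) = (\<Sum>n\<in>Om D l \<inter> cfgs X N. G n)"
    using finite_Om assms(1) by (intro sum.mono_neutral_right) auto
  also have "\<dots> \<le> (\<Sum>n\<in>Om D l \<inter> cfgs X N. F n)" using assms(2) by (intro sum_mono) auto
  also have "\<dots> \<le> (\<Sum>n\<in>cfgs X N. F n)" using assms(3) finite_cfgs[of X N] by (intro sum_mono2) auto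
  finally show ?thesis .
qed

text \<open>Detailed balance gives both terms of the square the common factor \<open>sqrt T\<close>,
  and \<open>T\<close> is at most \<open>D * n (Suc x) * mu X n\<close>. The factor
  \<open>n (Suc x)\<close> then removes a boson and turns the difference into a difference of
  annihilation operators, whose norm is diagonal in the modes.\<close>

lemma bform_vec_le:
  assumes M: "set_mset M \<subseteq> K" "size M = Suc N" and x: "x \<in> {1..<l}"
  shows "bform D x (Om D l) (vec M) \<le> half D * (\<Sum>k\<in>K. real (count M k) * (u k (Suc x) - u k x)\<^sup>2)"
proof -
  let ?y = "Suc x"
  have xX: "x \<in> X" "?y \<in> X" using x by auto
  define F where "F = (\<lambda>n. (chi M n - chi M (move x n))\<^sup>2)"
  have "bform D x (Om D l) (vec M) \<le> (\<Sum>n\<in>cfgs X (Suc N). half D / nrm M * (mu X n * real (n ?y) * F n))"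
    unfolding bform_def
  proof (rule sum_Om_le_cfgs)
    fix n assume n: "n \<in> Om D l"
    let ?A = "(sqrt ((real D - real (n x)) * real (n ?y)) * vec M n - sqrt (real (Suc (n x)) * (real D
        - real (n ?y) + 1)) * vec M (move x n))\<^sup>2 / 2"
    have le: "n x \<le> D" "n ?y \<le> D" using n by (auto simp: Om_def)
    show "(if movable D x n then ?A else 0) \<le> half D / nrm M * (mu X n * real (n ?y) * F n)"
    proof (cases "movable D x n")
      case True
      define T where "T = (real D - real (n x)) * real (n ?y) * nu D X n"
      have T0: "T \<ge> 0" using le nu_nonneg[of D X n] by (simp add: T_def)
      have a: "sqrt ((real D - real (n x)) * real (n ?y)) * vec M n = sqrt T * chi M n / sqrt (nrm M)"
        by (simp add: vec_def T_def real_sqrt_mult)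
      have "real (Suc (n x)) * (real D - real (n ?y) + 1) * nu D X (move x n) = T"
        using nu_move[OF D _ xX, of n] True by (simp add: T_def movable_def mult.commute)
      then have b: "sqrt (real (Suc (n x)) * (real D - real (n ?y) + 1)) * vec M (move x n)
          = sqrt T * chi M (move x n) / sqrt (nrm M)"
        unfolding vec_def by (metis (no_types, lifting) mult.assoc real_sqrt_mult times_divide_eq_right)
      have "?A = T * F n / nrm M / 2"
        unfolding a b F_def using T0 nrm_pos[of M]
        by (simp add: diff_divide_distrib[symmetric] right_diff_distrib[symmetric] power_divide
            power_mult_distrib less_imp_le)
      also have "\<dots> \<le> (real D * real (n ?y) * mu X n) * F n / nrm M / 2"
      proof -
        have "T \<le> real D * real (n ?y) * mu X n"
          unfolding T_def using le nu_le_mu[OF D, of X n] nu_nonneg[of D X n]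
          by (intro mult_mono) auto
        then show ?thesis using nrm_pos[of M] by (intro divide_right_mono mult_right_mono) (auto simp: F_def
            less_imp_le)
      qed
      finally show ?thesis using True by (simp add: half_def algebra_simps)
    next
      case False
      then show ?thesis using mu_pos[of X n] nrm_pos[of M] by (simp add: half_def F_def less_imp_le)
    qed
    assume "(if movable D x n then ?A else 0) \<noteq> 0"
    then have mv: "movable D x n" and "vec M n \<noteq> 0 \<or> vec M (move x n) \<noteq> 0" by (auto split: if_splits)
    then have "chi M n \<noteq> 0 \<or> chi M (move x n) \<noteq> 0" by (auto simp: vec_def)
    moreover have "sum (move x n) X = sum n X"
    proof -
      have s: "sum m X = m x + (m ?y + sum m (X - {x} - {?y}))" for m :: "nat \<Rightarrow> nat"
        using xX by (subst sum.remove[of X x], simp, simp, subst sum.remove[of "X - {x}" ?y]) auto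
      have "sum (move x n) (X - {x} - {?y}) = sum n (X - {x} - {?y})"
        by (intro sum.cong) (auto simp: move_def)
      then show ?thesis using mv unfolding s[of n] s[of "move x n"] by (simp add: move_def movable_def)
    qed
    ultimately have "sum n X = Suc N" using chi_supp M(2) by metis
    then show "n \<in> cfgs X (Suc N)" using n by (auto simp: cfgs_def Om_def)
  next
    fix n show "half D / nrm M * (mu X n * real (n ?y) * F n) \<ge> 0"
      using mu_pos[of X n] nrm_pos[of M] by (simp add: half_def F_def less_imp_le)
  qed
  also have "\<dots> = half D / nrm M * (\<Sum>m\<in>cfgs X N. mu X m * F (m(?y := Suc (m ?y))))"
    unfolding sum_distrib_left[symmetric] using xX by (subst sum_cfgs_shift) auto
  also have "(\<Sum>m\<in>cfgs X N. mu X m * F (m(?y := Suc (m ?y))))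
     = fip X N (\<lambda>n. ann ?y (chi M) n - ann x (chi M) n) (\<lambda>n. ann ?y (chi M) n - ann x (chi M) n)"
    unfolding fip_def F_def ann_def
  proof (intro sum.cong refl)
    fix m :: "nat \<Rightarrow> nat"
    \<comment> \<open>Moving the boson just added at \<open>Suc x\<close> amounts to adding it at
      \<open>x\<close> instead.\<close>
    have "move x (m(?y := Suc (m ?y))) = m(x := Suc (m x))" by (auto simp: move_def fun_eq_iff)
    then show "mu X m * (chi M (m(?y := Suc (m ?y))) - chi M (move x (m(?y := Suc (m ?y)))))\<^sup>2 =
      mu X m * (chi M (m(?y := Suc (m ?y))) - chi M (m(x := Suc (m x)))) * (chi M (m(?y := Suc (m ?y)))
          - chi M (m(x := Suc (m x))))"
      by (simp add: power2_eq_square)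
  qed
  also have "\<dots> = nrm M * (\<Sum>k\<in>K. real (count M k) * (u k ?y - u k x)\<^sup>2)"
    by (rule fip_gradient[OF M xX])
  finally show ?thesis using nrm_pos[of M] by simp
qed

lemma left_vec_le:
  assumes M: "set_mset M \<subseteq> K" "size M = Suc N"
  shows "(\<Sum>n\<in>Om D l. real (n 1) * (vec M n)\<^sup>2) \<le> (\<Sum>k\<in>K. real (count M k) * (u k 1)\<^sup>2)"
proof -
  have "(\<Sum>n\<in>Om D l. real (n 1) * (vec M n)\<^sup>2) \<le> (\<Sum>n\<in>cfgs X (Suc N). 1 / nrm M * (mu X n * real (n 1)
      * (chi M n)\<^sup>2))"
  proof (rule sum_Om_le_cfgs)
    fix n assume n: "n \<in> Om D l"
    show "real (n 1) * (vec M n)\<^sup>2 \<noteq> 0 \<Longrightarrow> n \<in> cfgs X (Suc N)"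
      using vec_supp[OF _ n, of M] M(2) by auto
    show "real (n 1) * (vec M n)\<^sup>2 \<le> 1 / nrm M * (mu X n * real (n 1) * (chi M n)\<^sup>2)"
    proof -
      have "real (n 1) * (chi M n)\<^sup>2 / nrm M * nu D X n \<le> real (n 1) * (chi M n)\<^sup>2 / nrm M * mu X n"
        using nrm_pos[of M] by (intro mult_left_mono nu_le_mu D) (auto simp: less_imp_le)
      then show ?thesis by (simp add: vec_square algebra_simps)
    qed
  next
    fix n show "1 / nrm M * (mu X n * real (n 1) * (chi M n)\<^sup>2) \<ge> 0"
      using mu_pos[of X n] nrm_pos[of M] by (simp add: less_imp_le)
  qed
  also have "\<dots> = 1 / nrm M * (\<Sum>m\<in>cfgs X N. mu X m * (chi M (m(1 := Suc (m 1))))\<^sup>2)"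
    unfolding sum_distrib_left[symmetric] using l by (subst sum_cfgs_shift) auto
  also have "(\<Sum>m\<in>cfgs X N. mu X m * (chi M (m(1 := Suc (m 1))))\<^sup>2) = fip X N (ann 1 (chi M)) (ann 1 (chi M))"
    by (simp add: fip_def ann_def power2_eq_square mult.assoc)
  also have "\<dots> = nrm M * (\<Sum>k\<in>K. real (count M k) * (u k 1)\<^sup>2)"
    using l by (intro fip_ann[OF M]) auto
  finally show ?thesis using nrm_pos[of M] by simp
qed

text \<open>The discrete Dirichlet form of a mode extended by zero to site 0; the first term is the
  step from the unflipped spin attached on the left.\<close>

definition energy :: "nat \<Rightarrow> real" where
  "energy k = (u k 1)\<^sup>2 + (\<Sum>x\<in>{1..<l}. (u k (Suc x) - u k x)\<^sup>2)"

lemma vec_empty: "vec {#} n = (if n = (\<lambda>_. 0) then 1 else 0)"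
  by (simp add: vec_def chi_empty vac_def nu_def nu1_def nrm_def del: One_nat_def)

lemma energy_vec_le:
  assumes M: "set_mset M \<subseteq> K"
  shows "qf (Om D l) (Hc D l) (vec M) + half D * (\<Sum>n\<in>Om D l. real (n 1) * (vec M n)\<^sup>2)
     \<le> half D * (\<Sum>k\<in>K. real (count M k) * energy k)"
proof (cases "size M")
  \<comment> \<open>The vacuum is separate, as the bond bounds refer to the sector with one boson
    fewer.\<close>
  case 0
  then have M0: "M = {#}" by simp
  have mz: "move x n \<noteq> (\<lambda>_. 0)" for x and n :: "nat \<Rightarrow> nat"
    by (auto simp: move_def fun_eq_iff intro!: exI[of _ x])
  have "bform D x (Om D l) (vec M) = 0" for x
    unfolding bform_def M0 using mz by (intro sum.neutral) (auto simp: movable_def vec_empty)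
  moreover have "(\<Sum>n\<in>Om D l. real (n 1) * (vec M n)\<^sup>2) = 0"
    unfolding M0 by (intro sum.neutral) (auto simp: vec_empty)
  ultimately show ?thesis by (simp add: qf_Hc M0)
next
  case (Suc N)
  have "qf (Om D l) (Hc D l) (vec M) \<le> (\<Sum>x\<in>{1..<l}. half D * (\<Sum>k\<in>K. real (count M k) * (u k (Suc x)
      - u k x)\<^sup>2))"
    unfolding qf_Hc by (intro sum_mono bform_vec_le[OF M Suc])
  moreover have "half D * (\<Sum>n\<in>Om D l. real (n 1) * (vec M n)\<^sup>2) \<le> half D * (\<Sum>k\<in>K. real (count M k) * (u k 1)\<^sup>2)"
    by (intro mult_left_mono left_vec_le[OF M Suc]) (simp add: half_def)
  moreover have "half D * (\<Sum>k\<in>K. real (count M k) * energy k)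
     = half D * (\<Sum>k\<in>K. real (count M k) * (u k 1)\<^sup>2) + (\<Sum>x\<in>{1..<l}. half D * (\<Sum>k\<in>K. real (count M k)
         * (u k (Suc x) - u k x)\<^sup>2))"
    unfolding energy_def distrib_left sum.distrib sum_distrib_left
    by (rule arg_cong2[where f = "(+)", OF refl sum.swap])
  ultimately show ?thesis by linarith
qed

text \<open>Two shifts at the same site turn the factorial moment into the norm of the twice
  annihilated state.\<close>

lemma pair_density_le:
  assumes M: "set_mset M \<subseteq> K" and x: "x \<in> X" and B: "\<And>k. k \<in> K \<Longrightarrow> (u k x)\<^sup>2 \<le> B"
  shows "(\<Sum>n\<in>cfgs X (size M). mu X n * (real (n x) * (real (n x) - 1)) * (chi M n)\<^sup>2)
      \<le> nrm M * (2 * (B * real (size M))\<^sup>2)"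
proof (cases "\<exists>N. size M = Suc (Suc N)")
  case True
  then obtain N where N: "size M = Suc (Suc N)" by blast
  have X: "finite X" by simp
  have "(\<Sum>n\<in>cfgs X (size M). mu X n * (real (n x) * (real (n x) - 1)) * (chi M n)\<^sup>2)
     = (\<Sum>n\<in>cfgs X (Suc (Suc N)). mu X n * real (n x) * ((real (n x) - 1) * (chi M n)\<^sup>2))"
    unfolding N by (simp add: mult_ac)
  also have "\<dots> = (\<Sum>m\<in>cfgs X (Suc N). mu X m * real (m x) * (chi M (m(x := Suc (m x))))\<^sup>2)"
    by (subst sum_cfgs_shift[OF X x], intro sum.cong refl) simp
  also have "\<dots> = (\<Sum>m\<in>cfgs X N. mu X m * (chi M ((m(x := Suc (m x)))(x := Suc (Suc (m x)))))\<^sup>2)"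
    by (subst sum_cfgs_shift[OF X x], intro sum.cong refl) simp
  also have "\<dots> = fip X N (ann x (ann x (chi M))) (ann x (ann x (chi M)))"
    by (simp add: fip_def ann_def power2_eq_square mult.assoc)
  also have "\<dots> \<le> nrm M * (2 * (B * real (size M))\<^sup>2)"
    by (rule fip_ann_ann_le[OF M N x B])
  finally show ?thesis .
next
  \<comment> \<open>With at most one boson in total no site is doubly occupied, and the left side is
    zero.\<close>
  case False
  then have "size M \<le> 1" by (metis One_nat_def not_less_eq_eq le_Suc_ex add_Suc)
  then have "n x \<le> 1" if "n \<in> cfgs X (size M)" for n
    using that x member_le_sum[of x X n] by (auto simp: cfgs_def)
  then have z: "real (n x) * (real (n x) - 1) = 0" if "n \<in> cfgs X (size M)" for n
    using that by (metis One_nat_def cancel_comm_monoid_add_class.diff_cancel le_Suc_eq le_zero_eq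
        mult_zero_left mult_zero_right of_nat_0 of_nat_1)
  show ?thesis using nrm_pos[of M] by (simp add: z less_imp_le)
qed

text \<open>By \<open>nu_ge\<close> the weight lost by a configuration is at most the fraction given
  by its number of pairs on common sites. The expected number of pairs on each of the
  \<open>l\<close> sites is at most \<open>(B * size M)^2\<close>.\<close>

lemma norm_vec_ge:
  assumes M: "set_mset M \<subseteq> K" and B: "\<And>k x. k \<in> K \<Longrightarrow> x \<in> X \<Longrightarrow> (u k x)\<^sup>2 \<le> B"
  shows "nsq (Om D l) (vec M) \<ge> 1 - real l * (B * real (size M))\<^sup>2"
proof -
  let ?C = "cfgs X (size M)"
  have "nsq (Om D l) (vec M) = (\<Sum>n\<in>Om D l. nu D X n * (chi M n)\<^sup>2 / nrm M)"
    by (simp add: ip_def vec_square flip: power2_eq_square)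
  also have "\<dots> = (\<Sum>n\<in>Om D l \<inter> ?C. nu D X n * (chi M n)\<^sup>2 / nrm M)"
    using finite_Om chi_supp[of M] by (intro sum.mono_neutral_right) (auto simp: Om_def cfgs_def)
  \<comment> \<open>Beyond \<open>D\<close> particles on a site the binomial coefficient, hence
    \<open>nu\<close>, vanishes, so the sum may run over all boson configurations.\<close>
  also have "\<dots> = (\<Sum>n\<in>?C. nu D X n * (chi M n)\<^sup>2 / nrm M)"
  proof (intro sum.mono_neutral_left finite_cfgs ballI)
    fix n assume n: "n \<in> ?C - Om D l \<inter> ?C"
    then have "\<exists>x. D < n x" by (auto simp: Om_def cfgs_def not_le)
    then obtain x where x: "D < n x" by blast
    have xX: "x \<in> X"
    proof (rule ccontr)
      assume "x \<notin> X"
      then have "n x = 0" using n unfolding cfgs_def by blast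
      then show False using x by simp
    qed
    then have "nu D X n = 0" unfolding nu_def nu1_def
      using x xX by (subst prod_zero_iff) (auto intro!: bexI[of _ x] simp: binomial_eq_0)
    then show "nu D X n * (chi M n)\<^sup>2 / nrm M = 0" by simp
  qed auto
  also have "\<dots> \<ge> (\<Sum>n\<in>?C. mu X n * (1 - (\<Sum>x\<in>X. real (n x) * (real (n x) - 1) / 2)) * (chi M n)\<^sup>2 / nrm M)"
    using nrm_pos[of M] D by (intro sum_mono divide_right_mono mult_right_mono nu_ge) (auto simp: less_imp_le)
  also have "(\<Sum>n\<in>?C. mu X n * (1 - (\<Sum>x\<in>X. real (n x) * (real (n x) - 1) / 2)) * (chi M n)\<^sup>2 / nrm M)
     = (\<Sum>n\<in>?C. mu X n * chi M n * chi M n) / nrm M - (\<Sum>n\<in>?C. \<Sum>x\<in>X. mu X n * (real (n x) * (real (n x) - 1))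
         * (chi M n)\<^sup>2) / (2 * nrm M)"
    by (simp add: sum_divide_distrib sum_subtractf[symmetric] sum_distrib_left sum_distrib_right
        power2_eq_square algebra_simps diff_divide_distrib)
  also have "(\<Sum>n\<in>?C. mu X n * chi M n * chi M n) = nrm M"
    using fip_chi[OF M M] by (simp add: fip_def)
  also have "(\<Sum>n\<in>?C. \<Sum>x\<in>X. mu X n * (real (n x) * (real (n x) - 1)) * (chi M n)\<^sup>2)
      = (\<Sum>x\<in>X. \<Sum>n\<in>?C. mu X n * (real (n x) * (real (n x) - 1)) * (chi M n)\<^sup>2)"
    by (rule sum.swap)
  finally have "nsq (Om D l) (vec M) \<ge> 1 - (\<Sum>x\<in>X. \<Sum>n\<in>?C. mu X n * (real (n x) * (real (n x) - 1))
      * (chi M n)\<^sup>2) / (2 * nrm M)"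
    using nrm_pos[of M] by simp
  moreover have "(\<Sum>x\<in>X. \<Sum>n\<in>?C. mu X n * (real (n x) * (real (n x) - 1)) * (chi M n)\<^sup>2)
      \<le> (\<Sum>x\<in>X. nrm M * (2 * (B * real (size M))\<^sup>2))"
    by (intro sum_mono pair_density_le[OF M] B)
  then have "(\<Sum>x\<in>X. \<Sum>n\<in>?C. mu X n * (real (n x) * (real (n x) - 1)) * (chi M n)\<^sup>2) / (2 * nrm M)
      \<le> real l * (B * real (size M))\<^sup>2"
    using nrm_pos[of M] by (simp add: field_simps)
  ultimately show ?thesis by linarith
qed

text \<open>Each \<open>vec M\<close> is the image of the orthonormal boson state
  \<open>psi M\<close> under multiplication by the square root of \<open>nu / mu\<close>. Moving
  this contraction onto \<open>e\<close> gives \<open>g\<close> with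
  \<open>nsq T g \<le> nsq (Om D l) e\<close>, and Bessel's inequality for \<open>psi\<close>
  applies to \<open>g\<close>.\<close>

lemma vec_bessel:
  assumes F: "finite F" "\<And>M. M \<in> F \<Longrightarrow> set_mset M \<subseteq> K"
  shows "(\<Sum>M\<in>F. (ip (Om D l) e (vec M))\<^sup>2) \<le> nsq (Om D l) e"
proof -
  \<comment> \<open>States with different boson numbers need a common finite index set; the inserted
    0 keeps the maximum defined for empty \<open>F\<close>.\<close>
  define R where "R = Max (insert 0 (size ` F))"
  have R: "size M \<le> R" if "M \<in> F" for M using F(1) that by (simp add: R_def)
  define T where "T = (\<Union>N\<in>{..R}. cfgs X N)"
  have finT: "finite T" unfolding T_def by (intro finite_UN_I finite_cfgs) auto
  define psi where "psi = (\<lambda>M n. sqrt (mu X n) * chi M n / sqrt (nrm M))"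
  have orth: "orthonormal_fam T F psi" unfolding orthonormal_fam_def
  proof (intro ballI)
    fix M M' assume MM: "M \<in> F" "M' \<in> F"
    have "ip T (psi M) (psi M') = (\<Sum>n\<in>T. mu X n * chi M n * chi M' n) / (sqrt (nrm M) * sqrt (nrm M'))"
      unfolding ip_def psi_def sum_divide_distrib
      using mu_pos[of X] by (intro sum.cong refl) (simp add: less_imp_le mult_ac flip: real_sqrt_mult)
    also have "(\<Sum>n\<in>T. mu X n * chi M n * chi M' n) = (\<Sum>n\<in>cfgs X (size M). mu X n * chi M n * chi M' n)"
      using finT R[OF MM(1)] chi_supp[of M] by (intro sum.mono_neutral_right) (auto simp: T_def cfgs_def)
    also have "\<dots> = (if M = M' then nrm M else 0)"
    proof (cases "size M' = size M")
      case True
      then show ?thesis using fip_chi[of M M'] F(2) MM by (simp add: fip_def)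
    next
      case False
      then have "chi M' n = 0" if "n \<in> cfgs X (size M)" for n
        using that chi_supp[of M' n] by (auto simp: cfgs_def)
      then show ?thesis using False by auto
    qed
    finally show "ip T (psi M) (psi M') = (if M = M' then 1 else 0)"
      using nrm_pos[of M] by (auto simp: real_sqrt_mult_self abs_of_pos)
  qed
  define g where "g = (\<lambda>n. if n \<in> Om D l then e n * sqrt (nu D X n) / sqrt (mu X n) else 0)"
  have ipg: "ip T g (psi M) = ip (Om D l) e (vec M)" if M: "M \<in> F" for M
  proof -
    have "ip T g (psi M) = (\<Sum>n\<in>T. if n \<in> Om D l then e n * vec M n else 0)"
      unfolding ip_def g_def psi_def vec_def
      using mu_pos[of X] by (intro sum.cong refl) (auto simp: less_imp_neq[symmetric])
    also have "\<dots> = (\<Sum>n\<in>T \<inter> Om D l. e n * vec M n)"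
      using finT by (simp add: sum.inter_restrict)
    also have "\<dots> = (\<Sum>n\<in>Om D l. e n * vec M n)"
      using vec_supp[of M] R[OF M] finite_Om by (intro sum.mono_neutral_left) (auto simp: T_def)
    finally show ?thesis by (simp add: ip_def)
  qed
  have "nsq T g = (\<Sum>n\<in>T. if n \<in> Om D l then e n * e n * (nu D X n / mu X n) else 0)"
    unfolding ip_def g_def using mu_pos[of X] nu_nonneg[of D X]
    by (intro sum.cong refl) (auto simp: less_imp_le field_simps)
  also have "\<dots> = (\<Sum>n\<in>T \<inter> Om D l. e n * e n * (nu D X n / mu X n))"
    by (rule sum.inter_restrict[OF finT, symmetric])
  also have "\<dots> \<le> (\<Sum>n\<in>T \<inter> Om D l. e n * e n * 1)"
    using nu_le_mu[OF D, of X] mu_pos[of X] by (intro sum_mono mult_left_mono) (auto simp: divide_le_eq_1)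
  also have "\<dots> \<le> nsq (Om D l) e"
    unfolding ip_def using finite_Om by (simp, intro sum_mono2) auto
  finally have "nsq T g \<le> nsq (Om D l) e" .
  moreover have "(\<Sum>M\<in>F. (ip T g (psi M))\<^sup>2) \<le> nsq T g"
    by (rule bessel[OF F(1) orth])
  ultimately show ?thesis by (simp add: ipg)
qed

end

section \<open>Sine modes and the partition function of a block\<close>

abbreviation gauss :: "real \<Rightarrow> nat \<Rightarrow> real" where
  "gauss c k \<equiv> exp (- (c * (real k)\<^sup>2))"

text \<open>Eigenfunctions of the discrete Laplacian vanishing at 0 and at \<open>l\<close>: the
  zero at \<open>l\<close> leaves the last spin unflipped, the zero at 0 fits the spin attached on
  the left.\<close>

definition sine :: "nat \<Rightarrow> nat \<Rightarrow> nat \<Rightarrow> real" where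
  "sine l k x = sqrt (2 / real l) * sin (pi * real k * real x / real l)"

lemma sum_cos_telescope:
  fixes t :: real
  shows "2 * sin (t / 2) * (\<Sum>x<l. cos (t * real x)) = sin (t * (real l - 1 / 2)) + sin (t / 2)"
proof (induction l)
  case 0
  have "t * (- 1 / 2) = - (t / 2)" by simp
  then show ?case by (simp only: of_nat_0 diff_0 lessThan_0 sum.empty mult_zero_right sin_minus
      minus_divide_left) simp
next
  case (Suc l)
  have "t * (real (Suc l) - 1 / 2) = t * real l + t / 2" "t * (real l - 1 / 2) = t * real l - t / 2"
    by (auto simp: algebra_simps)
  then have "sin (t * (real (Suc l) - 1 / 2)) = sin (t * (real l - 1 / 2)) + 2 * sin (t / 2) * cos (t * real l)"
    by (simp add: sin_add sin_diff)
  with Suc show ?case by (simp add: algebra_simps)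
qed

text \<open>The value 1 for odd \<open>j\<close> does no harm to orthogonality: the sums for
  \<open>j - k\<close> and \<open>j + k\<close> are subtracted, and these numbers have the same
  parity.\<close>

lemma sum_cos_zero:
  assumes l: "l \<ge> 1" and j: "0 < j" "j < 2 * l"
  shows "(\<Sum>x<l. cos (pi * real j * real x / real l)) = (if odd j then 1 else 0)"
proof -
  define t where "t = pi * real j / real l"
  have "0 < t / 2" "t / 2 < pi"
    using l j by (auto simp: t_def field_simps)
  then have s: "sin (t / 2) > 0" by (rule sin_gt_zero)
  have "t * (real l - 1 / 2) = real j * pi - t / 2" using l by (simp add: t_def field_simps)
  then have "sin (t * (real l - 1 / 2)) = - (cos (real j * pi) * sin (t / 2))"
    by (simp add: sin_diff)
  also have "cos (real j * pi) = (if odd j then - 1 else 1)" by simp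
  finally have "2 * sin (t / 2) * (\<Sum>x<l. cos (t * real x)) = sin (t / 2) * (if odd j then 2 else 0)"
    unfolding sum_cos_telescope by simp
  then have "(\<Sum>x<l. cos (t * real x)) = (if odd j then 1 else 0)"
    using s by (auto split: if_splits)
  then show ?thesis by (simp add: t_def)
qed

lemma sine_orthonormal:
  assumes l: "l \<ge> 1" and j: "j \<in> {1..<l}" and k: "k \<in> {1..<l}"
  shows "(\<Sum>x\<in>{1..l}. sine l j x * sine l k x) = (if j = k then 1 else 0)"
proof -
  have aux: "(\<Sum>x\<in>{1..l}. sine l j x * sine l k x) = (if j = k then 1 else 0)"
      if j: "j \<in> {1..<l}" and k: "k \<in> {1..<l}" and kj: "k \<le> j" for j k
  proof -
    have end0: "sine l j l * sine l k l = 0" "sine l j 0 * sine l k 0 = 0"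
      using l by (simp_all add: sine_def)
    have "(\<Sum>x\<in>{1..l}. sine l j x * sine l k x) = (\<Sum>x<l. sine l j (Suc x) * sine l k (Suc x))"
      by (rule sum.reindex_bij_witness[of _ Suc "\<lambda>x. x - 1"]) auto
    also have "\<dots> = (\<Sum>x<Suc l. sine l j x * sine l k x)"
      using end0 by (simp only: sum.lessThan_Suc_shift add_0_left)
    also have "\<dots> = (\<Sum>x<l. sine l j x * sine l k x)"
      using end0 by (simp only: sum.lessThan_Suc add_0_right)
    also have "\<dots> = (\<Sum>x<l. (cos (pi * real (j - k) * real x / real l) - cos (pi * real (j + k) * real x
        / real l)) / real l)"
    proof (intro sum.cong refl)
      fix x
      define A where "A = pi * real j * real x / real l"
      define B where "B = pi * real k * real x / real l"
      have AB: "pi * real (j - k) * real x / real l = A - B" "pi * real (j + k) * real x / real l = A + B"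
        using kj l by (auto simp: A_def B_def of_nat_diff field_simps)
      have "sqrt (2 / real l) * sqrt (2 / real l) = 2 / real l" by simp
      then have "sine l j x * sine l k x = 2 / real l * (sin A * sin B)"
        unfolding sine_def A_def[symmetric] B_def[symmetric] by (simp add: mult_ac)
      also have "\<dots> = (cos (A - B) - cos (A + B)) / real l" by (simp add: cos_diff cos_add)
      finally show "sine l j x * sine l k x = (cos (pi * real (j - k) * real x / real l) - cos (pi * real (j
          + k) * real x / real l)) / real l"
        unfolding AB .
    qed
    also have "\<dots> = ((\<Sum>x<l. cos (pi * real (j - k) * real x / real l)) - (\<Sum>x<l. cos (pi * real (j + k)
        * real x / real l))) / real l"
      by (simp add: sum_divide_distrib[symmetric] sum_subtractf)
    also have "(\<Sum>x<l. cos (pi * real (j + k) * real x / real l)) = (if odd (j + k) then 1 else 0)"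
      using j k by (intro sum_cos_zero l) auto
    also have "(\<Sum>x<l. cos (pi * real (j - k) * real x / real l)) = (if j = k then real l else
        if odd (j + k) then 1 else 0)"
    proof (cases "j = k")
      case False
      have "(\<Sum>x<l. cos (pi * real (j - k) * real x / real l)) = (if odd (j - k) then 1 else 0)"
        using j k kj False by (intro sum_cos_zero l) auto
      then show ?thesis using False kj by simp
    qed simp
    finally show ?thesis using l by auto
  qed
  show ?thesis
  proof (cases "k \<le> j")
    case True
    then show ?thesis using aux[OF j k] by simp
  next
    case False
    then have "(\<Sum>x\<in>{1..l}. sine l k x * sine l j x) = (if k = j then 1 else 0)" using aux[OF k j] by simp
    then show ?thesis by (auto simp: mult.commute)
  qed
qed

lemma sine_end: "l \<ge> 1 \<Longrightarrow> sine l k l = 0"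
  by (simp add: sine_def)

lemma sine_square_le: "(sine l k x)\<^sup>2 \<le> 2 / real l"
proof -
  have "(sine l k x)\<^sup>2 = 2 / real l * (sin (pi * real k * real x / real l))\<^sup>2"
    by (simp add: sine_def power_mult_distrib)
  also have "\<dots> \<le> 2 / real l * 1"
    by (intro mult_left_mono) (auto simp: abs_square_le_1)
  finally show ?thesis by simp
qed

text \<open>Each difference is \<open>2 * sin (p / 2)\<close> times a normalised cosine at the
  midpoint. The double-angle sum telescopes to a multiple of \<open>sin (2 * pi * k) = 0\<close>, so
  the energy is exactly \<open>(2 * sin (p / 2))^2\<close>.\<close>

lemma sine_energy:
  assumes l: "l \<ge> 1" and k: "k \<in> {1..<l}"
  shows "(sine l k 1)\<^sup>2 + (\<Sum>x\<in>{1..<l}. (sine l k (Suc x) - sine l k x)\<^sup>2) \<le> (pi * real k / real l)\<^sup>2"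
proof -
  define p where "p = pi * real k / real l"
  have z: "sine l k 0 = 0" by (simp add: sine_def)
  have "(sine l k 1)\<^sup>2 + (\<Sum>x\<in>{1..<l}. (sine l k (Suc x) - sine l k x)\<^sup>2)
      = (\<Sum>x<l. (sine l k (Suc x) - sine l k x)\<^sup>2)"
    using l z by (simp add: lessThan_atLeast0 sum.atLeast_Suc_lessThan)
  also have "\<dots> = (\<Sum>x<l. (2 / real l) * (4 * (sin (p / 2))\<^sup>2) * ((1 + cos (p * (2 * real x + 1))) / 2))"
  proof (intro sum.cong refl)
    fix x
    have e: "pi * real k * real (Suc x) / real l = (p * real x + p / 2) + p / 2" "pi * real k * real x
        / real l = (p * real x + p / 2) - p / 2"
      by (auto simp: p_def add_divide_distrib algebra_simps)
    have "sine l k (Suc x) - sine l k x = sqrt (2 / real l) * (2 * sin (p / 2) * cos (p * real x + p / 2))"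
      unfolding sine_def e sin_add[of "p * real x + p / 2"] sin_diff[of "p * real x + p / 2"]
          by (simp add: algebra_simps)
    then have "(sine l k (Suc x) - sine l k x)\<^sup>2 = (2 / real l) * (4 * (sin (p / 2))\<^sup>2) * (cos (p * real x
        + p / 2))\<^sup>2"
      by (simp add: power_mult_distrib)
    also have "(cos (p * real x + p / 2))\<^sup>2 = (1 + cos (p * (2 * real x + 1))) / 2"
    proof -
      have "p * (2 * real x + 1) = 2 * (p * real x + p / 2)" by (simp add: algebra_simps)
      then show ?thesis by (simp only: cos_double_cos) simp
    qed
    finally show "(sine l k (Suc x) - sine l k x)\<^sup>2
        = (2 / real l) * (4 * (sin (p / 2))\<^sup>2) * ((1 + cos (p * (2 * real x + 1))) / 2)" .
  qed
  also have "\<dots> = (4 * (sin (p / 2))\<^sup>2) / real l * (real l + (\<Sum>x<l. cos (p * (2 * real x + 1))))"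
    by (simp add: sum.distrib sum_distrib_left[symmetric] sum_divide_distrib[symmetric])
  also have "(\<Sum>x<l. cos (p * (2 * real x + 1))) = 0"
  proof -
    have tel: "2 * sin p * (\<Sum>x<n. cos (p * (2 * real x + 1))) = sin (2 * p * real n)" for n
    proof (induction n)
      case (Suc n)
      have e: "2 * p * real (Suc n) = p * (2 * real n + 1) + p" "2 * p * real n = p * (2 * real n + 1) - p"
        by (auto simp: algebra_simps)
      have "sin (p * (2 * real n + 1) + p) - sin (p * (2 * real n + 1) - p)
          = 2 * sin p * cos (p * (2 * real n + 1))"
        by (simp add: sin_add sin_diff)
      then show ?case using Suc unfolding e sum.lessThan_Suc distrib_left by linarith
    qed simp
    have "2 * p * real l = real (2 * k) * pi" using l by (simp add: p_def)
    then have "sin (2 * p * real l) = 0" by (simp only: sin_npi)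
    moreover have "sin p > 0" using l k by (intro sin_gt_zero) (auto simp: p_def field_simps)
    ultimately show ?thesis using tel[of l] by simp
  qed
  also have "4 * (sin (p / 2))\<^sup>2 / real l * (real l + 0) = (2 * sin (p / 2))\<^sup>2"
    using l by (simp add: power_mult_distrib)
  also have "\<dots> \<le> p\<^sup>2"
  proof (rule power_mono)
    have "p \<ge> 0" by (simp add: p_def)
    then have "sin (p / 2) \<le> p / 2" by (intro sin_x_le_x) simp
    then show "2 * sin (p / 2) \<le> p" by simp
    have "0 \<le> p / 2" "p / 2 \<le> pi" using l k by (auto simp: p_def field_simps) 
    then show "0 \<le> 2 * sin (p / 2)" using sin_ge_zero by simp
  qed
  finally show ?thesis by (simp add: p_def)
qed

context block
begin

lemma vec_last:
  assumes "set_mset M \<subseteq> K" "n l \<noteq> 0"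
  shows "vec M n = 0"
  using chi_zero_site[of l M n] last assms by (simp add: vec_def)

text \<open>For a nonnegative energy bound \<open>E\<close> the weight
  \<open>n * exp (- b * E / n)\<close> increases with the squared norm \<open>n\<close>, so
  \<open>n\<close> may be replaced by its lower bound \<open>1 - \<delta>\<close> in both
  places.\<close>

lemma trial_block:
  assumes F: "finite F" "\<And>M. M \<in> F \<Longrightarrow> set_mset M \<subseteq> K \<and> real (size M) \<le> R"
    and B: "\<And>k x. k \<in> K \<Longrightarrow> x \<in> X \<Longrightarrow> (u k x)\<^sup>2 \<le> B" and B0: "B \<ge> 0"
    and del: "\<delta> = real l * (B * R)\<^sup>2" "\<delta> < 1" and b: "b \<ge> 0"
    and en: "\<And>k. k \<in> K \<Longrightarrow> energy k \<le> \<epsilon> k"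
  shows "trial D b l (\<Sum>M\<in>F. (1 - \<delta>) * exp (- (b * (half D * (\<Sum>k\<in>K. real (count M k) * \<epsilon> k)) / (1 - \<delta>))))"
proof -
  have norm: "nsq (Om D l) (vec M) \<ge> 1 - \<delta>" if M: "M \<in> F" for M
  proof -
    have "(B * real (size M))\<^sup>2 \<le> (B * R)\<^sup>2" using F(2)[OF M] B0 by (intro power_mono mult_left_mono) auto
    then have "real l * (B * real (size M))\<^sup>2 \<le> \<delta>" unfolding del by (intro mult_left_mono) auto
    moreover have "nsq (Om D l) (vec M) \<ge> 1 - real l * (B * real (size M))\<^sup>2"
      using F(2)[OF M] B by (intro norm_vec_ge) auto
    ultimately show ?thesis by linarith
  qed
  have df: "dform D l (vec M) \<le> half D * (\<Sum>k\<in>K. real (count M k) * \<epsilon> k)" if M: "M \<in> F" for M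
  proof -
    have "dform D l (vec M) \<le> half D * (\<Sum>k\<in>K. real (count M k) * energy k)"
      unfolding dform_def using F(2)[OF M] by (intro energy_vec_le) auto
    also have "\<dots> \<le> half D * (\<Sum>k\<in>K. real (count M k) * \<epsilon> k)"
      using en by (intro mult_left_mono sum_mono) (auto simp: half_def)
    finally show ?thesis .
  qed
  obtain h where h: "bij_betw h {0..<card F} F" using ex_bij_betw_nat_finite[OF F(1)] by blast
  have hF: "h i \<in> F" if "i \<in> {0..<card F}" for i using h that by (auto simp: bij_betw_def)
  show ?thesis unfolding trial_def
  proof (intro exI[of _ "{0..<card F}"] exI[of _ "\<lambda>i. vec (h i)"] conjI ballI allI impI)
    fix i assume i: "i \<in> {0..<card F}"
    show "nsq (Om D l) (vec (h i)) > 0" using norm[OF hF[OF i]] del(2) by linarith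
    fix n :: "nat \<Rightarrow> nat" assume "n l \<noteq> 0"
    then show "vec (h i) n = 0" using F(2)[OF hF[OF i]] by (intro vec_last) auto
  next
    fix e
    show "(\<Sum>i = 0..<card F. (ip (Om D l) e (vec (h i)))\<^sup>2) \<le> nsq (Om D l) e"
      unfolding sum.reindex_bij_betw[OF h, of "\<lambda>M. (ip (Om D l) e (vec M))\<^sup>2"]
      using F by (intro vec_bessel) auto
  next
    have "(\<Sum>M\<in>F. (1 - \<delta>) * exp (- (b * (half D * (\<Sum>k\<in>K. real (count M k) * \<epsilon> k)) / (1 - \<delta>))))
       \<le> (\<Sum>M\<in>F. peierls_weight D b l (vec M))"
    proof (rule sum_mono)
      fix M assume M: "M \<in> F"
      let ?E = "half D * (\<Sum>k\<in>K. real (count M k) * \<epsilon> k)" and ?n = "nsq (Om D l) (vec M)"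
      have "\<epsilon> k \<ge> 0" if "k \<in> K" for k
        using en[OF that] by (rule order_trans[rotated]) (auto simp: energy_def intro!: add_nonneg_nonneg
            sum_nonneg)
      then have E0: "?E \<ge> 0" by (intro mult_nonneg_nonneg sum_nonneg) (auto simp: half_def)
      have "b * dform D l (vec M) / ?n \<le> b * ?E / ?n"
        using df[OF M] b norm[OF M] del(2) by (intro divide_right_mono mult_left_mono) auto
      also have "\<dots> \<le> b * ?E / (1 - \<delta>)"
        using norm[OF M] del(2) b E0 by (intro divide_left_mono mult_nonneg_nonneg[OF b E0] mult_pos_pos) auto
      finally have "exp (- (b * ?E / (1 - \<delta>))) \<le> exp (- (b * dform D l (vec M) / ?n))" by simp
      then show "(1 - \<delta>) * exp (- (b * ?E / (1 - \<delta>))) \<le> ?n * exp (- (b * dform D l (vec M) / ?n))"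
        using norm[OF M] del(2) by (intro mult_mono) auto
    qed
    also have "\<dots> = (\<Sum>i = 0..<card F. nsq (Om D l) (vec (h i)) *
       exp (- (b * dform D l (vec (h i)) / nsq (Om D l) (vec (h i)))))"
      by (rule sum.reindex_bij_betw[OF h, symmetric])
    finally show "(\<Sum>M\<in>F. (1 - \<delta>) * exp (- (b * (half D * (\<Sum>k\<in>K. real (count M k) * \<epsilon> k)) / (1 - \<delta>))))
      \<le> (\<Sum>i = 0..<card F. nsq (Om D l) (vec (h i)) *
       exp (- (b * dform D l (vec (h i)) / nsq (Om D l) (vec (h i)))))" .
  qed simp
qed

end

lemma trial_sine:
  assumes D: "D \<ge> 1" and l: "l \<ge> 1" and b: "b \<ge> 0"
    and F: "finite F" "\<And>M. M \<in> F \<Longrightarrow> set_mset M \<subseteq> {1..<l} \<and> real (size M) \<le> R"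
    and del: "\<delta> = 4 * R\<^sup>2 / real l" "\<delta> < 1"
    and c: "c = b * half D / (1 - \<delta>) * (pi / real l)\<^sup>2"
  shows "trial D b l (\<Sum>M\<in>F. (1 - \<delta>) * (\<Prod>k\<in>{1..<l}. gauss c k ^ count M k))"
proof -
  interpret block l "{1..<l}" "sine l" D
    by unfold_locales (use D l in \<open>auto simp: sine_orthonormal sine_end simp del: One_nat_def\<close>)
  have "trial D b l (\<Sum>M\<in>F. (1 - \<delta>) * exp (- (b * (half D * (\<Sum>k\<in>{1..<l}. real (count M k) * (pi * real k
      / real l)\<^sup>2)) / (1 - \<delta>))))"
  proof (rule trial_block[OF F _ _ _ del(2) b])
    show "(sine l k x)\<^sup>2 \<le> 2 / real l" for k x by (rule sine_square_le)
    \<comment> \<open>With \<open>B = 2 / l\<close> from the sine modes, the norm loss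
      \<open>l * (B * R)^2\<close> becomes \<open>4 * R^2 / l\<close>.\<close>
    show "\<delta> = real l * (2 / real l * R)\<^sup>2" unfolding del using l by (simp add: power2_eq_square field_simps)
    show "energy k \<le> (pi * real k / real l)\<^sup>2" if "k \<in> {1..<l}" for k
      unfolding energy_def using sine_energy[OF l that] by simp
  qed simp_all
  moreover have "exp (- (b * (half D * (\<Sum>k\<in>{1..<l}. real (count M k) * (pi * real k / real l)\<^sup>2)) / (1 - \<delta>)))
     = (\<Prod>k\<in>{1..<l}. gauss c k ^ count M k)" for M
  proof -
    have "- (b * (half D * (\<Sum>k\<in>{1..<l}. real (count M k) * (pi * real k / real l)\<^sup>2)) / (1 - \<delta>))
      = (\<Sum>k\<in>{1..<l}. real (count M k) * - (c * (real k)\<^sup>2))"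
      by (simp add: c sum_distrib_left sum_divide_distrib sum_negf[symmetric] power_mult_distrib
          power_divide algebra_simps)
    then show ?thesis by (simp only: exp_sum finite_atLeastLessThan exp_of_nat_mult)
  qed
  ultimately show ?thesis by simp
qed

section \<open>Bounding the number of bosons\<close>

lemma geometric_mean_le:
  fixes q :: real
  assumes "0 \<le> q" "q < 1"
  shows "(\<Sum>i\<le>J. real i * q ^ i) \<le> q / (1 - q) * (\<Sum>i\<le>J. q ^ i)"
proof -
  \<comment> \<open>Summation by parts; truncation leaves only a negative boundary term, so the
    truncated mean does not exceed the full geometric mean.\<close>
  have "(\<Sum>i\<le>J. real i * q ^ i) * (1 - q) = q * (\<Sum>i<J. q ^ i) - real J * q ^ Suc J"
  proof (induction J)
    case (Suc J)
    have "(\<Sum>i\<le>Suc J. real i * q ^ i) * (1 - q) = (\<Sum>i\<le>J. real i * q ^ i) * (1 - q) + real (Suc J) * q ^ Suc J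
        * (1 - q)"
      by (simp only: sum.atMost_Suc distrib_right)
    also have "\<dots> = q * (\<Sum>i<Suc J. q ^ i) - real (Suc J) * q ^ Suc (Suc J)"
      unfolding Suc by (simp add: algebra_simps)
    finally show ?case .
  qed simp
  also have "\<dots> \<le> q * (\<Sum>i<J. q ^ i)" using assms by simp
  also have "\<dots> \<le> q * (\<Sum>i\<le>J. q ^ i)"
    using assms by (intro mult_left_mono sum_mono2) auto
  finally show ?thesis using assms by (simp add: field_simps)
qed

text \<open>Markov's inequality for the number of bosons: at most \<open>R\<close> bosons carry half of the partition function.\<close>

lemma bounded_occupation_sum:
  fixes q :: "nat \<Rightarrow> real"
  assumes K: "finite K" and q: "\<And>k. k \<in> K \<Longrightarrow> 0 \<le> q k \<and> q k < 1"
    and R: "R > 0" "(\<Sum>k\<in>K. q k / (1 - q k)) \<le> R / 2"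
  shows "\<exists>F. finite F \<and> (\<forall>M\<in>F. set_mset M \<subseteq> K \<and> real (size M) \<le> R) \<and>
     1 / 2 * (\<Prod>k\<in>K. 1 / (1 - q k)) \<le> (\<Sum>M\<in>F. \<Prod>k\<in>K. q k ^ count M k)"
proof -
  define mg where "mg = (\<lambda>g :: nat \<Rightarrow> nat. \<Sum>k\<in>K. replicate_mset (g k) k)"
  have cnt: "count (mg g) k = (if k \<in> K then g k else 0)" for g k
    unfolding mg_def count_sum using K by (auto simp: if_distrib cong: if_cong)
  have setm: "set_mset (mg g) \<subseteq> K" for g
  proof
    fix k assume "k \<in># mg g"
    then have "count (mg g) k \<noteq> 0" by simp
    then show "k \<in> K" unfolding cnt by (auto split: if_splits)
  qed
  have szm: "size (mg g) = sum g K" for g unfolding mg_def by simp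
  \<comment> \<open>\<open>F\<close> does not depend on the cutoff \<open>J\<close> below: a total
    of at most \<open>R\<close> already bounds each occupation number.\<close>
  define F where "F = mg ` {g \<in> PiE K (\<lambda>_. {..nat \<lfloor>R\<rfloor>}). real (sum g K) \<le> R}"
  have "finite (PiE K (\<lambda>_. {..nat \<lfloor>R\<rfloor>}))" by (rule finite_PiE[OF K]) simp
  then have finF: "finite F" unfolding F_def
    by (intro finite_imageI) (rule finite_subset[OF Collect_subset])
  have wnn: "(\<Prod>k\<in>K. q k ^ g k) \<ge> 0" for g using q by (intro prod_nonneg) auto
  \<comment> \<open>A cutoff \<open>J\<close> on the occupation numbers keeps all sums finite; the
    geometric series are recovered in the limit at the end.\<close>
  have main: "1 / 2 * (\<Prod>k\<in>K. \<Sum>i\<le>J. q k ^ i) \<le> (\<Sum>M\<in>F. \<Prod>k\<in>K. q k ^ count M k)" for J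
  proof -
    let ?G = "PiE K (\<lambda>_. {..J})"
    have finG: "finite ?G" using K by (intro finite_PiE) auto
    define Z where "Z = (\<Prod>k\<in>K. \<Sum>i\<le>J. q k ^ i)"
    have Z0: "Z \<ge> 0" unfolding Z_def using q by (intro prod_nonneg sum_nonneg ballI) auto
    have ZG: "(\<Sum>g\<in>?G. \<Prod>k\<in>K. q k ^ g k) = Z"
      unfolding Z_def using prod_sum_PiE[OF K, of "\<lambda>_. {..J}" "\<lambda>k i. q k ^ i"] by simp
    have mean: "(\<Sum>g\<in>?G. (\<Prod>k\<in>K. q k ^ g k) * real (g j)) \<le> q j / (1 - q j) * Z" if j: "j \<in> K" for j
    proof -
      have "(\<Sum>g\<in>?G. (\<Prod>k\<in>K. q k ^ g k) * real (g j)) = (\<Sum>g\<in>?G. \<Prod>k\<in>K. (if k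
          = j then real (g k) else 1) * q k ^ g k)"
        using j K by (intro sum.cong refl) (simp add: prod.distrib mult.commute)
      also have "\<dots> = (\<Prod>k\<in>K. \<Sum>i\<le>J. (if k = j then real i else 1) * q k ^ i)"
        by (rule prod_sum_PiE[OF K, symmetric]) auto
      also have "\<dots> = (\<Sum>i\<le>J. real i * q j ^ i) * (\<Prod>k\<in>K - {j}. \<Sum>i\<le>J. q k ^ i)"
        by (subst prod.remove[OF K j]) (auto intro!: arg_cong2[where f = "(*)"] prod.cong)
      also have "\<dots> \<le> (q j / (1 - q j) * (\<Sum>i\<le>J. q j ^ i)) * (\<Prod>k\<in>K - {j}. \<Sum>i\<le>J. q k ^ i)"
        using q j by (intro mult_right_mono geometric_mean_le prod_nonneg sum_nonneg ballI) auto
      also have "\<dots> = q j / (1 - q j) * Z"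
        unfolding Z_def by (subst prod.remove[OF K j]) simp
      finally show ?thesis .
    qed
    have "1 / 2 * Z \<le> Z * (1 - (\<Sum>k\<in>K. q k / (1 - q k)) / R)"
    proof -
      have "(\<Sum>k\<in>K. q k / (1 - q k)) / R \<le> 1 / 2" using R by (simp add: field_simps)
      then have "1 / 2 \<le> 1 - (\<Sum>k\<in>K. q k / (1 - q k)) / R" by simp
      from mult_left_mono[OF this Z0] show ?thesis by simp
    qed
    also have "\<dots> = Z - (\<Sum>j\<in>K. q j / (1 - q j) * Z) / R"
      unfolding sum_distrib_right[symmetric] by (simp add: right_diff_distrib mult.commute)
    also have "\<dots> \<le> Z - (\<Sum>j\<in>K. \<Sum>g\<in>?G. (\<Prod>k\<in>K. q k ^ g k) * real (g j)) / R"
      using mean R(1) by (intro diff_left_mono divide_right_mono sum_mono) auto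
    also have "(\<Sum>j\<in>K. \<Sum>g\<in>?G. (\<Prod>k\<in>K. q k ^ g k) * real (g j)) = (\<Sum>g\<in>?G. (\<Prod>k\<in>K. q k ^ g k) * real (sum g K))"
      by (subst sum.swap) (simp add: sum_distrib_left)
    also have "Z - (\<Sum>g\<in>?G. (\<Prod>k\<in>K. q k ^ g k) * real (sum g K)) / R
        = (\<Sum>g\<in>?G. (\<Prod>k\<in>K. q k ^ g k) * (1 - real (sum g K) / R))"
      unfolding ZG[symmetric] sum_divide_distrib sum_subtractf[symmetric]
      by (intro sum.cong refl) (simp add: right_diff_distrib)
    \<comment> \<open>Markov's inequality in the form that \<open>1 - N / R\<close> is at most the
      indicator of \<open>N \<le> R\<close>.\<close>
    also have "\<dots> \<le> (\<Sum>g\<in>?G. if real (sum g K) \<le> R then \<Prod>k\<in>K. q k ^ g k else 0)"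
    proof (rule sum_mono)
      fix g
      show "(\<Prod>k\<in>K. q k ^ g k) * (1 - real (sum g K) / R) \<le> (if real (sum g K) \<le> R then \<Prod>k\<in>K. q k ^ g k else 0)"
      proof (cases "real (sum g K) \<le> R")
        case True
        have "(\<Prod>k\<in>K. q k ^ g k) * (1 - real (sum g K) / R) \<le> (\<Prod>k\<in>K. q k ^ g k) * 1"
          using R(1) wnn by (intro mult_left_mono) (auto intro!: divide_nonneg_pos sum_nonneg)
        then show ?thesis using True by simp
      next
        case False
        then have "1 - real (sum g K) / R \<le> 0" using R(1) by (simp add: field_simps)
        then show ?thesis using False wnn[of g] by (simp add: mult_nonneg_nonpos)
      qed
    qed
    also have "\<dots> = (\<Sum>g\<in>{g \<in> ?G. real (sum g K) \<le> R}. \<Prod>k\<in>K. q k ^ count (mg g) k)"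
      using finG by (simp add: sum.inter_filter cnt)
    also have "\<dots> = (\<Sum>M\<in>mg ` {g \<in> ?G. real (sum g K) \<le> R}. \<Prod>k\<in>K. q k ^ count M k)"
    proof (subst sum.reindex)
      show "inj_on mg {g \<in> ?G. real (sum g K) \<le> R}"
      proof (rule inj_onI)
        fix g g' assume gg: "g \<in> {g \<in> ?G. real (sum g K) \<le> R}" "g' \<in> {g \<in> ?G. real (sum g K) \<le> R}" "mg g
            = mg g'"
        show "g = g'"
        proof (rule PiE_ext[of g K "\<lambda>_. {..J}" g'])
          show "g \<in> ?G" "g' \<in> ?G" using gg by blast+
          fix k assume "k \<in> K"
          then show "g k = g' k" using cnt[of g k] cnt[of g' k] gg(3) by simp
        qed
      qed
    qed simp
    also have "\<dots> \<le> (\<Sum>M\<in>F. \<Prod>k\<in>K. q k ^ count M k)"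
    proof (rule sum_mono2[OF finF])
      show "mg ` {g \<in> ?G. real (sum g K) \<le> R} \<subseteq> F"
      proof
        fix M assume "M \<in> mg ` {g \<in> ?G. real (sum g K) \<le> R}"
        then obtain g where g: "g \<in> ?G" "real (sum g K) \<le> R" "M = mg g" by auto
        have "g k \<le> nat \<lfloor>R\<rfloor>" if "k \<in> K" for k
        proof -
          have "g k \<le> sum g K" using K that by (intro member_le_sum) auto
          then have "real (g k) \<le> R" using g(2) by linarith
          then show ?thesis by (rule le_nat_floor)
        qed
        then show "M \<in> F" using g unfolding F_def by (intro image_eqI[of _ _ g]) auto
      qed
    qed (use wnn in auto)
    finally show ?thesis unfolding Z_def .
  qed
  have "(\<lambda>J. 1 / 2 * (\<Prod>k\<in>K. \<Sum>i\<le>J. q k ^ i)) \<longlonglongrightarrow> 1 / 2 * (\<Prod>k\<in>K. 1 / (1 - q k))"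
  proof (intro tendsto_mult tendsto_const tendsto_prod)
    fix k assume "k \<in> K"
    then have "(\<lambda>i. q k ^ i) sums (1 / (1 - q k))" using q by (intro geometric_sums) auto
    then show "(\<lambda>J. \<Sum>i\<le>J. q k ^ i) \<longlonglongrightarrow> 1 / (1 - q k)" by (simp add: sums_def_le)
  qed
  then have "1 / 2 * (\<Prod>k\<in>K. 1 / (1 - q k)) \<le> (\<Sum>M\<in>F. \<Prod>k\<in>K. q k ^ count M k)"
    by (rule LIMSEQ_le_const2) (use main in blast)
  moreover have "\<forall>M\<in>F. set_mset M \<subseteq> K \<and> real (size M) \<le> R"
    unfolding F_def using setm szm by auto
  ultimately show ?thesis using finF by blast
qed

section \<open>Gaussian sums and the constant\<close>

lemma neg_ln_series:
  fixes q :: real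
  assumes "0 \<le> q" "q < 1"
  shows "(\<lambda>n. q ^ Suc n / real (Suc n)) sums (- ln (1 - q))"
proof -
  have "(\<lambda>n. - ((- (- q)) ^ n) / of_nat n) sums ln (1 + (- q))"
    using assms by (intro ln_series') auto
  then have "(\<lambda>n. q ^ n / real n) sums (- ln (1 - q))"
    using sums_minus by fastforce
  then show ?thesis using sums_Suc_iff[of "\<lambda>n. q ^ n / real n" "- ln (1 - q)"] by simp
qed

lemma neg_ln_ge:
  fixes q :: real
  assumes "0 \<le> q" "q < 1"
  shows "(\<Sum>n<m. q ^ Suc n / real (Suc n)) \<le> - ln (1 - q)"
proof -
  note s = neg_ln_series[OF assms]
  have "(\<Sum>n<m. q ^ Suc n / real (Suc n)) \<le> (\<Sum>n. q ^ Suc n / real (Suc n))"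
    using assms by (intro sum_le_suminf sums_summable[OF s]) auto
  then show ?thesis using sums_unique[OF s] by simp
qed

lemma nn_integral_gaussian:
  assumes a: "a > 0"
  shows "(\<integral>\<^sup>+x. ennreal (exp (- (a * x\<^sup>2))) \<partial>lborel) = ennreal (sqrt (pi / a))"
proof -
  define \<sigma> where "\<sigma> = 1 / sqrt (2 * a)"
  have \<sigma>: "\<sigma> > 0" "\<sigma>\<^sup>2 = 1 / (2 * a)" using a by (auto simp: \<sigma>_def power_divide)
  have e: "exp (- (a * x\<^sup>2)) = sqrt (pi / a) * normal_density 0 \<sigma> x" for x
    using a unfolding normal_density_def \<sigma>(2) by (simp add: real_sqrt_divide field_simps)
  have "(\<integral>\<^sup>+x. ennreal (exp (- (a * x\<^sup>2))) \<partial>lborel)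
      = ennreal (\<integral>x. sqrt (pi / a) * normal_density 0 \<sigma> x \<partial>lborel)"
    unfolding e using \<sigma> a by (intro nn_integral_eq_integral integrable_mult_right integrable_normal_density)
        auto
  also have "(\<integral>x. sqrt (pi / a) * normal_density 0 \<sigma> x \<partial>lborel) = sqrt (pi / a)"
    using \<sigma> by simp
  finally show ?thesis .
qed

lemma summable_zeta_half: "summable (\<lambda>n. 1 / real (Suc n) powr (3 / 2))"
proof -
  have "summable (\<lambda>n. real n powr (- 3 / 2))" by (subst summable_real_powr_iff) simp
  then have "summable (\<lambda>n. real (Suc n) powr (- 3 / 2))" by (subst summable_Suc_iff)
  moreover have "real (Suc n) powr (- 3 / 2) = 1 / real (Suc n) powr (3 / 2)" for n
    by (simp add: powr_minus_divide[symmetric])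
  ultimately show ?thesis by simp
qed

lemma zeta_half_pos: "zeta_real (3 / 2) > 0"
  unfolding zeta_real_def by (intro suminf_pos summable_zeta_half) auto

lemma sqrt_div_eq_powr:
  assumes "x > 0"
  shows "sqrt (p / x) / x = sqrt p * (1 / x powr (3 / 2))"
proof -
  have "x powr (3 / 2) = x powr (1 + 1 / 2)" by simp
  also have "\<dots> = x * sqrt x" using assms by (subst powr_add) (simp add: powr_half_sqrt)
  finally show ?thesis using assms by (simp add: real_sqrt_divide)
qed

text \<open>The logarithm is expanded in powers of the Gaussian and integrated termwise; since the
  terms are nonnegative, monotone convergence applies. Each Gaussian integral contributes one term
  of the zeta series.\<close>

lemma C1_eq: "C1 = - zeta_real (3 / 2) / (2 * sqrt pi)"
proof -
  let ?f = "\<lambda>p :: real. - ln (1 - exp (- p\<^sup>2))"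
  have f_nn: "?f p \<ge> 0" for p
    by (cases "p = 0") (auto simp: ln_le_zero_iff)
  have ae: "AE p in lborel. ennreal (?f p) = (\<Sum>n. ennreal (exp (- (real (Suc n) * p\<^sup>2)) / real (Suc n)))"
  \<comment> \<open>At \<open>p = 0\<close> the argument of the logarithm vanishes; this point is
    discarded as a null set.\<close>
  proof (rule AE_mp[OF AE_lborel_singleton[of 0]], rule AE_I2, rule impI)
    fix p :: real assume "p \<noteq> 0"
    then have q: "0 \<le> exp (- p\<^sup>2)" "exp (- p\<^sup>2) < 1" by auto
    have e: "exp (- p\<^sup>2) ^ Suc n = exp (- (real (Suc n) * p\<^sup>2))" for n
      by (subst exp_of_nat_mult[symmetric]) simp
    from neg_ln_series[OF q] have s: "(\<lambda>n. exp (- (real (Suc n) * p\<^sup>2)) / real (Suc n)) sums ?f p"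
      unfolding e .
    show "ennreal (?f p) = (\<Sum>n. ennreal (exp (- (real (Suc n) * p\<^sup>2)) / real (Suc n)))"
      unfolding sums_unique[OF s] using sums_summable[OF s] by (intro suminf_ennreal2[symmetric]) auto
  qed
  have "(\<integral>\<^sup>+p. ennreal (?f p) \<partial>lborel) = (\<integral>\<^sup>+p. (\<Sum>n. ennreal (exp (- (real (Suc n) * p\<^sup>2))
      / real (Suc n))) \<partial>lborel)"
    by (rule nn_integral_cong_AE[OF ae])
  also have "\<dots> = (\<Sum>n. \<integral>\<^sup>+p. ennreal (exp (- (real (Suc n) * p\<^sup>2)) / real (Suc n)) \<partial>lborel)"
    by (rule nn_integral_suminf) measurable
  also have "\<dots> = (\<Sum>n. ennreal (sqrt pi * (1 / real (Suc n) powr (3 / 2))))"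
  proof (rule arg_cong[where f = suminf], rule ext)
    fix n
    have "(\<integral>\<^sup>+p. ennreal (exp (- (real (Suc n) * p\<^sup>2)) / real (Suc n)) \<partial>lborel)
        = (\<integral>\<^sup>+p. ennreal (1 / real (Suc n)) * ennreal (exp (- (real (Suc n) * p\<^sup>2))) \<partial>lborel)"
      by (intro nn_integral_cong) (simp flip: ennreal_mult add: divide_inverse mult.commute)
    also have "\<dots> = ennreal (1 / real (Suc n)) * ennreal (sqrt (pi / real (Suc n)))"
      by (subst nn_integral_cmult) (simp_all only: nn_integral_gaussian of_nat_0_less_iff zero_less_Suc,
          measurable)
    also have "\<dots> = ennreal (sqrt (pi / real (Suc n)) / real (Suc n))"
      by (simp flip: ennreal_mult)
    also have "sqrt (pi / real (Suc n)) / real (Suc n) = sqrt pi * (1 / real (Suc n) powr (3 / 2))"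
      by (rule sqrt_div_eq_powr) simp
    finally show "(\<integral>\<^sup>+p. ennreal (exp (- (real (Suc n) * p\<^sup>2)) / real (Suc n)) \<partial>lborel)
        = ennreal (sqrt pi * (1 / real (Suc n) powr (3 / 2)))" .
  qed
  also have "\<dots> = ennreal (sqrt pi * zeta_real (3 / 2))"
    unfolding zeta_real_def suminf_mult[OF summable_zeta_half, symmetric]
    by (intro suminf_ennreal2 summable_mult summable_zeta_half) auto
  finally have nn: "(\<integral>\<^sup>+p. ennreal (?f p) \<partial>lborel) = ennreal (sqrt pi * zeta_real (3 / 2))" .
  have "(LINT p|lborel. ?f p) = enn2real (\<integral>\<^sup>+p. ennreal (?f p) \<partial>lborel)"
    using f_nn by (intro integral_eq_nn_integral) auto
  then have "(LINT p|lborel. ?f p) = sqrt pi * zeta_real (3 / 2)"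
    unfolding nn using zeta_half_pos by simp
  then have "(LINT p|lborel. ln (1 - exp (- p\<^sup>2))) = - (sqrt pi * zeta_real (3 / 2))"
    by simp
  then have "C1 = - (sqrt pi * zeta_real (3 / 2)) / (2 * pi)" unfolding C1_def by simp
  also have "\<dots> = - zeta_real (3 / 2) / (2 * sqrt pi)"
  proof -
    have "pi = sqrt pi * sqrt pi" by simp
    then show ?thesis by (simp add: field_simps) 
  qed
  finally show ?thesis .
qed

lemma summable_gaussian:
  assumes "a > 0"
  shows "summable (\<lambda>k. gauss a k)"
proof (rule summable_comparison_test')
  show "summable (\<lambda>k. exp (- a) ^ k)" using assms by (intro summable_geometric) simp
  fix k :: nat
  have "real k \<le> (real k)\<^sup>2" by (cases k) (auto simp: power2_eq_square)
  then have "gauss a k \<le> exp (real k * (- a))" using assms by simp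
  then show "norm (gauss a k) \<le> exp (- a) ^ k"
    by (simp only: exp_of_nat_mult real_norm_def abs_exp_cancel)
qed

text \<open>\<open>A k\<close> is the set where \<open>|x|\<close> has integer part
  \<open>k\<close>. It has measure at most 2, and there the Gaussian is at most its value at
  \<open>k\<close>.\<close>

lemma gaussian_sum_ge:
  assumes a: "a > 0"
  shows "sqrt (pi / a) / 2 \<le> (\<Sum>k. gauss a k)"
proof -
  define A where "A = (\<lambda>k :: nat. {real k..<real k + 1} \<union> {- real k - 1<..- real k})"
  have "(\<integral>\<^sup>+x. ennreal (exp (- (a * x\<^sup>2))) \<partial>lborel)
      \<le> (\<integral>\<^sup>+x. (\<Sum>k. ennreal (gauss a k) * indicator (A k) x) \<partial>lborel)"
  proof (rule nn_integral_mono)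
    fix x :: real
    define k where "k = nat \<lfloor>\<bar>x\<bar>\<rfloor>"
    have k: "real k \<le> \<bar>x\<bar>" "\<bar>x\<bar> < real k + 1" by (auto simp: k_def)
    then have xA: "x \<in> A k" by (auto simp: A_def abs_real_def split: if_splits)
    have "(real k)\<^sup>2 \<le> x\<^sup>2" using k by (metis abs_le_square_iff abs_of_nat)
    then have "exp (- (a * x\<^sup>2)) \<le> gauss a k" using a by simp
    then have "ennreal (exp (- (a * x\<^sup>2))) \<le> ennreal (gauss a k) * indicator (A k) x"
      using xA by (simp add: ennreal_leI)
    also have "\<dots> = (\<Sum>i\<in>{k}. ennreal (exp (- (a * (real i)\<^sup>2))) * indicator (A i) x)"
      by (simp only: sum.insert finite.emptyI empty_iff not_False_eq_True sum.empty add_0_right)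
    also have "\<dots> \<le> (\<Sum>k. ennreal (gauss a k) * indicator (A k) x)"
      by (rule sum_le_suminf) auto
    finally show "ennreal (exp (- (a * x\<^sup>2))) \<le> (\<Sum>k. ennreal (gauss a k) * indicator (A k) x)" .
  qed
  also have "\<dots> = (\<Sum>k. \<integral>\<^sup>+x. ennreal (gauss a k) * indicator (A k) x \<partial>lborel)"
    by (rule nn_integral_suminf) (auto simp: A_def)
  also have "\<dots> \<le> (\<Sum>k. ennreal (2 * gauss a k))"
  proof (rule suminf_le)
    fix k
    have "emeasure lborel (A k) \<le> emeasure lborel {real k..<real k + 1} + emeasure lborel {- real k
        - 1<..- real k}"
      unfolding A_def by (rule emeasure_subadditive) auto
    also have "\<dots> = 2" by simp
    finally have m: "emeasure lborel (A k) \<le> 2" .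
    have "(\<integral>\<^sup>+x. ennreal (gauss a k) * indicator (A k) x \<partial>lborel) = ennreal (gauss a k) * emeasure lborel (A k)"
      by (rule nn_integral_cmult_indicator) (auto simp: A_def)
    also have "\<dots> \<le> ennreal (gauss a k) * 2" using m by (rule mult_left_mono) simp
    also have "\<dots> = ennreal (2 * gauss a k)" by (simp add: ennreal_mult mult.commute)
    finally show "(\<integral>\<^sup>+x. ennreal (gauss a k) * indicator (A k) x \<partial>lborel) \<le> ennreal (2 * gauss a k)" .
  qed auto
  also have "\<dots> = ennreal (2 * (\<Sum>k. gauss a k))"
    unfolding suminf_mult[OF summable_gaussian[OF a], symmetric]
    by (intro suminf_ennreal2 summable_mult summable_gaussian a) auto
  finally show ?thesis
    unfolding nn_integral_gaussian[OF a] using suminf_nonneg[OF summable_gaussian[OF a]]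
    by (subst (asm) ennreal_le_iff) auto
qed

text \<open>The 2 pays for the missing term \<open>k = 0\<close> and for the tail from
  \<open>l\<close> on. Because \<open>c * l \<ge> 1\<close>, the tail is dominated by a geometric
  series of ratio \<open>exp (- 1)\<close>, whose sum is at most 1.\<close>

lemma gaussian_sum_truncated_ge:
  assumes c: "c > 0" and cl: "c * real l \<ge> 1" and l: "l \<ge> 1" and m: "m \<ge> 1"
  shows "sqrt (pi / (c * real m)) / 2 - 2 \<le> (\<Sum>k\<in>{1..<l}. exp (- (c * real m * (real k)\<^sup>2)))"
proof -
  let ?f = "\<lambda>k. exp (- (c * real m * (real k)\<^sup>2))"
  have a: "c * real m > 0" using c m by simp
  have sm: "summable ?f" by (rule summable_gaussian[OF a])
  have geo: "(\<lambda>k. exp (- 1 :: real) ^ k) sums (1 / (1 - exp (- 1)))" by (rule geometric_sums) simp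
  have tail: "?f (k + l) \<le> exp (- 1) ^ Suc k" for k
  proof -
    have "real (k + l) \<ge> 1" using l by simp
    have "1 * (1 * real (k + 1)) \<le> real m * ((c * real l) * real (k + l))"
      using m cl l by (intro mult_mono) auto
    also have "\<dots> \<le> real m * ((c * real (k + l)) * real (k + l))"
      using c by (intro mult_left_mono mult_right_mono) auto
    also have "\<dots> = c * real m * (real (k + l))\<^sup>2" by (simp add: power2_eq_square)
    finally have "?f (k + l) \<le> exp (real (Suc k) * (- 1))" by simp
    then show ?thesis by (simp only: exp_of_nat_mult)
  qed
  have e2: "exp (- 1 :: real) \<le> 1 / 2"
  proof -
    have "(2 :: real) \<le> exp 1" using exp_ge_add_one_self[of 1] by simp
    then show ?thesis by (simp add: exp_minus field_simps)
  qed
  have "(\<Sum>k. ?f (k + l)) \<le> (\<Sum>k. exp (- 1) ^ Suc k)"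
    using tail summable_ignore_initial_segment[OF sm, of l] geo
    by (intro suminf_le) (auto simp del: of_nat_add simp: sums_iff intro!: summable_mult)
  also have "\<dots> = exp (- 1) * (1 / (1 - exp (- 1)))"
    using geo by (simp add: suminf_mult sums_iff)
  also have "\<dots> \<le> 1" using e2 by (simp add: field_simps)
  finally have t: "(\<Sum>k. ?f (k + l)) \<le> 1" .
  have "sqrt (pi / (c * real m)) / 2 \<le> (\<Sum>k. ?f k)" by (rule gaussian_sum_ge[OF a])
  also have "\<dots> = (\<Sum>k. ?f (k + l)) + (\<Sum>k<l. ?f k)"
    by (rule suminf_split_initial_segment[OF sm])
  also have "(\<Sum>k<l. ?f k) = ?f 0 + (\<Sum>k\<in>{1..<l}. ?f k)"
    using l by (simp add: lessThan_atLeast0 sum.atLeast_Suc_lessThan)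
  finally show ?thesis using t by simp
qed

text \<open>The terms are compared with the telescoping differences of
  \<open>2 / sqrt n\<close>.\<close>

lemma zeta_tail:
  assumes m: "m \<ge> 1"
  shows "zeta_real (3 / 2) \<le> (\<Sum>n<m. 1 / real (Suc n) powr (3 / 2)) + 2 / sqrt (real m)"
proof -
  let ?g = "\<lambda>n. 1 / real (Suc n) powr (3 / 2)"
  have step: "?g n \<le> 2 / sqrt (real n) - 2 / sqrt (real (Suc n))" if n: "n \<ge> 1" for n
  proof -
    define x where "x = sqrt (real n)"
    define y where "y = sqrt (real (Suc n))"
    have xy: "x > 0" "x \<le> y" "y > 0" "y\<^sup>2 = x\<^sup>2 + 1" using n by (auto simp: x_def y_def)
    have "real (Suc n) powr (3 / 2) = real (Suc n) powr (1 + 1 / 2)" by simp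
    also have "\<dots> = real (Suc n) * y" unfolding y_def by (subst powr_add) (simp add: powr_half_sqrt)
    finally have "?g n = 1 / (real (Suc n) * y)" by (simp only:)
    moreover have "y\<^sup>2 = real (Suc n)" by (simp add: y_def)
    ultimately have g: "?g n = 1 / (y\<^sup>2 * y)" by (simp only:)
    have "(y - x) * (y + x) = 1" using xy(4) by (simp add: power2_eq_square algebra_simps)
    then have yx: "y - x = 1 / (y + x)" using xy by (simp add: field_simps)
    have "2 / x - 2 / y = 2 * (y - x) / (x * y)" using xy by (simp add: field_simps)
    also have "\<dots> = 2 / ((x * y) * (y + x))" unfolding yx using xy by simp
    also have "\<dots> \<ge> 2 / ((y * y) * (y + y))"
      using xy by (intro divide_left_mono mult_mono mult_pos_pos) auto
    finally show ?thesis unfolding g x_def[symmetric] y_def[symmetric] using xy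
      by (simp add: power2_eq_square mult.commute)
  qed
  have part: "(\<Sum>n<m + N. ?g n) \<le> (\<Sum>n<m. ?g n) + (2 / sqrt (real m) - 2 / sqrt (real (m + N)))" for N
  proof (induction N)
    case (Suc N)
    have "?g (m + N) \<le> 2 / sqrt (real (m + N)) - 2 / sqrt (real (Suc (m + N)))" using m by (intro step) auto
    then show ?case using Suc unfolding add_Suc_right sum.lessThan_Suc by linarith
  qed simp
  have "(\<lambda>N. \<Sum>n<m + N. ?g n) \<longlonglongrightarrow> zeta_real (3 / 2)"
    using LIMSEQ_ignore_initial_segment[OF summable_LIMSEQ[OF summable_zeta_half], of m]
    unfolding zeta_real_def by (simp add: add.commute)
  moreover have "(\<Sum>n<m + N. ?g n) \<le> (\<Sum>n<m. ?g n) + 2 / sqrt (real m)" for N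
    using part[of N] by (rule order_trans) simp
  ultimately show ?thesis by (intro LIMSEQ_le_const2) auto
qed

lemma harmonic_le: "(\<Sum>n<m. 1 / real (Suc n)) \<le> 1 + ln (real m)" if "m \<ge> 1" for m
  using that
proof (induction m rule: nat_induct_at_least)
  case (Suc m)
  have "ln (real m) - ln (real (Suc m)) \<le> (real m - real (Suc m)) / real (Suc m)"
    using Suc(1) by (intro ln_diff_le) auto
  then have "1 / real (Suc m) \<le> ln (real (Suc m)) - ln (real m)" by (simp add: field_simps)
  then show ?case using Suc by simp
qed simp

text \<open>Cutting the logarithmic series after about \<open>1 / c\<close> terms balances two
  losses. The tail of the zeta series costs at most 2; the loss 2 in each Gaussian sum is weighted
  by \<open>1 / Suc n\<close> and adds up to at most \<open>2 * (1 + ln (2 / c))\<close>.\<close>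

lemma sum_neg_ln_ge:
  assumes c: "c > 0" "c \<le> 1" and cl: "c * real l \<ge> 1" and l: "l \<ge> 1"
  shows "sqrt (pi / c) / 2 * zeta_real (3 / 2) - 4 - 2 * ln (2 / c) \<le> (\<Sum>k\<in>{1..<l}. - ln (1 - gauss c k))"
proof -
  define m where "m = nat \<lceil>1 / c\<rceil>"
  have m: "real m \<ge> 1 / c" "real m \<le> 1 / c + 1" using c by (auto simp: m_def)
  have m1: "m \<ge> 1" using m(1) c by (simp add: m_def Suc_le_eq)
  have m2: "real m \<le> 2 / c"
  proof -
    have "1 \<le> 1 / c" using c by simp
    then show ?thesis using m(2) by simp
  qed
  have "(\<Sum>n<m. (sqrt (pi / (c * real (Suc n))) / 2 - 2) / real (Suc n))
     \<le> (\<Sum>n<m. (\<Sum>k\<in>{1..<l}. exp (- (c * real (Suc n) * (real k)\<^sup>2))) / real (Suc n))"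
    using c cl l by (intro sum_mono divide_right_mono gaussian_sum_truncated_ge) auto
  also have "\<dots> = (\<Sum>k\<in>{1..<l}. \<Sum>n<m. gauss c k ^ Suc n / real (Suc n))"
    unfolding sum_divide_distrib
  proof (subst sum.swap, intro sum.cong refl)
    fix k n
    have "exp (- (c * real (Suc n) * (real k)\<^sup>2)) = exp (real (Suc n) * (- (c * (real k)\<^sup>2)))"
      by (simp add: mult_ac)
    also have "\<dots> = gauss c k ^ Suc n" by (rule exp_of_nat_mult)
    finally show "exp (- (c * real (Suc n) * (real k)\<^sup>2)) / real (Suc n) = gauss c k ^ Suc n / real (Suc n)"
        by simp
  qed
  also have "\<dots> \<le> (\<Sum>k\<in>{1..<l}. - ln (1 - gauss c k))"
    using c by (intro sum_mono neg_ln_ge) auto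
  finally have A: "(\<Sum>n<m. (sqrt (pi / (c * real (Suc n))) / 2 - 2) / real (Suc n))
      \<le> (\<Sum>k\<in>{1..<l}. - ln (1 - gauss c k))" .
  have "(sqrt (pi / (c * real (Suc n))) / 2 - 2) / real (Suc n)
      = sqrt (pi / c) / 2 * (1 / real (Suc n) powr (3 / 2)) - 2 * (1 / real (Suc n))" for n
  proof -
    have "sqrt (pi / (c * real (Suc n))) / real (Suc n) = sqrt (pi / c / real (Suc n)) / real (Suc n)" by simp
    also have "\<dots> = sqrt (pi / c) * (1 / real (Suc n) powr (3 / 2))" by (rule sqrt_div_eq_powr) simp
    finally have t: "sqrt (pi / (c * real (Suc n))) / real (Suc n)
        = sqrt (pi / c) * (1 / real (Suc n) powr (3 / 2))" .
    have "(sqrt (pi / (c * real (Suc n))) / 2 - 2) / real (Suc n)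
        = (sqrt (pi / (c * real (Suc n))) / real (Suc n)) / 2 - 2 * (1 / real (Suc n))"
      by (simp add: diff_divide_distrib)
    then show ?thesis unfolding t by simp
  qed
  then have B: "(\<Sum>n<m. (sqrt (pi / (c * real (Suc n))) / 2 - 2) / real (Suc n))
     = sqrt (pi / c) / 2 * (\<Sum>n<m. 1 / real (Suc n) powr (3 / 2)) - 2 * (\<Sum>n<m. 1 / real (Suc n))"
    by (simp only: sum_subtractf sum_distrib_left)
  have "sqrt (pi / c) / 2 * (zeta_real (3 / 2) - 2 / sqrt (real m))
      \<le> sqrt (pi / c) / 2 * (\<Sum>n<m. 1 / real (Suc n) powr (3 / 2))"
    using zeta_tail[OF m1] c by (intro mult_left_mono) auto
  moreover have "sqrt (pi / c) / sqrt (real m) \<le> 2"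
  proof -
    have "sqrt (pi / c) / sqrt (real m) = sqrt (pi / (c * real m))"
        by (simp add: real_sqrt_divide real_sqrt_mult)
    also have "\<dots> \<le> sqrt 4"
    proof (rule real_sqrt_le_mono)
      have "1 \<le> c * real m" using m(1) c by (simp add: field_simps)
      then have "pi / (c * real m) \<le> pi / 1" by (intro divide_left_mono) auto
      then show "pi / (c * real m) \<le> 4" using pi_less_4 by simp
    qed
    finally show ?thesis by simp
  qed
  moreover have "(\<Sum>n<m. 1 / real (Suc n)) \<le> 1 + ln (2 / c)"
  proof -
    have "ln (real m) \<le> ln (2 / c)" using m2 m1 c by simp
    then show ?thesis using harmonic_le[OF m1] by linarith
  qed
  ultimately show ?thesis using A unfolding B by (simp add: right_diff_distrib)
qed

section \<open>The thermodynamic limit\<close>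

lemma fekete_nonneg:
  fixes a :: "nat \<Rightarrow> real"
  assumes sub: "\<And>m n. m \<ge> 1 \<Longrightarrow> n \<ge> 1 \<Longrightarrow> a (m + n) \<le> a m + a n" and nn: "\<And>n. a n \<ge> 0"
  shows "convergent (\<lambda>n. a n / real n)"
proof -
  define c where "c = (INF n\<in>{1..}. a n / real n)"
  have bdd: "bdd_below ((\<lambda>n. a n / real n) ` {1..})"
    using nn by (intro bdd_belowI2[of _ 0]) auto
  have c_le: "c \<le> a n / real n" if "n \<ge> 1" for n
    unfolding c_def using that bdd by (intro cINF_lower) auto
  \<comment> \<open>Remainder zero is treated apart, since subadditivity is assumed for positive
    lengths only.\<close>
  have mult: "a (Suc q * m + r) \<le> real (Suc q) * a m + (if r = 0 then 0 else a r)" if "m \<ge> 1" for q m r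
  proof -
    have "a (Suc q * m) \<le> real (Suc q) * a m"
    proof (induction q)
      case (Suc q)
      have "a (m + Suc q * m) \<le> a m + a (Suc q * m)" using that by (intro sub) auto
      with Suc show ?case by (simp add: algebra_simps)
    qed simp
    moreover have "a (Suc q * m + r) \<le> a (Suc q * m) + a r" if "r \<noteq> 0"
      using that \<open>m \<ge> 1\<close> by (intro sub) auto
    ultimately show ?thesis by auto
  qed
  have "(\<lambda>n. a n / real n) \<longlonglongrightarrow> c"
  proof (rule LIMSEQ_I)
    fix e :: real assume e: "e > 0"
    obtain m where m: "m \<ge> 1" "a m / real m < c + e / 2"
    proof -
      have "\<exists>x\<in>(\<lambda>n. a n / real n) ` {1..}. x < c + e / 2"
        using cInf_lessD[of "(\<lambda>n. a n / real n) ` {1..}" "c + e / 2"] e unfolding c_def by auto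
      then show ?thesis using that by auto
    qed
    define A where "A = (\<Sum>r<m. a r)"
    have A: "a r \<le> A" if "r < m" for r unfolding A_def using that nn by (intro member_le_sum) auto
    have A0: "A \<ge> 0" unfolding A_def by (intro sum_nonneg nn)
    obtain N :: nat where N: "real N > 2 * A / e" using reals_Archimedean2 by blast
    have "norm (a n / real n - c) < e" if n: "n \<ge> max (Suc N) m" for n
    proof -
      have n1: "n \<ge> 1" "n \<ge> m" "n > N" using n m(1) by auto
      obtain q where q: "n div m = Suc q" using n1 m(1) by (cases "n div m") (auto simp: div_eq_0_iff)
      have "n = Suc q * m + n mod m" using q by (metis div_mult_mod_eq)
      then have "a n \<le> real (Suc q) * a m + (if n mod m = 0 then 0 else a (n mod m))"
        using mult[OF m(1), of q "n mod m"] by simp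
      also have "\<dots> \<le> real (Suc q) * a m + A" using A[of "n mod m"] A0 m(1) by auto
      also have "\<dots> \<le> real n / real m * a m + A"
      proof -
        have "Suc q * m \<le> n" using q by (metis div_times_less_eq_dividend)
        then have "real (Suc q) * real m \<le> real n" by (metis of_nat_le_iff of_nat_mult)
        then have "real (Suc q) \<le> real n / real m" using m(1) by (simp add: field_simps)
        from mult_right_mono[OF this nn[of m]] show ?thesis by simp
      qed
      finally have "a n / real n \<le> a m / real m + A / real n" using n1 by (simp add: field_simps)
      moreover have "A / real n < e / 2"
      proof -
        have "2 * A < e * real N" using N e by (simp add: field_simps)
        also have "\<dots> \<le> e * real n" using e n1 by simp
        finally show ?thesis using n1 by (simp add: field_simps)
      qed
      ultimately show ?thesis using m(2) c_le[OF n1(1)] e unfolding real_norm_def by linarith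
    qed
    then show "\<exists>no. \<forall>n\<ge>no. norm (a n / real n - c) < e" by blast
  qed
  then show ?thesis by (rule convergentI)
qed

lemma trial_mono: "trial D b L W' \<Longrightarrow> W \<le> W' \<Longrightarrow> trial D b L W"
  unfolding trial_def by (meson order_trans)

text \<open>Tensoring the trial family of one block with itself gives
  \<open>Zp \<ge> W ^ Suc q\<close> on \<open>Suc q\<close> blocks. As the limit exists, the
  multiples of \<open>l\<close> determine it, and no block remainder has to be estimated.\<close>

lemma free_energy_le_trial:
  assumes D: "D \<ge> 1" and b: "b > 0" and l: "l \<ge> 1" and W: "trial D b l W" "W > 0"
  shows "free_energy b (half D) \<le> - (ln W / real l) / b"
proof -
  define a where "a = (\<lambda>L. ln (Zp D b L))"
  have Zpos: "Zp D b L > 0" for L using Zp_ge_1[of D b L] by linarith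
  have "convergent (\<lambda>n. a n / real n)"
  proof (rule fekete_nonneg)
    fix m n :: nat assume mn: "m \<ge> 1" "n \<ge> 1"
    have "a (m + n) \<le> ln (Zp D b m * Zp D b n)"
      unfolding a_def using Zp_submult[OF mn, of b D] b Zpos by simp
    then show "a (m + n) \<le> a m + a n" unfolding a_def using Zpos[of m] Zpos[of n] by (simp add: ln_mult)
  qed (simp add: a_def Zp_ge_1)
  then obtain k where k: "(\<lambda>n. a n / real n) \<longlonglongrightarrow> k" by (auto simp: convergent_def)
  have "(\<lambda>L. - (1 / b) * (a L / real L)) \<longlonglongrightarrow> - (1 / b) * k"
    by (intro tendsto_mult tendsto_const k)
  moreover have "free_energy_fin L b (half D) = - (1 / b) * (a L / real L)" for L
    by (simp add: free_energy_fin_def a_def Zp_def)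
  ultimately have f: "free_energy b (half D) = - (1 / b) * k"
    unfolding free_energy_def by (simp add: limI)
  have "(\<lambda>q. a (Suc q * l) / real (Suc q * l)) \<longlonglongrightarrow> k"
  proof -
    have "strict_mono (\<lambda>q. Suc q * l)" using l by (intro strict_monoI) auto
    from LIMSEQ_subseq_LIMSEQ[OF k this] show ?thesis by (simp only: o_def)
  qed
  moreover have "ln W / real l \<le> a (Suc q * l) / real (Suc q * l)" for q
  proof -
    have "trial D b (Suc q * l) (W ^ Suc q)" using D l W by (intro trial_power) auto
    then have "W ^ Suc q \<le> Zp D b (Suc q * l)" using b by (intro trial_Zp) auto
    then have "ln (W ^ Suc q) \<le> a (Suc q * l)" unfolding a_def using W(2)
        by (subst ln_le_cancel_iff) (auto intro: Zpos simp del: power_Suc)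
    then have "real (Suc q) * ln W \<le> a (Suc q * l)" using W(2) by (simp only: ln_realpow)
    then have "real (Suc q) * ln W / real (Suc q * l) \<le> a (Suc q * l) / real (Suc q * l)"
      by (rule divide_right_mono) simp
    also have "real (Suc q) * ln W / real (Suc q * l) = ln W / real l"
      unfolding of_nat_mult by (rule mult_divide_mult_cancel_left) simp
    finally show ?thesis .
  qed
  ultimately have "ln W / real l \<le> k" by (intro LIMSEQ_le_const) auto
  then show ?thesis unfolding f using b by (simp add: field_simps)
qed

section \<open>The trial weight of one block\<close>

lemma sum_inverse_squares_le: "(\<Sum>k\<in>{1..<l}. 1 / (real k)\<^sup>2) \<le> 2"
proof -
  have "(\<Sum>k\<in>{1..<Suc (Suc n)}. 1 / (real k)\<^sup>2) \<le> 2 - 1 / real (Suc n)" for n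
  proof (induction n)
    case (Suc n)
    have "1 / (real (Suc (Suc n)))\<^sup>2 \<le> 1 / (real (Suc n) * real (Suc (Suc n)))"
      unfolding power2_eq_square by (intro divide_left_mono mult_right_mono) auto
    also have "\<dots> = 1 / real (Suc n) - 1 / real (Suc (Suc n))" by (simp add: field_simps)
    finally show ?case using Suc by (subst sum.atLeastLessThan_Suc) auto
  qed simp
  note A = this
  show ?thesis
  proof (cases "l \<le> 1")
    case False
    define n where "n = l - 2"
    have n: "l = Suc (Suc n)" using False by (simp add: n_def)
    show ?thesis unfolding n by (rule order_trans[OF A]) simp
  qed simp
qed

text \<open>Compared with \<open>sum_neg_ln_ge\<close> the constant grows from 4 to 6: the factor
  \<open>1 / 2\<close> lost in bounding the boson number and the factor \<open>1 - \<delta>\<close>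
  together are at least \<open>1 / 4\<close>, whose logarithm exceeds -2.\<close>

lemma trial_lower_bound:
  assumes D: "D \<ge> 1" and l: "l \<ge> 1" and \<beta>: "\<beta> > 0" and b: "b = \<beta> * half D"
    and del: "\<delta> = 4 * real l ^ 3 / b\<^sup>2" "\<delta> \<le> 1 / 2"
    and c: "c = b / (1 - \<delta>) * (pi / real l)\<^sup>2" "c \<le> 1" "c * real l \<ge> 1"
  shows "\<exists>W > 0. trial D \<beta> l W \<and> sqrt (pi / c) / 2 * zeta_real (3 / 2) - 6 - 2 * ln (2 / c) \<le> ln W"
proof -
  have b0: "b > 0" unfolding b half_def using \<beta> D by simp
  have d0: "\<delta> \<ge> 0" unfolding del by simp
  have c0: "c > 0" unfolding c(1) using b0 del(2) l by simp
  \<comment> \<open>Mode \<open>k\<close> holds at most \<open>1 / (c * k^2)\<close> bosons on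
    average, so their mean number is at most \<open>2 / c\<close>, which is at most
    \<open>R / 2\<close> because \<open>pi^2 \<ge> 4\<close>. With this \<open>R\<close> the norm
    loss \<open>4 * R^2 / l\<close> is exactly \<open>\<delta>\<close>.\<close>
  define R where "R = (real l)\<^sup>2 / b"
  have R0: "R > 0" using b0 l by (simp add: R_def)
  define q where "q = (\<lambda>k :: nat. gauss c k)"
  have q: "0 \<le> q k \<and> q k < 1" if "k \<in> {1..<l}" for k using that c0 by (auto simp: q_def)
  have "(\<Sum>k\<in>{1..<l}. q k / (1 - q k)) \<le> (\<Sum>k\<in>{1..<l}. 1 / c * (1 / (real k)\<^sup>2))"
  proof (rule sum_mono)
    fix k assume k: "k \<in> {1..<l}"
    define x where "x = c * (real k)\<^sup>2"
    have x: "x > 0" using c0 k by (simp add: x_def)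
    have "exp x * exp (- x) = 1" by (simp flip: exp_add)
    moreover have "(1 + x) * exp (- x) \<le> exp x * exp (- x)" by (intro mult_right_mono exp_ge_add_one_self) simp
    ultimately have "exp (- x) * x \<le> 1 - exp (- x)" by (simp add: algebra_simps)
    then have "exp (- x) / (1 - exp (- x)) \<le> 1 / x" using x by (simp add: field_simps)
    then show "q k / (1 - q k) \<le> 1 / c * (1 / (real k)\<^sup>2)" by (simp add: q_def x_def)
  qed
  also have "\<dots> = 1 / c * (\<Sum>k\<in>{1..<l}. 1 / (real k)\<^sup>2)" by (rule sum_distrib_left[symmetric])
  also have "\<dots> \<le> 1 / c * 2" using c0 by (intro mult_left_mono sum_inverse_squares_le) auto
  also have "\<dots> \<le> R / 2"
  proof -
    have "4 \<le> pi\<^sup>2" using power_mono[of 2 pi 2] pi_gt3 by simp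
    then have "4 * (1 - \<delta>) * (real l)\<^sup>2 \<le> pi\<^sup>2 * 1 * (real l)\<^sup>2" using d0 del(2)
        by (intro mult_right_mono mult_mono) auto
    then have "4 * (1 - \<delta>) * (real l)\<^sup>2 / pi\<^sup>2 \<le> (real l)\<^sup>2" by (simp add: divide_le_eq mult.commute)
    then have "4 * (1 - \<delta>) * (real l)\<^sup>2 / pi\<^sup>2 / (2 * b) \<le> (real l)\<^sup>2 / (2 * b)"
      using b0 by (intro divide_right_mono) auto
    moreover have "1 / c * 2 = 4 * (1 - \<delta>) * (real l)\<^sup>2 / pi\<^sup>2 / (2 * b)"
      unfolding c(1) using b0 del(2) l by (simp add: power_divide field_simps)
    ultimately show ?thesis by (simp add: R_def)
  qed
  finally obtain F where F: "finite F" "\<And>M. M \<in> F \<Longrightarrow> set_mset M \<subseteq> {1..<l} \<and> real (size M) \<le> R"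
      "1 / 2 * (\<Prod>k\<in>{1..<l}. 1 / (1 - q k)) \<le> (\<Sum>M\<in>F. \<Prod>k\<in>{1..<l}. q k ^ count M k)"
    using bounded_occupation_sum[of "{1..<l}" q R] q R0 by auto
  have "\<delta> = 4 * R\<^sup>2 / real l"
    unfolding del R_def using l b0 by (simp add: power_divide power2_eq_square power3_eq_cube)
  then have tr: "trial D \<beta> l (\<Sum>M\<in>F. (1 - \<delta>) * (\<Prod>k\<in>{1..<l}. gauss c k ^ count M k))"
    using del(2) c(1) \<beta> b by (intro trial_sine[OF D l _ F(1,2)]) auto
  define W where "W = (1 - \<delta>) * (1 / 2 * (\<Prod>k\<in>{1..<l}. 1 / (1 - q k)))"
  have P0: "(\<Prod>k\<in>{1..<l}. 1 / (1 - q k)) > 0" using q by (intro prod_pos) auto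
  have W0: "W > 0" unfolding W_def using P0 del(2) by simp
  have "trial D \<beta> l W"
  proof (rule trial_mono[OF tr])
    show "W \<le> (\<Sum>M\<in>F. (1 - \<delta>) * (\<Prod>k\<in>{1..<l}. gauss c k ^ count M k))"
      unfolding W_def sum_distrib_left[symmetric] using F(3) del(2) by (intro mult_left_mono) (auto simp: q_def)
  qed
  moreover have "sqrt (pi / c) / 2 * zeta_real (3 / 2) - 6 - 2 * ln (2 / c) \<le> ln W"
  proof -
    have "W = (1 - \<delta>) / 2 * (\<Prod>k\<in>{1..<l}. 1 / (1 - q k))" by (simp add: W_def)
    then have "ln W = ln ((1 - \<delta>) / 2) + ln (\<Prod>k\<in>{1..<l}. 1 / (1 - q k))"
      using P0 del(2) by (simp only:) (intro ln_mult_pos, auto)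
    also have "ln (\<Prod>k\<in>{1..<l}. 1 / (1 - q k)) = (\<Sum>k\<in>{1..<l}. ln (1 / (1 - q k)))"
      using q by (intro ln_prod) (force dest: q)+
    also have "\<dots> = (\<Sum>k\<in>{1..<l}. - ln (1 - q k))"
      using q by (intro sum.cong refl) (simp add: ln_div)
    finally have "ln W = ln ((1 - \<delta>) / 2) + (\<Sum>k\<in>{1..<l}. - ln (1 - q k))" .
    moreover have "(\<Sum>k\<in>{1..<l}. - ln (1 - q k)) \<ge> sqrt (pi / c) / 2 * zeta_real (3 / 2) - 4 - 2 * ln (2 / c)"
      unfolding q_def by (rule sum_neg_ln_ge[OF c0 c(2,3) l])
    moreover have "ln ((1 - \<delta>) / 2) \<ge> - 2"
    proof -
      have "ln (4 :: real) = 2 * ln 2" using ln_realpow[of 2 2] by simp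
      moreover have "ln (2 :: real) \<le> 1" using ln_le_minus_one[of 2] by simp
      moreover have "ln (1 / 4 :: real) = - ln 4" by (simp add: ln_div)
      moreover have "ln (1 / 4) \<le> ln ((1 - \<delta>) / 2)" using del(2) by simp
      ultimately show ?thesis by linarith
    qed
    ultimately show ?thesis by linarith
  qed
  ultimately show ?thesis using W0 by blast
qed

text \<open>\<open>t\<close> is the block length before rounding. Beyond basic positivity,
  \<open>t \<le> b\<close> yields \<open>c * l \<ge> 1\<close>, \<open>32 * b \<le> t^2\<close>
  yields \<open>c \<le> 1\<close>, the next condition bounds \<open>ln (2 / c)\<close> by
  \<open>2 * ln b\<close>, and the last one gives \<open>\<delta> \<le> 1 / 2\<close>.\<close>

definition large :: "real \<Rightarrow> bool" where
  "large b \<longleftrightarrow> (let t = b powr (5 / 8) * ln b powr (1 / 4) in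
     b > 1 \<and> ln b \<ge> 1 \<and> t \<ge> 1 \<and> t \<le> b \<and> 32 * b \<le> t\<^sup>2 \<and> 4 * t\<^sup>2 / b \<le> b\<^sup>2 \<and>
     32 * (b powr (- 1 / 8) * ln b powr (3 / 4)) \<le> 1 / 2)"

lemma eventually_large: "eventually large at_top"
  unfolding large_def Let_def by (intro eventually_conj; real_asymp)

lemma spin_values_half:
  assumes "S \<in> spin_values"
  obtains D where "D \<ge> 1" "S = half D"
  using assms by (auto simp: spin_values_def half_def)

theorem proposition4p1:
  shows "C1 = - zeta_real (3 / 2) / (2 * sqrt pi) \<and>
    (\<exists>C > 0. \<exists>K. \<forall>S \<in> spin_values. \<forall>\<beta> > 0. \<beta> * S > K \<longrightarrow>
       free_energy \<beta> S \<le> C1 * S powr (- 1 / 2) * \<beta> powr (- 3 / 2) *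
         (1 - C * ((\<beta> * S) powr (- 1 / 8) * ln (\<beta> * S) powr (3 / 4))))"
proof
  show "C1 = - zeta_real (3 / 2) / (2 * sqrt pi)" by (rule C1_eq)
  define A where "A = - C1"
  have A0: "A > 0" using zeta_half_pos by (simp add: A_def C1_eq)
  have Az: "zeta_real (3 / 2) = 2 * sqrt pi * A" by (simp add: A_def C1_eq)
  obtain K where K: "\<And>b. b > K \<Longrightarrow> large b"
    using eventually_large unfolding eventually_at_top_dense by blast
  \<comment> \<open>32 bounds the norm loss, as \<open>l \<le> 2 * t\<close> makes
    \<open>4 * l^3\<close> at most \<open>32 * t^3\<close>; \<open>12 / A\<close> covers the
    logarithmic loss \<open>10 * L\<close>, measured relative to \<open>A\<close>.\<close>
  define C where "C = 32 + 12 / A"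
  show "\<exists>C > 0. \<exists>K. \<forall>S \<in> spin_values. \<forall>\<beta> > 0. \<beta> * S > K \<longrightarrow>
       free_energy \<beta> S \<le> C1 * S powr (- 1 / 2) * \<beta> powr (- 3 / 2) *
         (1 - C * ((\<beta> * S) powr (- 1 / 8) * ln (\<beta> * S) powr (3 / 4)))"
  proof (rule exI[of _ C], rule conjI, goal_cases)
    case 1
    show "C > 0" using A0 by (simp add: C_def add_pos_pos)
  next
    case 2
    show ?case
    proof (rule exI[of _ K], intro ballI allI impI)
      fix S \<beta> :: real assume S: "S \<in> spin_values" and \<beta>: "\<beta> > 0" and bS: "\<beta> * S > K"
      obtain D where D: "D \<ge> 1" "S = half D" using S by (rule spin_values_half)
      define b where "b = \<beta> * S"
      define L where "L = ln b"
      define t where "t = b powr (5 / 8) * L powr (1 / 4)"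
      define \<epsilon> where "\<epsilon> = b powr (- 1 / 8) * L powr (3 / 4)"
      have S0: "S > 0" using D by (simp add: half_def)
      have Kb: "b > 1" "L \<ge> 1" "t \<ge> 1" "t \<le> b" "32 * b \<le> t\<^sup>2" "4 * t\<^sup>2 / b \<le> b\<^sup>2" "32 * \<epsilon> \<le> 1 / 2"
        using K[OF bS] by (auto simp: large_def Let_def b_def L_def t_def \<epsilon>_def)
      have e0: "\<epsilon> \<ge> 0" by (simp add: \<epsilon>_def)
      define l where "l = nat \<lceil>t\<rceil>"
      have "real l = of_int \<lceil>t\<rceil>" using Kb(3) by (simp add: l_def)
      then have lt: "t \<le> real l" "real l \<le> 2 * t"
        using of_int_ceiling_le_add_one[of t] le_of_int_ceiling[of t] Kb(3) by linarith+
  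
      have l1: "l \<ge> 1" using lt(1) Kb(3) by linarith
      define \<delta> where "\<delta> = 4 * real l ^ 3 / b\<^sup>2"
      have d0: "\<delta> \<ge> 0" by (simp add: \<delta>_def)
      \<comment> \<open>The choice of \<open>t\<close> makes both relative errors equal to
        \<open>\<epsilon>\<close>: here the norm loss \<open>t^3 / b^2\<close>, later the boundary
        loss \<open>sqrt b * L / t\<close>.\<close>
      have t3: "t ^ 3 / b\<^sup>2 = \<epsilon>"
      proof -
        have "(x powr a) ^ 3 = x powr (a + a + a)" for x a :: real
          unfolding power3_eq_cube powr_add ..
        then have "t ^ 3 = b powr (15 / 8) * L powr (3 / 4)" by (simp add: t_def power_mult_distrib)
        moreover have "b powr (15 / 8) = b powr (- 1 / 8) * b\<^sup>2"
          using Kb(1) by (simp add: powr_add[symmetric] flip: powr_numeral)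
        ultimately show ?thesis using Kb(1) by (simp add: \<epsilon>_def)
      qed
      have d_le: "\<delta> \<le> 32 * \<epsilon>"
      proof -
        have "real l ^ 3 \<le> (2 * t) ^ 3" using lt by (intro power_mono) auto
        then have "\<delta> \<le> 4 * (2 * t) ^ 3 / b\<^sup>2" unfolding \<delta>_def by (intro divide_right_mono) auto
        also have "\<dots> = 32 * (t ^ 3 / b\<^sup>2)" by (simp add: power_mult_distrib)
        finally show ?thesis unfolding t3 .
      qed
      then have d2: "\<delta> \<le> 1 / 2" using Kb(7) by linarith
      define c where "c = b / (1 - \<delta>) * (pi / real l)\<^sup>2"
      have pi2: "9 \<le> pi\<^sup>2" "pi\<^sup>2 \<le> 16"
        using power_mono[of 3 pi 2] power_mono[of pi 4 2] pi_gt3 pi_less_4 by auto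
      have c_ub: "c \<le> 1"
      proof -
        have "c = b * pi\<^sup>2 / ((1 - \<delta>) * (real l)\<^sup>2)" by (simp add: c_def power_divide)
        also have "\<dots> \<le> b * 16 / (1 / 2 * t\<^sup>2)"
          using Kb d2 pi2 lt by (intro frac_le mult_left_mono mult_mono power_mono mult_pos_pos) auto
        also have "\<dots> \<le> 1" using Kb by (simp add: field_simps)
        finally show ?thesis .
      qed
      have c_lb: "b * 9 / (real l)\<^sup>2 \<le> c"
      proof -
        have "b * 9 / (1 * (real l)\<^sup>2) \<le> b * pi\<^sup>2 / ((1 - \<delta>) * (real l)\<^sup>2)"
          using Kb d2 d0 pi2 l1 by (intro frac_le mult_left_mono mult_right_mono) auto
        then show ?thesis by (simp add: c_def power_divide)
      qed
      have c0: "c > 0" unfolding c_def using Kb d2 l1 by simp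
      have cl: "c * real l \<ge> 1"
      proof -
        have "1 \<le> b * 9 / (2 * t)" using Kb by (simp add: field_simps)
        also have "\<dots> \<le> b * 9 / real l" using lt Kb l1 by (intro divide_left_mono mult_pos_pos) auto
        also have "\<dots> = b * 9 / (real l)\<^sup>2 * real l" using l1 by (simp add: power2_eq_square)
        also have "\<dots> \<le> c * real l" using c_lb by (rule mult_right_mono) simp
        finally show ?thesis .
      qed
      obtain W where W: "W > 0" "trial D \<beta> l W" "sqrt (pi / c) / 2 * zeta_real (3 / 2) - 6 - 2 * ln (2 / c)
          \<le> ln W"
        using trial_lower_bound[OF D(1) l1 \<beta> _ \<delta>_def d2 c_def c_ub cl] by (auto simp: b_def D(2))
      have ln_c: "2 * ln (2 / c) \<le> 4 * L"
      proof -
        have "2 / c \<le> 2 / (b * 9 / (real l)\<^sup>2)"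
          using c_lb c0 Kb l1 by (intro divide_left_mono mult_pos_pos divide_pos_pos) auto
        also have "\<dots> \<le> (real l)\<^sup>2 / b" using Kb by (simp add: field_simps)
        also have "\<dots> \<le> (2 * t)\<^sup>2 / b" using lt Kb by (intro divide_right_mono power_mono) auto
        also have "\<dots> \<le> b\<^sup>2" using Kb(6) by (simp add: power_mult_distrib)
        finally have "ln (2 / c) \<le> ln (b\<^sup>2)" using c0 Kb by (subst ln_le_cancel_iff) auto
        also have "\<dots> = 2 * L" using Kb by (simp add: L_def ln_realpow)
        finally show ?thesis by simp
      qed
      \<comment> \<open>The leading term: the factors of pi cancel between \<open>c\<close> and the
        zeta value, leaving \<open>sqrt (1 - \<delta>) * l * A / sqrt b\<close>, and
        \<open>sqrt (1 - \<delta>) \<ge> 1 - \<delta>\<close>.\<close>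
      have main: "real l * A * (1 - \<delta>) / sqrt b \<le> sqrt (pi / c) / 2 * zeta_real (3 / 2)"
      proof -
        have "pi / c = (1 - \<delta>) * (real l)\<^sup>2 / (pi * b)"
          using Kb d2 l1 by (simp add: c_def power_divide power2_eq_square field_simps)
        then have "sqrt (pi / c) = sqrt (1 - \<delta>) * real l / (sqrt pi * sqrt b)"
          by (simp add: real_sqrt_divide real_sqrt_mult)
        then have "sqrt (pi / c) / 2 * zeta_real (3 / 2) = sqrt (1 - \<delta>) * (real l * A / sqrt b)"
          unfolding Az by simp
        also have "\<dots> \<ge> (1 - \<delta>) * (real l * A / sqrt b)"
        proof (rule mult_right_mono)
          have "(1 - \<delta>)\<^sup>2 \<le> 1 - \<delta>" using d0 d2 by (simp add: power2_eq_square mult_left_le)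
          then show "1 - \<delta> \<le> sqrt (1 - \<delta>)" by (rule real_le_rsqrt)
        qed (use A0 Kb in auto)
        finally show ?thesis by (simp add: mult_ac)
      qed
      \<comment> \<open>The constant 6 is absorbed into \<open>6 * L\<close> because
        \<open>L \<ge> 1\<close>; with \<open>4 * L\<close> from the logarithm this makes
        10.\<close>
      have "ln W \<ge> real l * A * (1 - \<delta>) / sqrt b - 10 * L" using W(3) main ln_c Kb(2) by linarith
      then have "ln W / real l \<ge> (real l * A * (1 - \<delta>) / sqrt b - 10 * L) / real l"
        by (rule divide_right_mono) simp
      moreover have "(real l * A * (1 - \<delta>) / sqrt b - 10 * L) / real l = A * (1 - \<delta>) / sqrt b - 10 * L / real l"
        using l1 by (simp add: diff_divide_distrib)
      moreover have "10 * L / real l \<le> 10 * (\<epsilon> / sqrt b)"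
      proof -
        have "L / real l \<le> L / t" using lt Kb by (intro divide_left_mono mult_pos_pos) auto
        also have "\<dots> = \<epsilon> / sqrt b"
        proof -
          have "L powr 1 = L powr (3 / 4 + 1 / 4)" by simp
          then have "L = L powr (3 / 4) * L powr (1 / 4)" using Kb(2) by (subst (asm) powr_add) simp
          moreover have "b powr (5 / 8) * b powr (- 1 / 8) = sqrt b"
            using Kb(1) by (simp add: powr_add[symmetric] powr_half_sqrt)
          moreover have "L powr (1 / 4) > 0" "b powr (5 / 8) > 0" "sqrt b > 0" using Kb by auto
          ultimately show ?thesis unfolding t_def \<epsilon>_def by (simp add: field_simps)
        qed
        finally show ?thesis by simp
      qed
      moreover have "A * (1 - 32 * \<epsilon>) / sqrt b \<le> A * (1 - \<delta>) / sqrt b"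
        using d_le A0 Kb by (intro divide_right_mono mult_left_mono) auto
      ultimately have "A * (1 - 32 * \<epsilon>) / sqrt b - 10 * (\<epsilon> / sqrt b) \<le> ln W / real l" by linarith
      moreover have "A / sqrt b * (1 - C * \<epsilon>) \<le> A * (1 - 32 * \<epsilon>) / sqrt b - 10 * (\<epsilon> / sqrt b)"
      proof -
        have "A * (1 - C * \<epsilon>) \<le> A * (1 - 32 * \<epsilon>) - 10 * \<epsilon>"
          using A0 e0 by (simp add: C_def algebra_simps)
        then have "A * (1 - C * \<epsilon>) / sqrt b \<le> (A * (1 - 32 * \<epsilon>) - 10 * \<epsilon>) / sqrt b"
          by (rule divide_right_mono) (use Kb in simp)
        then show ?thesis by (simp add: diff_divide_distrib)
      qed
      ultimately have "A / sqrt b * (1 - C * \<epsilon>) / \<beta> \<le> ln W / real l / \<beta>"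
        using \<beta> by (intro divide_right_mono) auto
      moreover have "free_energy \<beta> S \<le> - (ln W / real l) / \<beta>"
        unfolding D(2) by (rule free_energy_le_trial[OF D(1) \<beta> l1 W(2,1)])
      ultimately have "free_energy \<beta> S \<le> C1 / (sqrt b * \<beta>) * (1 - C * \<epsilon>)"
        by (simp add: A_def)
      also have "C1 / (sqrt b * \<beta>) = C1 * S powr (- 1 / 2) * \<beta> powr (- 3 / 2)"
      proof -
        have "S powr (- 1 / 2) = 1 / sqrt S" using S0 by (simp add: powr_minus_divide powr_half_sqrt)
        moreover have "\<beta> powr (- 3 / 2) = 1 / (sqrt \<beta> * \<beta>)"
        proof -
          have "\<beta> powr (- 3 / 2) = \<beta> powr (- (1 / 2) + - 1)" by simp
          also have "\<dots> = \<beta> powr (- (1 / 2)) * \<beta> powr - 1" by (rule powr_add)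
          finally show ?thesis using \<beta> by (simp add: powr_minus_divide powr_half_sqrt)
        qed
        ultimately show ?thesis by (simp add: b_def real_sqrt_mult)
      qed
      finally show "free_energy \<beta> S \<le> C1 * S powr (- 1 / 2) * \<beta> powr (- 3 / 2) *
           (1 - C * ((\<beta> * S) powr (- 1 / 8) * ln (\<beta> * S) powr (3 / 4)))"
        by (simp add: \<epsilon>_def b_def L_def)
    qed
  qed
qed

end
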